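(* Let $b$ be the Coxeter-type representative with $\mathrm{ord}\,\lambda(b)=k\in\{0,1\}$. Then the varieties $X_h$ and the components $\dot X^m_{w_r}(b)_{\mathcal L}$ of affine Deligne–Lusztig varieties coincide at infinite level: on $\overline{\mathbb F}_q$-points there are natural isomorphisms (bijections) and an inclusion $$\varprojlim_{h}X_h\;\simeq\;\mathcal L_b^{\mathrm{symp,rat}}\;\simeq\;\varprojlim_{r>m}\dot X^m_{w_r}(b)_{\mathcal L}\;\subset\;\varprojlim_{r>m}\dot X^m_{w_r}(b)\;\simeq\;X_w^{(U)}(b),$$ where the first isomorphism is induced by $v\mapsto(v\bmod\mathcal L^{(h)})_{h\ge1}$, the second by $v\mapsto(g_{b,r}(v)\dot I^m)_{r>m\geq 0}$, and the last is the bijection under which, for $v\in V_b^{\mathrm{symp}}$ with $\langle v,F^n(v)\rangle\in K^\times$, the class $g_{b,0}(v)U(\breve K)$ corresponds to $(g_{b,r}(v)\dot I^m)_{r>m\ge0}$.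
   Context: Setting. $K$ is a non-archimedean local field with residue field $\mathbb F_q$, ring of integers $\mathcal O_K$ and uniformizer $\varpi$; $\breve K$ is the completion of its maximal unramified extension, with ring of integers $\mathcal O$, maximal ideal $\mathfrak p$, residue field $\overline{\mathbb F}_q$; $\sigma$ is the Frobenius of $\breve K/K$. Let $n\ge1$, $V=\breve K^{2n}$ with standard basis $e_1,\dots,e_{2n}$ and symplectic form $\langle x,y\rangle={}^tx\,\Omega\,y$, where $\Omega$ is the antidiagonal $2n\times2n$ matrix with all antidiagonal entries $1$, multiplied on the right by $\mathrm{diag}(1,-1,\dots,1,-1)$. $G=\mathrm{GSp}_{2n}$ is its similitude group, with similitude character $\lambda$. Coxeter-type representative: $b=b_0A_k$, where $b_0e_i=e_{i+1}$ $(1\le i\le n-1)$, $b_0e_n=e_{2n}$, $b_0e_{n+1}=(-1)^{n+1}e_1$, $b_0e_{n+i}=e_{n+i-1}$ $(2\le i\le n)$ and $A_k=\mathrm{diag}(1,\varpi^k,\dots,1,\varpi^k)$; then $\lambda(b)=-\varpi^k$. Put $F=b\sigma$, $V_k=\varpi^kF^{-1}$. $V_b^{\mathrm{symp}}:=\{v\in V\mid\langle v,F^i(v)\rangle=0\ (1\le i\le n-1),\ \langle v,F^n(v)\rangle\ne0\}$. The lattice $\mathcal L$ is $\bigoplus_{i=1}^{2n}\mathcal Oe_i$ if $n$ is odd, and $\bigoplus_{i=1}^n\mathcal Oe_i\oplus\mathfrak p^ke_{n+1}\oplus\mathcal Oe_{n+2}\oplus\cdots\oplus\mathfrak p^ke_{2n-1}\oplus\mathcal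 Oe_{2n}$ if $n$ is even. $\mathcal L_b^{\mathrm{symp,rat}}:=\{v\in V_b^{\mathrm{symp}}\cap\mathcal L\mid\langle v,F^n(v)\rangle\in\varpi^{\lfloor kn/2\rfloor}\mathcal O_K^\times\}$. The varieties $X_h$ ($h\ge1$). Define $\mathcal L^{(h)}\subset\mathcal L$: if $k=0$, $\mathcal L^{(h)}=\bigoplus_{i}\mathfrak p^he_i$; if $k=1$ and $n$ is even, $\mathcal L^{(h)}=\mathfrak p^he_1\oplus\mathfrak p^{h-1}e_2\oplus\cdots\oplus\mathfrak p^he_{n-1}\oplus\mathfrak p^{h-1}e_n\oplus\bigoplus_{i>n}\mathfrak p^he_i$; if $k=1$ and $n$ is odd, $\mathcal L^{(h)}=\mathfrak p^he_1\oplus\mathfrak p^{h-1}e_2\oplus\cdots\oplus\mathfrak p^he_{2n-1}\oplus\mathfrak p^{h-1}e_{2n}$. $X_h$ is the subscheme of $\mathcal L/\mathcal L^{(h)}$ whose $\overline{\mathbb F}_q$-points are the classes $v$ such that $\langle v,F^i(v)\rangle\equiv0\bmod\mathfrak p^{h+\lfloor ki/2\rfloor}$ for $1\le i\le n-1$ and $\langle v,F^n(v)\rangle\bmod\mathfrak p^{h+\lfloor kn/2\rfloor}$ lies in the image of $\varpi^{\lfloor kn/2\rfloor}\mathcal O_K^\times$. Transition maps $X_{h+1}\to X_h$ are the natural projections. For $v\in V_b^{\mathrm{symp}}$ and $\alpha_v=\langle v,F^n(v)\rangle$ set $G_1(v):=(-1)^{n+1}\frac{\alpha_v}{\sigma^{-1}(\alpha_v)}\bigl(V_k(v)-\frac{\langle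 V_k(v),F^n(v)\rangle}{\alpha_v}v\bigr)$, $G_{i+1}(v):=\frac{\alpha_v}{\sigma^{-1}(\alpha_v)}\bigl(V_k(G_i(v))-\frac{\langle V_k(G_i(v)),F^n(v)\rangle}{\alpha_v}v\bigr)$ for $1\le i\le n-2$, and let $g_{b,r}(v)\in G(\breve K)$ be the matrix with columns $(v,\varpi^rF(v),\dots,\varpi^{(n-1)r}F^{n-1}(v),\varpi^rG_1(v),\dots,\varpi^{(n-1)r}G_{n-1}(v),\varpi^{nr}F^n(v))$. $w_r\in G(\breve K)$: $w_re_i=\varpi^{-r}e_{i+1}$ $(1\le i\le n-1)$, $w_re_n=\varpi^{-r}e_{2n}$, $w_re_{n+1}=(-1)^{n+1}\varpi^{r+k}e_1$, $w_re_{n+i}=\varpi^{r+k}e_{n+i-1}$ $(2\le i\le n)$; $w=w_0$. $U$ is the group of upper triangular unipotent matrices in $G$, and $X_w^{(U)}(b)=\{g\in G(\breve K)/U(\breve K)\mid g^{-1}b\sigma(g)\in U(\breve K)wU(\breve K)\}$. $\dot I^m\subset G(\breve K)$ is the subgroup of matrices with diagonal entries in $1+\mathfrak p^{m+1}$, entries above the diagonal in $\mathfrak p^{m+1}$ and below the diagonal in $\mathfrak p^m$; $\dot X^m_{w_r}(b)(\overline{\mathbb F}_q)=\{g\dot I^m\mid g^{-1}b\sigma(g)\in\dot I^mw_r\dot I^m\}$. For $r>m$ it is known that $\dot X^m_{w_r}(b)(\overline{\mathbb F}_q)=\{g_{b,r}(v)\dot I^m\mid v\in V_b^{\mathrm{symp}},\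 \sigma(\alpha_v)/\alpha_v\equiv1\bmod\mathfrak p^{m+1}\}$, and that there are well-defined transition maps, in $r$ given by $g_{b,r+1}(v)\dot I^m\mapsto g_{b,r}(v)\dot I^m$ and in $m$ by the natural projection; inverse limits are over pairs $r>m\ge0$. Finally $\dot X^m_{w_r}(b)_{\mathcal L}:=\{g_{b,r}(v)\dot I^m\mid v\in\mathcal L_b^{\mathrm{symp,rat}}\}\subset\dot X^m_{w_r}(b)(\overline{\mathbb F}_q)$. *)

theory Defs
  imports
    "HOL-Algebra.Algebraic_Closure_Type"
    "HOL-Algebra.Embedded_Algebras"
    "Jordan_Normal_Form.Matrix"
    "Jordan_Normal_Form.Gauss_Jordan_Elimination"
begin

section \<open>Local fields and the completed maximal unramified extension\<close>

text \<open>
  A normalized discrete valuation on a subfield \<open>E\<close> of an ambient field. The value at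
  \<open>0\<close> carries no information; the convention \<open>v 0 = \<infinity>\<close> is built into \<open>ppow\<close>.
\<close>

definition discrete_valuation_on :: "'a::field set \<Rightarrow> ('a \<Rightarrow> int) \<Rightarrow> bool" where
  "discrete_valuation_on E v \<longleftrightarrow>
     (\<forall>x\<in>E - {0}. \<forall>y\<in>E - {0}. v (x * y) = v x + v y) \<and>
     (\<forall>x\<in>E - {0}. \<forall>y\<in>E - {0}. x + y \<noteq> 0 \<longrightarrow> min (v x) (v y) \<le> v (x + y)) \<and>
     v ` (E - {0}) = UNIV"

definition ppow :: "('a::field \<Rightarrow> int) \<Rightarrow> int \<Rightarrow> 'a set" where
  "ppow v N = {x. x = 0 \<or> N \<le> v x}"

definition val_complete :: "('a::field \<Rightarrow> int) \<Rightarrow> bool" where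
  "val_complete v \<longleftrightarrow>
     (\<forall>s :: nat \<Rightarrow> 'a.
        (\<forall>N. \<exists>M. \<forall>i\<ge>M. \<forall>j\<ge>M. s i - s j \<in> ppow v N) \<longrightarrow>
        (\<exists>x. \<forall>N. \<exists>M. \<forall>i\<ge>M. s i - x \<in> ppow v N))"

definition residue_field :: "('a::field \<Rightarrow> int) \<Rightarrow> 'a set set" where
  "residue_field v = (\<lambda>x. (+) x ` ppow v 1) ` ppow v 0"

definition nonarch_local_field :: "('a::field \<Rightarrow> int) \<Rightarrow> bool" where
  "nonarch_local_field v \<longleftrightarrow>
     discrete_valuation_on UNIV v \<and> val_complete v \<and> finite (residue_field v)"

text \<open>
  Finite unramified extensions inside the algebraic closure: the normalized valuation of
  \<open>K\<close> extends to an integer-valued valuation, i.e. the ramification index is \<open>1\<close>. Separability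
  of the residue extension is automatic, as it is only used for finite residue fields.
\<close>

definition finite_unramified_extension ::
  "('k::field \<Rightarrow> int) \<Rightarrow> 'k alg_closure set \<Rightarrow> bool" where
  "finite_unramified_extension v E \<longleftrightarrow>
     range to_ac \<subseteq> E \<and>
     subfield E ring_of_type_algebra \<and>
     ring.finite_dimension ring_of_type_algebra (range to_ac) E \<and>
     (\<exists>w. discrete_valuation_on E w \<and> (\<forall>x. x \<noteq> 0 \<longrightarrow> w (to_ac x) = v x))"

definition max_unramified_extension :: "('k::field \<Rightarrow> int) \<Rightarrow> 'k alg_closure set" where
  "max_unramified_extension v = \<Union> {E. finite_unramified_extension v E}"

text \<open>
  \<open>'k\<close> is the local field, \<open>'l\<close> the completion of its maximal unramified extension. Only the
  values of \<open>emb\<close> on the maximal unramified extension matter.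
\<close>

record (overloaded) ('k, 'l) local_datum =
  ordK :: "'k \<Rightarrow> int"
  unifK :: 'k
  emb :: "'k alg_closure \<Rightarrow> 'l"
  ordL :: "'l \<Rightarrow> int"
  frobL :: "'l \<Rightarrow> 'l"

definition embK :: "('k::field, 'l::field) local_datum \<Rightarrow> 'k \<Rightarrow> 'l" where
  "embK D x = emb D (to_ac x)"

text \<open>
  \<open>ordL D \<circ> emb D\<close> is a valuation on the maximal unramified extension that extends \<open>ordK D\<close>, hence
  it is the unique such valuation.
\<close>

definition is_completed_max_unramified :: "('k::field, 'l::field) local_datum \<Rightarrow> bool" where
  "is_completed_max_unramified D \<longleftrightarrow>
     discrete_valuation_on UNIV (ordL D) \<and> val_complete (ordL D) \<and>
     emb D \<in> Ring.ring_hom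
       (ring_of_type_algebra \<lparr>carrier := max_unramified_extension (ordK D)\<rparr>) ring_of_type_algebra \<and>
     (\<forall>x. x \<noteq> 0 \<longrightarrow> ordL D (embK D x) = ordK D x) \<and>
     (\<forall>x N. \<exists>y\<in>max_unramified_extension (ordK D). x - emb D y \<in> ppow (ordL D) N)"

text \<open>
  The Frobenius is the continuous automorphism over \<open>K\<close> that acts on the residue field as
  \<open>x \<mapsto> x ^ q\<close>, where \<open>q\<close> is the cardinality of the residue field of \<open>K\<close>.
\<close>

definition is_frobenius :: "('k::field, 'l::field) local_datum \<Rightarrow> bool" where
  "is_frobenius D \<longleftrightarrow>
     frobL D \<in> ring_iso ring_of_type_algebra ring_of_type_algebra \<and>
     (\<forall>x. x \<noteq> 0 \<longrightarrow> ordL D (frobL D x) = ordL D x) \<and>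
     (\<forall>x. frobL D (embK D x) = embK D x) \<and>
     (\<forall>x\<in>ppow (ordL D) 0.
        frobL D x - x ^ card (residue_field (ordK D)) \<in> ppow (ordL D) 1)"

definition is_local_datum :: "('k::field, 'l::field) local_datum \<Rightarrow> bool" where
  "is_local_datum D \<longleftrightarrow>
     nonarch_local_field (ordK D) \<and>
     unifK D \<noteq> 0 \<and> ordK D (unifK D) = 1 \<and>
     is_completed_max_unramified D \<and> is_frobenius D"


section \<open>The symplectic space and the Coxeter-type representative\<close>

text \<open>
  Indices of the Jordan-Normal-Form library start at \<open>0\<close>. Vectors \<open>basis n i\<close> use the
  indices \<open>1, \<dots>, 2n\<close>.
\<close>

definition basis :: "nat \<Rightarrow> nat \<Rightarrow> 'l::field vec" where
  "basis n i = unit_vec (2 * n) (i - 1)"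

definition Omega :: "nat \<Rightarrow> 'l::field mat" where
  "Omega n = mat (2 * n) (2 * n) (\<lambda>(i, j). if i + j + 1 = 2 * n then 1 else 0) *
     mat_diag (2 * n) (\<lambda>i. if even i then 1 else - 1)"

definition sform :: "nat \<Rightarrow> 'l::field vec \<Rightarrow> 'l vec \<Rightarrow> 'l" where
  "sform n x y = x \<bullet> (Omega n *\<^sub>v y)"

definition GSp :: "nat \<Rightarrow> 'l::field mat set" where
  "GSp n = {g \<in> carrier_mat (2 * n) (2 * n).
     \<exists>c. c \<noteq> 0 \<and> g\<^sup>T * Omega n * g = c \<cdot>\<^sub>m Omega n}"

definition lcoset :: "'l::field mat \<Rightarrow> 'l mat set \<Rightarrow> 'l mat set" where
  "lcoset g H = (\<lambda>h. g * h) ` H"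

definition b0 :: "nat \<Rightarrow> 'l::field mat" where
  "b0 n = mat_of_cols (2 * n) (map (\<lambda>j.
     if j < n then basis n (j + 1)
     else if j = n then basis n (2 * n)
     else if j = n + 1 then (- 1) ^ (n + 1) \<cdot>\<^sub>v basis n 1
     else basis n (j - 1)) [1..<2 * n + 1])"

definition U_unip :: "nat \<Rightarrow> 'l::field mat set" where
  "U_unip n = {g \<in> GSp n. (\<forall>i<2 * n. g $$ (i, i) = 1) \<and>
     (\<forall>i<2 * n. \<forall>j<i. g $$ (i, j) = 0)}"

context
  fixes D :: "('k::field, 'l::field) local_datum" and n k :: nat
begin

abbreviation \<pi> :: 'l where "\<pi> \<equiv> embK D (unifK D)"
abbreviation \<sigma> :: "'l \<Rightarrow> 'l" where "\<sigma> \<equiv> frobL D"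
abbreviation \<sigma>inv :: "'l \<Rightarrow> 'l" where "\<sigma>inv \<equiv> inv_into UNIV (frobL D)"
abbreviation pp :: "int \<Rightarrow> 'l set" where "pp \<equiv> ppow (ordL D)"

definition unitsK :: "'l set" where
  "unitsK = embK D ` {u. u \<noteq> 0 \<and> ordK D u = 0}"

definition KtimesL :: "'l set" where
  "KtimesL = embK D ` (UNIV - {0})"

definition A_mat :: "'l mat" where
  "A_mat = mat_diag (2 * n) (\<lambda>i. if even i then 1 else \<pi> ^ k)"

definition b_mat :: "'l mat" where
  "b_mat = b0 n * A_mat"

definition Fr :: "'l vec \<Rightarrow> 'l vec" where
  "Fr v = b_mat *\<^sub>v map_vec \<sigma> v"

definition Ver :: "'l vec \<Rightarrow> 'l vec" where
  "Ver v = \<pi> ^ k \<cdot>\<^sub>v inv_into (carrier_vec (2 * n)) Fr v"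

definition alpha :: "'l vec \<Rightarrow> 'l" where
  "alpha v = sform n v ((Fr ^^ n) v)"

definition V_symp :: "'l vec set" where
  "V_symp = {v \<in> carrier_vec (2 * n).
     (\<forall>i. 1 \<le> i \<and> i \<le> n - 1 \<longrightarrow> sform n v ((Fr ^^ i) v) = 0) \<and> alpha v \<noteq> 0}"


section \<open>The lattices and the varieties of level \<open>h\<close>\<close>

definition lattice_of :: "(nat \<Rightarrow> int) \<Rightarrow> 'l vec set" where
  "lattice_of a = {v \<in> carrier_vec (2 * n). \<forall>i\<in>{1..2 * n}. v $ (i - 1) \<in> pp (a i)}"

definition Lat :: "'l vec set" where
  "Lat = lattice_of (\<lambda>i. if even n \<and> n < i \<and> odd i then int k else 0)"

definition Lat_h :: "nat \<Rightarrow> 'l vec set" where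
  "Lat_h h = lattice_of (\<lambda>i.
     if k = 0 then int h
     else if even n \<and> n < i then int h
     else if odd i then int h else int h - 1)"

definition L_symp_rat :: "'l vec set" where
  "L_symp_rat = {v \<in> V_symp \<inter> Lat. alpha v \<in> (\<lambda>u. \<pi> ^ (k * n div 2) * u) ` unitsK}"

definition vclass :: "nat \<Rightarrow> 'l vec \<Rightarrow> 'l vec set" where
  "vclass h v = (\<lambda>u. v + u) ` Lat_h h"

text \<open>Points over the algebraic closure of the residue field, as classes in \<open>Lat / Lat_h h\<close>.\<close>

definition X_level :: "nat \<Rightarrow> 'l vec set set" where
  "X_level h = vclass h ` {v \<in> Lat.
     (\<forall>i. 1 \<le> i \<and> i \<le> n - 1 \<longrightarrow>
        sform n v ((Fr ^^ i) v) \<in> pp (int h + int (k * i div 2))) \<and>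
     (\<exists>u\<in>unitsK. alpha v - \<pi> ^ (k * n div 2) * u \<in> pp (int h + int (k * n div 2)))}"

definition X_proj :: "nat \<Rightarrow> 'l vec set \<Rightarrow> 'l vec set" where
  "X_proj h C = {x + u | x u. x \<in> C \<and> u \<in> Lat_h h}"

definition X_limit :: "(nat \<Rightarrow> 'l vec set) set" where
  "X_limit = {x \<in> \<Pi>\<^sub>E h\<in>{1..}. X_level h. \<forall>h\<ge>1. X_proj h (x (h + 1)) = x h}"

definition v_classes :: "'l vec \<Rightarrow> nat \<Rightarrow> 'l vec set" where
  "v_classes v = (\<lambda>h\<in>{1..}. vclass h v)"


section \<open>Affine Deligne--Lusztig sets of Coxeter type\<close>

definition G_step :: "'l vec \<Rightarrow> 'l vec \<Rightarrow> 'l vec" where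
  "G_step v u = (alpha v / \<sigma>inv (alpha v)) \<cdot>\<^sub>v
     (Ver u - (sform n (Ver u) ((Fr ^^ n) v) / alpha v) \<cdot>\<^sub>v v)"

text \<open>Index shift: \<open>G_vec v i\<close> is the vector \<open>G\<^sub>i\<^sub>+\<^sub>1(v)\<close>.\<close>

primrec G_vec :: "'l vec \<Rightarrow> nat \<Rightarrow> 'l vec" where
  "G_vec v 0 = (- 1) ^ (n + 1) \<cdot>\<^sub>v G_step v v"
| "G_vec v (Suc i) = G_step v (G_vec v i)"

definition g_mat :: "nat \<Rightarrow> 'l vec \<Rightarrow> 'l mat" where
  "g_mat r v = mat_of_cols (2 * n)
     (map (\<lambda>i. \<pi> ^ (i * r) \<cdot>\<^sub>v (Fr ^^ i) v) [0..<n] @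
      map (\<lambda>i. \<pi> ^ (i * r) \<cdot>\<^sub>v G_vec v (i - 1)) [1..<n] @
      [\<pi> ^ (n * r) \<cdot>\<^sub>v (Fr ^^ n) v])"

definition w_mat :: "nat \<Rightarrow> 'l mat" where
  "w_mat r = mat_of_cols (2 * n) (map (\<lambda>j.
     if j < n then (\<pi> powi (- int r)) \<cdot>\<^sub>v basis n (j + 1)
     else if j = n then (\<pi> powi (- int r)) \<cdot>\<^sub>v basis n (2 * n)
     else if j = n + 1 then ((- 1) ^ (n + 1) * \<pi> ^ (r + k)) \<cdot>\<^sub>v basis n 1
     else \<pi> ^ (r + k) \<cdot>\<^sub>v basis n (j - 1)) [1..<2 * n + 1])"

definition I_dot :: "nat \<Rightarrow> 'l mat set" where
  "I_dot m = {g \<in> GSp n. \<forall>i<2 * n. \<forall>j<2 * n.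
     (i = j \<longrightarrow> g $$ (i, j) - 1 \<in> pp (int m + 1)) \<and>
     (i < j \<longrightarrow> g $$ (i, j) \<in> pp (int m + 1)) \<and>
     (j < i \<longrightarrow> g $$ (i, j) \<in> pp (int m))}"

text \<open>The set of \<open>g H\<close> such that \<open>g\<^sup>-\<^sup>1 b \<sigma>(g)\<close> lies in the double coset \<open>H w H\<close>.\<close>

definition adlv :: "'l mat set \<Rightarrow> 'l mat \<Rightarrow> 'l mat set set" where
  "adlv H w = {lcoset g H | g. g \<in> GSp n \<and>
     (\<exists>x\<in>H. \<exists>y\<in>H. the (mat_inverse g) * b_mat * map_mat \<sigma> g = x * w * y)}"

definition X_U :: "'l mat set set" where
  "X_U = adlv (U_unip n) (w_mat 0)"

definition X_dot :: "nat \<Rightarrow> nat \<Rightarrow> 'l mat set set" where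
  "X_dot r m = adlv (I_dot m) (w_mat r)"

definition X_dot_L :: "nat \<Rightarrow> nat \<Rightarrow> 'l mat set set" where
  "X_dot_L r m = (\<lambda>v. lcoset (g_mat r v) (I_dot m)) ` L_symp_rat"

text \<open>
  The transition map from \<open>(r + 1, m)\<close> to \<open>(r, m)\<close>, given by its graph. The map is everywhere
  defined and single-valued since for \<open>r > m\<close> every element of \<open>X_dot r m\<close> is represented by
  some \<open>g_mat r v\<close> with \<open>v\<close> as below, and the class of \<open>g_mat (r + 1) v\<close> determines that of
  \<open>g_mat r v\<close>.
\<close>

definition r_transition :: "nat \<Rightarrow> nat \<Rightarrow> ('l mat set \<times> 'l mat set) set" where
  "r_transition r m =
     {(lcoset (g_mat (r + 1) v) (I_dot m), lcoset (g_mat r v) (I_dot m)) | v.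
        v \<in> V_symp \<and> \<sigma> (alpha v) / alpha v - 1 \<in> pp (int m + 1)}"

definition m_projection :: "nat \<Rightarrow> 'l mat set \<Rightarrow> 'l mat set" where
  "m_projection m C = {x * y | x y. x \<in> C \<and> y \<in> I_dot m}"

abbreviation rm_index :: "(nat \<times> nat) set" where
  "rm_index \<equiv> {(r, m). m < r}"

definition dot_limit :: "(nat \<Rightarrow> nat \<Rightarrow> 'l mat set set) \<Rightarrow> (nat \<times> nat \<Rightarrow> 'l mat set) set" where
  "dot_limit Y = {x \<in> \<Pi>\<^sub>E (r, m)\<in>rm_index. Y r m.
     (\<forall>r m. m < r \<longrightarrow> (x (r + 1, m), x (r, m)) \<in> r_transition r m) \<and>
     (\<forall>r m. m + 1 < r \<longrightarrow> m_projection m (x (r, m + 1)) = x (r, m))}"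

definition g_classes :: "'l vec \<Rightarrow> nat \<times> nat \<Rightarrow> 'l mat set" where
  "g_classes v = (\<lambda>(r, m)\<in>rm_index. lcoset (g_mat r v) (I_dot m))"

end

end

theory Submission
  imports Defs "Jordan_Normal_Form.Determinant"
begin

text \<open>
  All bijections are controlled by the first column of \<open>g_mat r v\<close>, which is \<open>v\<close> itself. The
  crucial point is integrality. Since \<open>F\<close> is isoclinic of slope \<open>k / 2\<close>, all iterates \<open>F\<^sup>j v\<close> of a
  cyclic vector are integral combinations of the first \<open>2n\<close> of them, up to the normalization by the
  slope. For \<open>v\<close> in \<open>V_symp\<close> this says that \<open>\<langle>v, F\<^sup>j v\<rangle>\<close> is an integral multiple of
  \<open>\<alpha> = \<langle>v, F\<^sup>n v\<rangle>\<close> for every \<open>j\<close>, and hence the lattice spanned by the columns of \<open>g_mat 0 v\<close> is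
  self-dual up to the scalar \<open>\<alpha>\<close> and stable under \<open>F\<close> and \<open>V\<close>. Consequently, a vector \<open>u\<close> congruent
  to \<open>v\<close> modulo \<open>p\<^sup>N\<close> times this lattice has \<open>g_mat 0 u\<close> congruent to \<open>g_mat 0 v\<close>. This makes the
  transition maps single-valued and lets compatible systems of cosets converge. The matrices of
  level \<open>r\<close> arise from level \<open>0\<close> by multiplication with a diagonal matrix of powers of the uniformizer.
\<close>

text \<open>Membership in K is handled as invariance under \<sigma>. That the fixed field of
  \<sigma> is K follows from the data: the residue field of K already supplies q roots of X^q - X,
  and K is complete. The slope k/2 need not be an integer, so valuations are doubled. The weights
  \<open>W\<close> define a norm that \<open>F\<close> and \<open>V\<close> raise by k in this
  scale, and its unit ball is \<open>Lat\<close>. This one norm gives both the lower bound that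
  makes the minimality argument for integrality possible and the stability of \<open>Lat\<close>.
  Both sides of the last bijection are parametrized by the same set, the v in \<open>V_symp\<close>
  with \<alpha> in K. The link is a factorization b \<sigma>(g) = g w y for g =
  \<open>g_mat r v\<close>, where y is unipotent and differs from the identity only in an upper
  right block divisible by the r-th power of the uniformizer. For r = 0 this places y in U, for r >
  m in \<open>I_dot m\<close>. Conversely, an element of \<open>X_U\<close> has a representative
  whose first column is a vector v of this kind and generates the whole basis.\<close>

no_notation fps_nth (infixl "$" 75)

section \<open>Valuations and the fixed field of the Frobenius\<close>

locale valuation =
  fixes ord :: "'a::field \<Rightarrow> int"
  assumes dv: "discrete_valuation_on UNIV ord"
begin

abbreviation P :: "int \<Rightarrow> 'a set" where "P \<equiv> ppow ord"

lemma ord_mult: "x \<noteq> 0 \<Longrightarrow> y \<noteq> 0 \<Longrightarrow> ord (x * y) = ord x + ord y"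
  using dv by (auto simp: discrete_valuation_on_def)

lemma ord_add: "x \<noteq> 0 \<Longrightarrow> y \<noteq> 0 \<Longrightarrow> x + y \<noteq> 0 \<Longrightarrow> min (ord x) (ord y) \<le> ord (x + y)"
  using dv by (auto simp: discrete_valuation_on_def)

lemma ord_one [simp]: "ord 1 = 0"
  using ord_mult[of 1 1] by simp

lemma ord_minus_one [simp]: "ord (- 1) = 0"
  using ord_mult[of "- 1" "- 1"] by simp

lemma ord_minus [simp]: "ord (- x) = ord x"
  using ord_mult[of "- 1" x] by (cases "x = 0") auto

lemma ord_inverse: "x \<noteq> 0 \<Longrightarrow> ord (inverse x) = - ord x"
  using ord_mult[of x "inverse x"] by simp

lemma ord_divide: "x \<noteq> 0 \<Longrightarrow> y \<noteq> 0 \<Longrightarrow> ord (x / y) = ord x - ord y"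
  by (simp add: divide_inverse ord_mult ord_inverse)

lemma ord_power: "x \<noteq> 0 \<Longrightarrow> ord (x ^ j) = int j * ord x"
  by (induction j) (auto simp: ord_mult algebra_simps)

lemma ppow_zero [simp]: "0 \<in> P N"
  by (simp add: ppow_def)

lemma ppow_iff: "x \<noteq> 0 \<Longrightarrow> x \<in> P N \<longleftrightarrow> N \<le> ord x"
  by (simp add: ppow_def)

lemma ppow_self: "x \<in> P (ord x)"
  by (simp add: ppow_def)

lemma ppow_minus: "x \<in> P N \<Longrightarrow> - x \<in> P N"
  by (auto simp: ppow_def)

lemma ppow_minus_iff [simp]: "- x \<in> P N \<longleftrightarrow> x \<in> P N"
  using ppow_minus[of x N] ppow_minus[of "- x" N] by auto

lemma ppow_add: "x \<in> P N \<Longrightarrow> y \<in> P N \<Longrightarrow> x + y \<in> P N"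
  using ord_add[of x y] by (cases "x = 0"; cases "y = 0"; cases "x + y = 0") (auto simp: ppow_def)

lemma ppow_diff: "x \<in> P N \<Longrightarrow> y \<in> P N \<Longrightarrow> x - y \<in> P N"
  using ppow_add[of x N "- y"] by simp

lemma ppow_diff_commute: "x - y \<in> P N \<longleftrightarrow> y - x \<in> P N"
  using ppow_minus_iff[of "x - y" N] by simp

lemma ppow_trans: "x - y \<in> P N \<Longrightarrow> y - z \<in> P N \<Longrightarrow> x - z \<in> P N"
  using ppow_add[of "x - y" N "y - z"] by simp

lemma ppow_mono: "x \<in> P N \<Longrightarrow> M \<le> N \<Longrightarrow> x \<in> P M"
  by (auto simp: ppow_def)

lemma ppow_mult: "x \<in> P M \<Longrightarrow> y \<in> P N \<Longrightarrow> x * y \<in> P (M + N)"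
  using ord_mult[of x y] by (cases "x = 0"; cases "y = 0") (auto simp: ppow_def)

lemma ppow_mult_left: "x \<in> P 0 \<Longrightarrow> y \<in> P N \<Longrightarrow> x * y \<in> P N"
  using ppow_mult[of x 0 y N] by simp

lemma ppow_mult_right: "y \<in> P N \<Longrightarrow> x \<in> P 0 \<Longrightarrow> y * x \<in> P N"
  using ppow_mult[of y N x 0] by simp

lemma ppow_sum: "(\<And>i. i \<in> A \<Longrightarrow> f i \<in> P N) \<Longrightarrow> sum f A \<in> P N"
  by (induction A rule: infinite_finite_induct) (auto intro: ppow_add)

lemma ppow_divide: "x \<in> P (M + ord y) \<Longrightarrow> y \<noteq> 0 \<Longrightarrow> x / y \<in> P M"
  using ord_divide[of x y] by (cases "x = 0") (auto simp: ppow_def)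

lemma one_in_ppow [simp]: "1 \<in> P 0"
  by (simp add: ppow_def)

lemma ppow_power: "x \<in> P 0 \<Longrightarrow> x ^ j \<in> P 0"
  by (induction j) (auto intro: ppow_mult_left)

lemma sign_in_ppow: "(- 1) ^ j \<in> P 0"
  by (rule ppow_power) (simp add: ppow_minus_iff)

lemma ppow_sign_iff [simp]: "(- 1) ^ j * x \<in> P N \<longleftrightarrow> x \<in> P N"
  by (cases "even j") auto

text \<open>Separatedness of the valuation topology: congruences at all finite levels are turned
  into equalities through this.\<close>

lemma ppow_all_zero: "(\<And>N::nat. x \<in> P (int N)) \<Longrightarrow> x = 0"
proof (rule ccontr)
  assume a: "\<And>N::nat. x \<in> P (int N)" and "x \<noteq> 0"
  then have "int (nat (ord x + 1)) \<le> ord x"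
    using ppow_iff by blast
  then show False by linarith
qed

lemma not_one_in_ppow: "N \<ge> 1 \<Longrightarrow> 1 \<notin> P N"
  by (auto simp: ppow_def)

text \<open>If x had positive valuation, so would 1 = x - (x - 1). The inverse stays in the same
  class because 1/x - 1 = -(x - 1)/x.\<close>

lemma one_unit:
  assumes "x - 1 \<in> P N" "N \<ge> 1"
  shows "x \<noteq> 0" "ord x = 0" "x \<in> P 0" "inverse x \<in> P 0" "inverse x - 1 \<in> P N"
proof -
  show nz: "x \<noteq> 0"
    using assms not_one_in_ppow[of N] by auto
  have "x = (x - 1) + 1" by simp
  then show x0: "x \<in> P 0"
    using assms ppow_add[OF ppow_mono[OF assms(1), of 0] one_in_ppow] by simp
  have "\<not> 1 \<le> ord x"
  proof
    assume "1 \<le> ord x"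
    then have "x \<in> P 1" using nz by (simp add: ppow_iff)
    from ppow_diff[OF this ppow_mono[OF assms]] have "1 \<in> P 1" by simp
    then show False using not_one_in_ppow[of 1] by simp
  qed
  then show o: "ord x = 0" using x0 nz by (simp add: ppow_iff)
  show i: "inverse x \<in> P 0" using nz o by (simp add: ppow_iff ord_inverse)
  have "inverse x - 1 = - (inverse x * (x - 1))" using nz by (simp add: algebra_simps)
  then show "inverse x - 1 \<in> P N"
    using ppow_mult_left[OF i assms(1)] by (simp only: ppow_minus_iff)
qed

lemma ppow_mult_diff:
  assumes "x - x' \<in> P N" "y - y' \<in> P N" "x \<in> P 0" "y' \<in> P 0"
  shows "x * y - x' * y' \<in> P N"
proof -
  have "x * y - x' * y' = x * (y - y') + (x - x') * y'" by (simp add: algebra_simps)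
  then show ?thesis
    using assms by (simp add: ppow_add ppow_mult_left ppow_mult_right)
qed

lemma one_unit_mult:
  assumes "x - 1 \<in> P N" "y - 1 \<in> P N" "N \<ge> 1"
  shows "x * y - 1 \<in> P N"
  using ppow_mult_diff[OF assms(1,2)] one_unit(3)[OF assms(1,3)] by simp

text \<open>Dividing by y makes x/y congruent to 1 modulo the maximal ideal, hence a unit.\<close>

lemma ord_cong:
  assumes "x - y \<in> P (ord y + 1)" "y \<noteq> 0"
  shows "x \<noteq> 0" "ord x = ord y"
proof -
  have "(x - y) / y \<in> P 1" using assms by (intro ppow_divide) (auto simp: add.commute)
  then have 1: "x / y - 1 \<in> P 1" using assms(2) by (simp add: diff_divide_distrib)
  then show "x \<noteq> 0" using one_unit(1)[OF 1] by auto
  then show "ord x = ord y" using one_unit(2)[OF 1] assms(2) by (simp add: ord_divide)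
qed

section \<open>Roots of monic polynomials modulo the maximal ideal\<close>

lemma coeff_synthetic_div_ppow:
  "\<forall>i. coeff p i \<in> P 0 \<Longrightarrow> c \<in> P 0 \<Longrightarrow>
    (\<forall>i. coeff (synthetic_div p c) i \<in> P 0) \<and> poly p c \<in> P 0"
proof (induction p)
  case 0
  then show ?case by simp
next
  case (pCons a p)
  have "\<forall>i. coeff p i \<in> P 0"
  proof
    fix i show "coeff p i \<in> P 0" using pCons.prems(1)[rule_format, of "Suc i"] by simp
  qed
  moreover have "a \<in> P 0" using pCons.prems(1)[rule_format, of 0] by simp
  ultimately show ?case using pCons
    by (auto simp: coeff_pCons split: nat.split intro: ppow_add ppow_mult_left)
qed

text \<open>The usual bound for the number of roots over the residue field, argued with
  representatives in the valuation ring. After splitting off X - c the remaining elements are still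
  roots modulo \<open>P 1\<close>, since a - c is a unit whenever a and c are incongruent.\<close>

lemma residue_root_count:
  assumes "finite A" "A \<subseteq> P 0" "\<And>a b. a \<in> A \<Longrightarrow> b \<in> A \<Longrightarrow> a \<noteq> b \<Longrightarrow> a - b \<notin> P 1"
    and "\<forall>i. coeff p i \<in> P 0" "lead_coeff p = 1" "\<And>a. a \<in> A \<Longrightarrow> poly p a \<in> P 1"
  shows "card A \<le> degree p"
  using assms
proof (induction "degree p" arbitrary: p A)
  case 0
  then have "p = 1" by (metis degree_eq_zeroE lead_coeff_pCons(1) lead_coeff_pCons(2) one_pCons pCons_eq_0_iff)
  then have "A = {}" using 0 not_one_in_ppow[of 1] by auto
  then show ?case by simp
next
  case (Suc d)
  show ?case
  proof (cases "A = {}")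
    case True
    then show ?thesis by simp
  next
    case False
    then obtain c where c: "c \<in> A" by auto
    define q where "q = synthetic_div p c"
    have pq: "p = [:- c, 1:] * q + [:poly p c:]"
      using synthetic_div_correct'[of c p] by (simp add: q_def)
    have dq: "degree q = d" using Suc.hyps(2) by (simp add: q_def degree_synthetic_div)
    have q0: "q \<noteq> 0"
    proof
      assume "q = 0"
      then have "degree p = 0" using pq by (metis add.left_neutral degree_pCons_0 mult_zero_right)
      then show False using Suc.hyps(2) by simp
    qed
    have d1: "degree ([:- c, 1:] * q) = Suc d" using q0 dq degree_mult_eq[of "[:- c, 1:]" q] by simp
    have "lead_coeff p = coeff ([:- c, 1:] * q) (Suc d)"
      using pq Suc.hyps(2)
      by (metis add.right_neutral coeff_add coeff_pCons_Suc coeff_0)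
    also have "\<dots> = lead_coeff ([:- c, 1:] * q)" using d1 by simp
    also have "\<dots> = lead_coeff q" using lead_coeff_mult[of "[:- c, 1:]" q] by simp
    finally have lq: "lead_coeff q = 1" using Suc.prems(5) by simp
    have cq: "\<forall>i. coeff q i \<in> P 0"
      unfolding q_def using coeff_synthetic_div_ppow[OF Suc.prems(4)] c Suc.prems(2) by auto
    have "card (A - {c}) \<le> degree q"
    proof (rule Suc.hyps(1))
      fix a assume a: "a \<in> A - {c}"
      have "poly p a = (a - c) * poly q a + poly p c"
        by (subst pq) (simp add: algebra_simps)
      then have "(a - c) * poly q a = poly p a - poly p c" by simp
      moreover have "poly p a - poly p c \<in> P 1"
        using Suc.prems(6) a c by (intro ppow_diff) auto
      ultimately have 1: "(a - c) * poly q a \<in> P 1" by simp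
      have 2: "a - c \<notin> P 1" using Suc.prems(3) a c by auto
      have 3: "a - c \<in> P 0" using Suc.prems(2) a c by (auto intro: ppow_diff)
      have "a - c \<noteq> 0" using a by auto
      with 2 3 have "ord (a - c) = 0" by (simp add: ppow_iff)
      with 1 \<open>a - c \<noteq> 0\<close> show "poly q a \<in> P 1"
        by (cases "poly q a = 0") (auto simp: ppow_iff ord_mult)
    qed (use Suc.prems cq lq dq in auto)
    then show ?thesis using dq c Suc.hyps(2) Suc.prems(1) by (simp add: card_Diff_singleton)
  qed
qed

end


locale local_fields =
  fixes D :: "('k::field, 'l::field) local_datum"
  assumes datum: "is_local_datum D"

sublocale local_fields \<subseteq> K: valuation "ordK D"
  using datum by unfold_locales (simp add: is_local_datum_def nonarch_local_field_def)

sublocale local_fields \<subseteq> valuation "ordL D"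
  using datum by unfold_locales (simp add: is_local_datum_def is_completed_max_unramified_def)

context local_fields
begin

abbreviation \<iota> where "\<iota> \<equiv> embK D"
abbreviation pi where "pi \<equiv> embK D (unifK D)"
abbreviation sg where "sg \<equiv> frobL D"
abbreviation sgi where "sgi \<equiv> inv_into UNIV (frobL D)"

section \<open>The embedding of K and the Frobenius\<close>

lemma subfield_range_to_ac:
  "subfield (range (to_ac :: 'k \<Rightarrow> _)) (ring_of_type_algebra :: 'k alg_closure ring)"
proof -
  let ?R = "ring_of_type_algebra :: 'k alg_closure ring"
  interpret R: field ?R by (rule field_from_type_algebra)
  have minus: "\<ominus>\<^bsub>?R\<^esub> x = - x" for x
    by (rule R.minus_equality) (auto simp: ring_of_type_algebra_def)
  have inv: "inv\<^bsub>?R\<^esub> x = inverse x" if "x \<noteq> 0" for x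
    using that by (intro R.comm_inv_char) (auto simp: ring_of_type_algebra_def)
  have "subring (range to_ac) ?R"
  proof (rule R.subringI)
    fix h1 h2 :: "'k alg_closure"
    assume "h1 \<in> range to_ac" "h2 \<in> range to_ac"
    then obtain a b where ab: "h1 = to_ac a" "h2 = to_ac b" by auto
    show "h1 \<otimes>\<^bsub>?R\<^esub> h2 \<in> range to_ac" "h1 \<oplus>\<^bsub>?R\<^esub> h2 \<in> range to_ac"
      unfolding ab by (auto simp: ring_of_type_algebra_def simp flip: to_ac_mult to_ac_add)
  next
    fix h assume "h \<in> range (to_ac :: 'k \<Rightarrow> _)"
    then obtain a where "h = to_ac a" by auto
    then show "\<ominus>\<^bsub>?R\<^esub> h \<in> range to_ac" by (auto simp: minus simp flip: to_ac_minus)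
  qed (auto simp: ring_of_type_algebra_def image_iff intro: exI[of _ 1])
  then have "subcring (range to_ac) ?R"
    by (rule R.subcringI')
  then show ?thesis
  proof (rule R.subfieldI)
    have "x \<in> Units ?R" if "x \<noteq> 0" for x
      using that R.field_Units by (auto simp: ring_of_type_algebra_def)
    moreover have "Units (?R\<lparr>carrier := range to_ac\<rparr>) = range to_ac - {\<zero>\<^bsub>?R\<^esub>}"
    proof -
      have "\<exists>y. to_ac (y::'k) * to_ac x = 1" if "x \<noteq> 0" for x
        using that by (intro exI[of _ "inverse x"]) (simp flip: to_ac_mult)
      then show ?thesis
        by (auto simp: Units_def ring_of_type_algebra_def mult.commute)
    qed
    ultimately show "Units (?R\<lparr>carrier := range to_ac\<rparr>) = range to_ac - {\<zero>\<^bsub>?R\<^esub>}" by simp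
  qed
qed

text \<open>K is an unramified extension of itself, of degree 1. The homomorphism property of
  \<open>emb\<close> is given only on the maximal unramified extension; this makes it available for
  elements of K.\<close>

lemma to_ac_max_unramified: "to_ac x \<in> max_unramified_extension (ordK D)"
proof -
  interpret R: field "ring_of_type_algebra :: 'k alg_closure ring" by (rule field_from_type_algebra)
  define w where "w = (\<lambda>y. ordK D (of_ac y))"
  have w: "w (to_ac y) = ordK D y" for y by (simp add: w_def)
  have "\<exists>y\<in>range (to_ac :: 'k \<Rightarrow> _) - {0}. w y = m" for m
  proof -
    have "m \<in> ordK D ` (UNIV - {0})" using K.dv by (simp add: discrete_valuation_on_def)
    then obtain y where "y \<noteq> 0" "ordK D y = m" by auto
    then show ?thesis by (intro bexI[of _ "to_ac y"]) (auto simp: w)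
  qed
  then have "w ` (range to_ac - {0}) = UNIV" by (metis UNIV_eq_I image_eqI)
  moreover have "w (x * y) = w x + w y" if "x \<in> range to_ac - {0}" "y \<in> range to_ac - {0}" for x y
    using that K.ord_mult by (auto simp: w simp flip: to_ac_mult)
  moreover have "min (w x) (w y) \<le> w (x + y)"
    if "x \<in> range to_ac - {0}" "y \<in> range to_ac - {0}" "x + y \<noteq> 0" for x y
  proof -
    from that obtain a b where ab: "x = to_ac a" "y = to_ac b" by blast
    then have "a \<noteq> 0" "b \<noteq> 0" using that by auto
    moreover have "a + b \<noteq> 0" using that(3) to_ac_add[of a b] unfolding ab by (metis to_ac_0)
    ultimately show ?thesis using K.ord_add[of a b] w[of "a + b"] by (simp add: ab w)
  qed
  ultimately have "discrete_valuation_on (range to_ac) w" by (simp add: discrete_valuation_on_def)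
  moreover have "R.finite_dimension (range (to_ac :: 'k \<Rightarrow> _)) (range to_ac)"
    by (rule R.finite_dimensionI[of 1]) (rule R.dimension_one[OF subfield_range_to_ac])
  ultimately have "finite_unramified_extension (ordK D) (range to_ac)"
    using subfield_range_to_ac unfolding finite_unramified_extension_def
    using w by blast
  then show ?thesis unfolding max_unramified_extension_def by auto
qed

lemma emb_hom: "emb D \<in> Ring.ring_hom
   (ring_of_type_algebra \<lparr>carrier := max_unramified_extension (ordK D)\<rparr>) ring_of_type_algebra"
  using datum by (simp add: is_local_datum_def is_completed_max_unramified_def)

lemma embK_add: "\<iota> (x + y) = \<iota> x + \<iota> y"
  using ring_hom_add[OF emb_hom, of "to_ac x" "to_ac y"] to_ac_max_unramified
  by (simp add: ring_of_type_algebra_def embK_def)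

lemma embK_mult: "\<iota> (x * y) = \<iota> x * \<iota> y"
  using ring_hom_mult[OF emb_hom, of "to_ac x" "to_ac y"] to_ac_max_unramified
  by (simp add: ring_of_type_algebra_def embK_def)

lemma embK_one [simp]: "\<iota> 1 = 1"
  using ring_hom_one[OF emb_hom] by (simp add: ring_of_type_algebra_def embK_def)

lemma embK_zero [simp]: "\<iota> 0 = 0"
  using embK_add[of 0 0] by (metis add.right_neutral add_cancel_right_right)

lemma embK_diff: "\<iota> (x - y) = \<iota> x - \<iota> y"
  using embK_add[of "x - y" y] by simp

lemma embK_eq_0_iff [simp]: "\<iota> x = 0 \<longleftrightarrow> x = 0"
  using embK_mult[of x "inverse x"] by (cases "x = 0") auto

lemma embK_power: "\<iota> (x ^ j) = \<iota> x ^ j"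
  by (induction j) (auto simp: embK_mult)

lemma embK_divide: "\<iota> (x / y) = \<iota> x / \<iota> y"
  using embK_mult[of "x / y" y] by (cases "y = 0") (auto simp: field_simps)

lemma ord_embK: "x \<noteq> 0 \<Longrightarrow> ordL D (\<iota> x) = ordK D x"
  using datum by (auto simp: is_local_datum_def is_completed_max_unramified_def)

lemma embK_ppow_iff [simp]: "\<iota> x \<in> P N \<longleftrightarrow> x \<in> K.P N"
  by (cases "x = 0") (auto simp: ppow_iff K.ppow_iff ord_embK)

lemma pi_nonzero [simp]: "unifK D \<noteq> 0" "pi \<noteq> 0"
  using datum by (auto simp: is_local_datum_def)

lemma ord_unifK [simp]: "ordK D (unifK D) = 1"
  using datum by (auto simp: is_local_datum_def)

lemma ord_pi [simp]: "ordL D pi = 1"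
  by (simp add: ord_embK)

lemma ord_pi_power [simp]: "ordL D (pi ^ j) = int j"
  by (simp add: ord_power)

lemma pi_power_ppow: "pi ^ j \<in> P (int j)"
  by (simp add: ppow_iff)

lemma pi_power_mult_ppow: "x \<in> P N \<Longrightarrow> pi ^ j * x \<in> P (N + int j)"
  using ppow_mult[OF pi_power_ppow[of j]] by (simp add: add.commute)

lemma pi_power_mult_integral: "x \<in> P N \<Longrightarrow> pi ^ j * x \<in> P N"
  by (rule ppow_mono[OF pi_power_mult_ppow]) auto

lemma sg_iso: "sg \<in> ring_iso ring_of_type_algebra ring_of_type_algebra"
  using datum by (simp add: is_local_datum_def is_frobenius_def)

lemma bij_sg: "bij sg"
  using sg_iso by (auto simp: ring_iso_def ring_of_type_algebra_def)

lemma sg_add: "sg (x + y) = sg x + sg y"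
  and sg_mult: "sg (x * y) = sg x * sg y"
  and sg_one [simp]: "sg 1 = 1"
  using sg_iso by (auto simp: ring_iso_def Ring.ring_hom_def ring_of_type_algebra_def)

lemma sg_zero [simp]: "sg 0 = 0"
  using sg_add[of 0 0] by (metis add.right_neutral add_cancel_right_right)

lemma sg_minus: "sg (- x) = - sg x"
  using sg_add[of x "- x"] by (simp add: eq_neg_iff_add_eq_0 add.commute)

lemma sg_diff: "sg (x - y) = sg x - sg y"
  using sg_add[of "x - y" y] by simp

lemma sg_sum: "sg (sum f A) = (\<Sum>i\<in>A. sg (f i))"
  by (induction A rule: infinite_finite_induct) (auto simp: sg_add)

lemma sg_power: "sg (x ^ j) = sg x ^ j"
  by (induction j) (auto simp: sg_mult)

lemma sg_eq_iff: "sg x = sg y \<longleftrightarrow> x = y"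
  using bij_sg by (auto simp: bij_def inj_def)

lemma sg_eq_0_iff [simp]: "sg x = 0 \<longleftrightarrow> x = 0"
  using sg_eq_iff[of x 0] by simp

lemma sg_divide: "sg (x / y) = sg x / sg y"
  using sg_mult[of "x / y" y] by (cases "y = 0") (auto simp: field_simps)

lemma ord_sg [simp]: "ordL D (sg x) = ordL D x"
  using datum by (cases "x = 0") (auto simp: is_local_datum_def is_frobenius_def)

lemma sg_ppow_iff [simp]: "sg x \<in> P N \<longleftrightarrow> x \<in> P N"
  by (auto simp: ppow_def)

lemma sg_embK [simp]: "sg (\<iota> x) = \<iota> x"
  using datum by (cases "x = 0") (auto simp: is_local_datum_def is_frobenius_def)

lemma sg_sign [simp]: "sg ((- 1) ^ j) = (- 1) ^ j"
  by (simp add: sg_power sg_minus)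

lemma sg_sgi [simp]: "sg (sgi x) = x"
  using bij_sg by (simp add: bij_def surj_f_inv_f)

lemma sgi_sg [simp]: "sgi (sg x) = x"
  using bij_sg by (simp add: bij_def inv_f_f)

lemma sgi_eqI: "sg x = y \<Longrightarrow> sgi y = x" by auto

lemma sgi_zero [simp]: "sgi 0 = 0" and sgi_one [simp]: "sgi 1 = 1"
  and sgi_embK [simp]: "sgi (\<iota> y) = \<iota> y"
  by (auto intro!: sgi_eqI)

lemma sgi_mult: "sgi (x * y) = sgi x * sgi y"
  and sgi_minus: "sgi (- x) = - sgi x"
  and sgi_diff: "sgi (x - y) = sgi x - sgi y"
  and sgi_divide: "sgi (x / y) = sgi x / sgi y"
  by (auto intro!: sgi_eqI simp: sg_add sg_mult sg_minus sg_diff sg_divide)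

lemma sgi_eq_0_iff [simp]: "sgi x = 0 \<longleftrightarrow> x = 0"
  by (metis sg_sgi sg_zero sgi_zero)

lemma ord_sgi [simp]: "ordL D (sgi x) = ordL D x"
  using ord_sg[of "sgi x"] by simp

lemma sgi_ppow_iff [simp]: "sgi x \<in> P N \<longleftrightarrow> x \<in> P N"
  using sg_ppow_iff[of "sgi x" N] by simp

lemma sgi_sign [simp]: "sgi ((- 1) ^ j) = (- 1) ^ j"
  by (intro sgi_eqI) simp

section \<open>The fixed field of the Frobenius\<close>

lemma residue_representatives:
  obtains A where "finite A" "card A = card (residue_field (ordK D))" "A \<subseteq> K.P 0"
    "\<And>a b. a \<in> A \<Longrightarrow> b \<in> A \<Longrightarrow> a \<noteq> b \<Longrightarrow> a - b \<notin> K.P 1"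
proof -
  define coset where "coset = (\<lambda>x. (+) x ` K.P 1)"
  have "residue_field (ordK D) = coset ` K.P 0"
    by (simp add: residue_field_def coset_def)
  then obtain A where A: "A \<subseteq> K.P 0" "inj_on coset A" "residue_field (ordK D) = coset ` A"
    by (metis subset_image_inj order_refl)
  have "finite (residue_field (ordK D))"
    using datum by (simp add: is_local_datum_def nonarch_local_field_def)
  then have fin: "finite A" using A(2,3) by (simp add: finite_image_iff)
  have card: "card A = card (residue_field (ordK D))" using A by (simp add: card_image)
  have "a - b \<notin> K.P 1" if "a \<in> A" "b \<in> A" "a \<noteq> b" for a b
  proof
    assume ab: "a - b \<in> K.P 1"
    have "coset a = coset b"
    proof (rule Set.set_eqI, rule iffI)
      fix x assume "x \<in> coset a"
      then obtain y where y: "x = a + y" "y \<in> K.P 1" by (auto simp: coset_def)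
      then have "x = b + (a - b + y)" by simp
      then show "x \<in> coset b" using K.ppow_add[OF ab y(2)] unfolding coset_def by blast
    next
      fix x assume "x \<in> coset b"
      then obtain y where y: "x = b + y" "y \<in> K.P 1" by (auto simp: coset_def)
      then have "x = a + (y - (a - b))" by simp
      then show "x \<in> coset a" using K.ppow_diff[OF y(2) ab] unfolding coset_def by blast
    qed
    then show False using A(2) that by (auto simp: inj_on_def)
  qed
  with fin card A(1) show ?thesis using that by blast
qed

text \<open>Modulo the maximal ideal \<sigma> is the q-th power map, so a fixed integral x is a root
  of X^q - X there. Representatives of the residue field of K are already q incongruent roots; an x
  congruent to none of them would be one root too many.\<close>

lemma frobenius_fixed_residue:
  assumes x: "x \<in> P 0" "sg x = x"
  obtains a where "a \<in> K.P 0" "x - \<iota> a \<in> P 1"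
proof (rule ccontr)
  assume "\<not> thesis"
  with that have no: "\<And>a. a \<in> K.P 0 \<Longrightarrow> x - \<iota> a \<notin> P 1" by blast
  define q where "q = card (residue_field (ordK D))"
  obtain A where A: "finite A" "card A = q" "A \<subseteq> K.P 0"
    "\<And>a b. a \<in> A \<Longrightarrow> b \<in> A \<Longrightarrow> a \<noteq> b \<Longrightarrow> a - b \<notin> K.P 1"
    using residue_representatives unfolding q_def by metis
  have frob: "y ^ q - y \<in> P 1" if "y \<in> P 0" "sg y = y" for y
  proof -
    have "sg y - y ^ q \<in> P 1"
      using datum that(1) by (auto simp: is_local_datum_def is_frobenius_def q_def)
    then show ?thesis using that(2) ppow_diff_commute by metis
  qed
  define B where "B = insert x (\<iota> ` A)"
  have inj: "inj_on \<iota> A"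
    by (metis embK_diff embK_eq_0_iff inj_onI right_minus_eq)
  have xA: "x \<notin> \<iota> ` A" 
  proof
    assume "x \<in> \<iota> ` A"
    then obtain a where "a \<in> A" "x - \<iota> a = 0" by auto
    then show False using no[of a] A(3) by auto
  qed
  have cB: "card B = Suc q" unfolding B_def using A(1,2) xA inj by (simp add: card_image)
  have sep: "a - b \<notin> P 1" if "a \<in> B" "b \<in> B" "a \<noteq> b" for a b
  proof -
    have 1: "\<iota> u - \<iota> w \<notin> P 1" if "u \<in> A" "w \<in> A" "\<iota> u \<noteq> \<iota> w" for u w
      using A(4)[of u w] that embK_diff[of u w] embK_ppow_iff[of "u - w" 1] by auto
    have 2: "x - \<iota> u \<notin> P 1" "\<iota> u - x \<notin> P 1" if "u \<in> A" for u
      using no A(3) that ppow_diff_commute by (metis subsetD)+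
    show ?thesis using that 1 2 unfolding B_def by auto
  qed
  \<comment> \<open>The residue field contains distinct classes of 0 and 1. Hence X^q - X is monic
    of degree q, which fails for q = 1.\<close>
  have q2: "q \<ge> 2"
  proof -
    have "{(+) 0 ` K.P 1, (+) 1 ` K.P 1} \<subseteq> residue_field (ordK D)"
      unfolding residue_field_def by (intro insert_subsetI imageI empty_subsetI) auto
    moreover have "(+) 0 ` K.P 1 \<noteq> (+) 1 ` K.P 1"
    proof -
      have "1 \<in> (+) 1 ` K.P 1" by (rule image_eqI[of _ _ 0]) auto
      moreover have "1 \<notin> (+) 0 ` K.P 1" using K.not_one_in_ppow[of 1] by auto
      ultimately show ?thesis by metis
    qed
    moreover have "finite (residue_field (ordK D))"
      using datum by (simp add: is_local_datum_def nonarch_local_field_def)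
    ultimately show ?thesis unfolding q_def
      by (metis card_2_iff card_mono)
  qed
  define p :: "'l poly" where "p = monom 1 q - monom 1 1"
  have dp: "degree p = q"
    using q2 degree_add_eq_left[of "- monom 1 1 :: 'l poly" "monom 1 q"]
    by (simp add: p_def degree_monom_eq)
  have lp: "coeff p q = 1" using q2 by (simp add: p_def)
  have "card B \<le> degree p"
  proof (rule residue_root_count)
    show "finite B" unfolding B_def using A(1) by simp
    show "B \<subseteq> P 0" unfolding B_def using x A(3) by auto
    show "\<forall>i. coeff p i \<in> P 0" unfolding p_def by (auto intro: ppow_diff)
    show "lead_coeff p = 1" using dp lp by simp
    show "poly p a \<in> P 1" if "a \<in> B" for a
      using that x A(3) frob[of a] unfolding p_def B_def by (auto simp: poly_monom)
  qed (use sep in auto)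
  then show False using cB dp by simp
qed

text \<open>The error divided by pi^N is again integral and fixed, because pi comes from K; its
  residue is the next digit of the expansion.\<close>

lemma frobenius_fixed_approx:
  assumes x: "x \<in> P 0" "sg x = x"
  shows "\<exists>a. x - \<iota> a \<in> P (int N)"
proof (induction N)
  case 0
  show ?case using x by (intro exI[of _ 0]) simp
next
  case (Suc N)
  then obtain a where a: "x - \<iota> a \<in> P (int N)" by blast
  define y where "y = (x - \<iota> a) / pi ^ N"
  have "y \<in> P 0" unfolding y_def using a by (intro ppow_divide) auto
  moreover have "sg y = y" unfolding y_def by (simp add: sg_divide sg_diff x sg_power)
  ultimately obtain c where c: "y - \<iota> c \<in> P 1" using frobenius_fixed_residue by blast
  have "x - \<iota> (a + unifK D ^ N * c) = pi ^ N * (y - \<iota> c)"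
    unfolding y_def by (simp add: embK_add embK_mult embK_power field_simps)
  then show ?case using pi_power_mult_ppow[OF c, of N] by (intro exI[of _ "a + unifK D ^ N * c"]) (simp add: add.commute)
qed

text \<open>The approximations form a Cauchy sequence in K itself, since the embedding preserves
  valuations. The limit provided by completeness of K must then be the given element, after scaling
  it by a power of pi to make it integral.\<close>

lemma frobenius_fixed:
  assumes "sg x = x"
  shows "x \<in> range \<iota>"
proof -
  define N where "N = nat (- ordL D x)"
  define y where "y = pi ^ N * x"
  have "y \<in> P 0" unfolding y_def N_def by (cases "x = 0") (auto simp: ppow_iff ord_mult)
  moreover have "sg y = y" unfolding y_def by (simp add: sg_mult assms sg_power)
  ultimately have "\<exists>a. y - \<iota> a \<in> P (int N)" for N by (rule frobenius_fixed_approx)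
  then obtain s where s: "\<And>N. y - \<iota> (s N) \<in> P (int N)" by metis
  have cau: "s i - s j \<in> K.P N" if "i \<ge> nat N" "j \<ge> nat N" for i j N
  proof -
    have "(y - \<iota> (s j)) - (y - \<iota> (s i)) \<in> P N"
      using that by (intro ppow_diff ppow_mono[OF s]) auto
    then have "\<iota> (s i - s j) \<in> P N" by (simp add: embK_diff)
    then show ?thesis by simp
  qed
  have "val_complete (ordK D)"
    using datum by (simp add: is_local_datum_def nonarch_local_field_def)
  then have "\<exists>z. \<forall>N. \<exists>M. \<forall>i\<ge>M. s i - z \<in> K.P N"
    unfolding val_complete_def using cau by blast
  then obtain z where z: "\<And>N. \<exists>M. \<forall>i\<ge>M. s i - z \<in> K.P N" by blast
  have "y - \<iota> z = 0"
  proof (rule ppow_all_zero)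
    fix N :: nat
    obtain M where M: "\<forall>i\<ge>M. s i - z \<in> K.P (int N)" using z by blast
    define i where "i = max M N"
    have "\<iota> (s i - z) \<in> P (int N)" using M by (simp add: i_def)
    moreover have "y - \<iota> (s i) \<in> P (int N)" by (rule ppow_mono[OF s]) (simp add: i_def)
    ultimately show "y - \<iota> z \<in> P (int N)" using ppow_trans by (metis embK_diff)
  qed
  then have "x = \<iota> (z / unifK D ^ N)"
    unfolding y_def by (simp add: embK_divide embK_power field_simps)
  then show ?thesis by blast
qed

lemma KtimesL_iff: "x \<in> KtimesL D \<longleftrightarrow> x \<noteq> 0 \<and> sg x = x"
  using frobenius_fixed[of x] by (auto simp: KtimesL_def)

end

section \<open>The symplectic form and the Frobenius\<close>

lemma Omega_carrier [simp]: "Omega n \<in> carrier_mat (2 * n) (2 * n)"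
  unfolding Omega_def by (intro mult_carrier_mat[of _ _ "2 * n"]) (auto simp: mat_diag_def)

lemma Omega_index:
  "i < 2 * n \<Longrightarrow> j < 2 * n \<Longrightarrow>
    (Omega n :: 'a::field mat) $$ (i, j) = (if i + j + 1 = 2 * n then (- 1) ^ j else 0)"
  unfolding Omega_def by (subst mat_diag_mult_right[of _ "2 * n"]) auto

text \<open>With indices from 0 the partner of i is 2n - 1 - i, of opposite parity; this turns the
  column sign of \<open>Omega\<close> into the exponent i + 1.\<close>

lemma sform_sum:
  assumes "x \<in> carrier_vec (2 * n)" "y \<in> carrier_vec (2 * n)"
  shows "sform n x y = (\<Sum>i<2 * n. (- 1) ^ (i + 1) * x $ i * y $ (2 * n - 1 - i))"
proof -
  have "(Omega n *\<^sub>v y) $ i = (- 1) ^ (i + 1) * y $ (2 * n - 1 - i)" if "i < 2 * n" for i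
  proof -
    have "(Omega n *\<^sub>v y) $ i = (\<Sum>j<2 * n. (if i + j + 1 = 2 * n then (- 1) ^ j else 0) * y $ j)"
      using that assms(2) carrier_matD[OF Omega_carrier[of n, where ?'a='a]]
      by (auto simp: scalar_prod_def atLeast0LessThan Omega_index intro!: sum.cong)
    also have "\<dots> = (\<Sum>j<2 * n. if j = 2 * n - 1 - i then (- 1) ^ j * y $ j else 0)"
      using that by (intro sum.cong) auto
    also have "\<dots> = (- 1) ^ (2 * n - 1 - i) * y $ (2 * n - 1 - i)" 
    proof -
      have "2 * n - 1 - i \<in> {..<2 * n}" using that by auto
      then show ?thesis by (subst sum.delta) simp_all
    qed
    also have "(- 1 :: 'a) ^ (2 * n - 1 - i) = (- 1) ^ (i + 1)"
      using that by (auto simp: minus_one_power_iff)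
    finally show ?thesis .
  qed
  then show ?thesis using assms(2) carrier_matD[OF Omega_carrier[of n, where ?'a='a]]
    by (auto simp: sform_def scalar_prod_def atLeast0LessThan mult_ac intro!: sum.cong)
qed

text \<open>Folding the sum at the middle shows that the form is alternating and not merely
  skew-symmetric, which is stronger in characteristic 2.\<close>

lemma sform_alt:
  assumes "x \<in> carrier_vec (2 * n)" "y \<in> carrier_vec (2 * n)"
  shows "sform n x y =
    (\<Sum>i<n. (- 1) ^ (i + 1) * (x $ i * y $ (2 * n - 1 - i) - x $ (2 * n - 1 - i) * y $ i))"
proof -
  let ?f = "\<lambda>i. (- 1) ^ (i + 1) * x $ i * y $ (2 * n - 1 - i)"
  have "sform n x y = sum ?f {..<n} + sum ?f {n..<2 * n}"
    unfolding sform_sum[OF assms] by (subst sum.union_disjoint[symmetric]) (auto intro!: sum.cong)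
  also have "sum ?f {n..<2 * n} = (\<Sum>i<n. ?f (2 * n - 1 - i))"
    by (rule sum.reindex_bij_witness[of _ "\<lambda>i. 2 * n - 1 - i" "\<lambda>i. 2 * n - 1 - i"]) auto
  also have "\<dots> = (\<Sum>i<n. - ((- 1) ^ (i + 1) * x $ (2 * n - 1 - i) * y $ i))"
  proof (intro sum.cong refl)
    fix i assume "i \<in> {..<n}"
    then have "(- 1 :: 'a) ^ (2 * n - 1 - i + 1) = - ((- 1) ^ (i + 1))" "2 * n - 1 - (2 * n - 1 - i) = i"
      by (auto simp: minus_one_power_iff)
    then show "?f (2 * n - 1 - i) = - ((- 1) ^ (i + 1) * x $ (2 * n - 1 - i) * y $ i)"
      by simp
  qed
  finally show ?thesis by (simp add: sum.distrib[symmetric] algebra_simps)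
qed

lemma sform_self: "x \<in> carrier_vec (2 * n) \<Longrightarrow> sform n x x = 0"
  by (simp add: sform_alt mult.commute)

lemma sform_commute:
  "x \<in> carrier_vec (2 * n) \<Longrightarrow> y \<in> carrier_vec (2 * n) \<Longrightarrow> sform n x y = - sform n y x"
  by (simp add: sform_alt sum_negf[symmetric] algebra_simps)

lemma sform_add_right:
  "x \<in> carrier_vec (2 * n) \<Longrightarrow> y \<in> carrier_vec (2 * n) \<Longrightarrow> z \<in> carrier_vec (2 * n) \<Longrightarrow>
    sform n x (y + z) = sform n x y + sform n x z"
  by (simp add: sform_sum sum.distrib[symmetric] algebra_simps)

lemma sform_add_left:
  "x \<in> carrier_vec (2 * n) \<Longrightarrow> y \<in> carrier_vec (2 * n) \<Longrightarrow> z \<in> carrier_vec (2 * n) \<Longrightarrow>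
    sform n (x + y) z = sform n x z + sform n y z"
  by (simp add: sform_sum sum.distrib[symmetric] algebra_simps)

lemma sform_smult_right:
  "x \<in> carrier_vec (2 * n) \<Longrightarrow> y \<in> carrier_vec (2 * n) \<Longrightarrow>
    sform n x (c \<cdot>\<^sub>v y) = c * sform n x y"
  by (simp add: sform_sum sum_distrib_left mult_ac)

lemma sform_smult_left:
  "x \<in> carrier_vec (2 * n) \<Longrightarrow> y \<in> carrier_vec (2 * n) \<Longrightarrow>
    sform n (c \<cdot>\<^sub>v x) y = c * sform n x y"
  by (simp add: sform_sum sum_distrib_left mult_ac)

lemma sform_diff_right:
  "x \<in> carrier_vec (2 * n) \<Longrightarrow> y \<in> carrier_vec (2 * n) \<Longrightarrow> z \<in> carrier_vec (2 * n) \<Longrightarrow>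
    sform n x (y - z) = sform n x y - sform n x z"
  by (simp add: sform_sum sum_subtractf[symmetric] algebra_simps)

lemma sform_diff_left:
  "x \<in> carrier_vec (2 * n) \<Longrightarrow> y \<in> carrier_vec (2 * n) \<Longrightarrow> z \<in> carrier_vec (2 * n) \<Longrightarrow>
    sform n (x - y) z = sform n x z - sform n y z"
  by (simp add: sform_sum sum_subtractf[symmetric] algebra_simps)

lemma sform_zero_right [simp]: "y \<in> carrier_vec (2 * n) \<Longrightarrow> sform n y (0\<^sub>v (2 * n)) = 0"
  by (simp add: sform_sum)

lemmas sform_bilinear = sform_add_left sform_add_right sform_diff_left sform_diff_right
  sform_smult_left sform_smult_right

lemma sform_mult_mat_vec_right:
  assumes "x \<in> carrier_vec (2 * n)" "A \<in> carrier_mat (2 * n) m" "z \<in> carrier_vec m"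
  shows "sform n x (A *\<^sub>v z) = (\<Sum>j<m. sform n x (col A j) * z $ j)"
proof -
  have "sform n x (A *\<^sub>v z) =
    (\<Sum>i<2 * n. \<Sum>j<m. (- 1) ^ (i + 1) * x $ i * (A $$ (2 * n - 1 - i, j) * z $ j))"
    using assms by (auto simp: sform_sum scalar_prod_def atLeast0LessThan sum_distrib_left intro!: sum.cong)
  also have "\<dots> = (\<Sum>j<m. \<Sum>i<2 * n. (- 1) ^ (i + 1) * x $ i * (A $$ (2 * n - 1 - i, j) * z $ j))"
    by (rule sum.swap)
  also have "\<dots> = (\<Sum>j<m. sform n x (col A j) * z $ j)"
  proof (intro sum.cong refl)
    fix j assume "j \<in> {..<m}"
    then have "sform n x (col A j) = (\<Sum>i<2 * n. (- 1) ^ (i + 1) * x $ i * A $$ (2 * n - 1 - i, j))"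
      using assms by (subst sform_sum) (auto intro!: sum.cong)
    then show "(\<Sum>i<2 * n. (- 1) ^ (i + 1) * x $ i * (A $$ (2 * n - 1 - i, j) * z $ j)) = sform n x (col A j) * z $ j"
      by (simp add: sum_distrib_right mult.assoc)
  qed
  finally show ?thesis .
qed

lemma vec_eq_0_if_sform_0:
  assumes x: "x \<in> carrier_vec (2 * n)" and "\<And>y. y \<in> carrier_vec (2 * n) \<Longrightarrow> sform n x y = 0"
  shows "x = 0\<^sub>v (2 * n)"
proof (rule eq_vecI)
  fix i assume "i < dim_vec (0\<^sub>v (2 * n) :: 'a vec)"
  then have i: "i < 2 * n" by simp
  have "sform n x (unit_vec (2 * n) (2 * n - 1 - i)) =
    (\<Sum>l<2 * n. if l = i then (- 1) ^ (i + 1) * x $ i else 0)"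
    unfolding sform_sum[OF x unit_vec_carrier]
    using i by (intro sum.cong refl) (auto simp: unit_vec_def)
  then show "x $ i = 0\<^sub>v (2 * n) $ i" using i assms(2)[of "unit_vec (2 * n) (2 * n - 1 - i)"] by simp
qed (use x in simp)

lemma (in local_fields) sgi_power: "sgi (x ^ j) = sgi x ^ j"
  by (intro sgi_eqI) (simp add: sg_power)

section \<open>The operators F and V in coordinates\<close>

locale coxeter = local_fields D for D :: "('k::field, 'l::field) local_datum" +
  fixes n k :: nat
  assumes n_ge_1: "1 \<le> n" and k01: "k \<in> {0, 1}"
begin

abbreviation CV :: "'l vec set" where "CV \<equiv> carrier_vec (2 * n)"
abbreviation form :: "'l vec \<Rightarrow> 'l vec \<Rightarrow> 'l" ("\<langle>_,/ _\<rangle>") where "\<langle>x, y\<rangle> \<equiv> sform n x y"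
abbreviation gm :: "nat \<Rightarrow> 'l vec \<Rightarrow> 'l mat" where "gm \<equiv> g_mat D n k"
abbreviation F :: "'l vec \<Rightarrow> 'l vec" where "F \<equiv> Fr D n k"
abbreviation V :: "'l vec \<Rightarrow> 'l vec" where "V \<equiv> Ver D n k"
abbreviation \<alpha> :: "'l vec \<Rightarrow> 'l" where "\<alpha> \<equiv> alpha D n k"
abbreviation VS :: "'l vec set" where "VS \<equiv> V_symp D n k"

text \<open>The coordinate of index \<open>i\<close> of \<open>F x\<close> is \<open>coef i * sg (x $ tau i)\<close>.\<close>

definition tau :: "nat \<Rightarrow> nat" where
  "tau i = (if i = 0 then n else if i < n then i - 1 else if i = 2 * n - 1 then n - 1 else i + 1)"

definition tau_inv :: "nat \<Rightarrow> nat" where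
  "tau_inv j = (if j = n then 0 else if j < n - 1 then j + 1 else if j = n - 1 then 2 * n - 1 else j - 1)"

definition coef :: "nat \<Rightarrow> 'l" where
  "coef i = (if i = 0 then (- 1) ^ (n + 1) else 1) * (if even (tau i) then 1 else pi ^ k)"

text \<open>That the permutation commutes with the reflection of the indices
  (\<open>tau_flip\<close>) is what lets the monomial matrix b be a similitude.\<close>

lemma tau_less: "i < 2 * n \<Longrightarrow> tau i < 2 * n"
  and tau_inv_less: "i < 2 * n \<Longrightarrow> tau_inv i < 2 * n"
  and tau_inv_tau: "i < 2 * n \<Longrightarrow> tau_inv (tau i) = i"
  and tau_tau_inv: "i < 2 * n \<Longrightarrow> tau (tau_inv i) = i"
  and tau_flip: "i < 2 * n \<Longrightarrow> tau (2 * n - 1 - i) = 2 * n - 1 - tau i"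
  using n_ge_1 by (auto simp: tau_def tau_inv_def) (use n_ge_1 in linarith)

lemma coef_nonzero [simp]: "coef i \<noteq> 0"
  by (simp add: coef_def)

lemma ord_coef: "ordL D (coef i) = (if even (tau i) then 0 else int k)"
proof -
  have "ordL D ((- 1) ^ (n + 1)) = 0" by (cases "even n") auto
  then show ?thesis by (auto simp: coef_def ord_mult)
qed

lemma b0_index:
  assumes "i < 2 * n" "j < 2 * n"
  shows "(b0 n :: 'l mat) $$ (i, j) = (if j = tau i then if i = 0 then (- 1) ^ (n + 1) else 1 else 0)"
proof -
  have nth: "[1..<2 * n + 1] ! j = j + 1" using assms by (subst nth_upt) auto
  have len: "length [1..<2 * n + 1] = 2 * n" by (simp only: length_upt add_diff_cancel_right')
  have "(b0 n :: 'l mat) $$ (i, j) =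
    (if j + 1 < n then basis n (j + 2) else if j + 1 = n then basis n (2 * n)
     else if j = n then (- 1) ^ (n + 1) \<cdot>\<^sub>v basis n 1 else basis n j) $ i"
    unfolding b0_def using assms by (simp add: mat_of_cols_index len nth del: upt_Suc)
  also have "\<dots> = (if j = tau i then if i = 0 then (- 1) ^ (n + 1) else 1 else 0)"
    using assms n_ge_1 unfolding basis_def tau_def by (auto simp: unit_vec_def)
  finally show ?thesis .
qed

lemma b0_carrier [simp]: "b0 n \<in> carrier_mat (2 * n) (2 * n)"
  unfolding b0_def by (intro carrier_matI) (simp_all del: upt_Suc)

lemma b_mat_carrier [simp]: "b_mat D n k \<in> carrier_mat (2 * n) (2 * n)"
  unfolding b_mat_def A_mat_def by (intro mult_carrier_mat[OF b0_carrier]) (auto simp: mat_diag_def)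

lemma b_mat_index:
  assumes "i < 2 * n" "j < 2 * n"
  shows "b_mat D n k $$ (i, j) = (if j = tau i then coef i else 0)"
  using assms unfolding b_mat_def A_mat_def
  by (subst mat_diag_mult_right[OF b0_carrier]) (auto simp: b0_index coef_def)

lemma F_carrier [simp]: "F x \<in> CV"
  by (intro carrier_vecI) (simp add: Fr_def carrier_matD(1)[OF b_mat_carrier])

lemma dim_F [simp]: "dim_vec (F x) = 2 * n"
  using F_carrier carrier_vecD by blast

lemma F_index:
  assumes "x \<in> CV" "i < 2 * n"
  shows "F x $ i = coef i * sg (x $ tau i)"
proof -
  have "F x $ i = (\<Sum>j<2 * n. b_mat D n k $$ (i, j) * sg (x $ j))"
    using assms carrier_matD[OF b_mat_carrier] unfolding Fr_def
    by (auto simp: scalar_prod_def atLeast0LessThan intro!: sum.cong)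
  also have "\<dots> = (\<Sum>j<2 * n. if j = tau i then coef i * sg (x $ j) else 0)"
    using assms by (intro sum.cong) (auto simp: b_mat_index)
  finally show ?thesis using tau_less[OF assms(2)] by simp
qed

lemma F_diff: "x \<in> CV \<Longrightarrow> y \<in> CV \<Longrightarrow> F (x - y) = F x - F y"
  by (rule eq_vecI) (auto simp: F_index tau_less sg_diff right_diff_distrib)

lemma F_smult: "x \<in> CV \<Longrightarrow> F (c \<cdot>\<^sub>v x) = sg c \<cdot>\<^sub>v F x"
  by (rule eq_vecI) (auto simp: F_index tau_less sg_mult)

lemma F_funpow_carrier [simp]: "x \<in> CV \<Longrightarrow> (F ^^ j) x \<in> CV"
  by (cases j) auto

lemma F_form:
  assumes "x \<in> CV" "y \<in> CV"
  shows "\<langle>F x, F y\<rangle> = - (pi ^ k * sg \<langle>x, y\<rangle>)"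
proof -
  let ?g = "\<lambda>j. - (pi ^ k * sg ((- 1) ^ (j + 1) * x $ j * y $ (2 * n - 1 - j)))"
  have "\<langle>F x, F y\<rangle> = (\<Sum>i<2 * n. ?g (tau i))"
    unfolding sform_sum[OF F_carrier F_carrier]
  proof (intro sum.cong refl)
    fix i assume "i \<in> {..<2 * n}"
    then have i: "i < 2 * n" "2 * n - 1 - i < 2 * n" by auto
    have t: "tau i < 2 * n" using tau_less i by auto
    \<comment> \<open>An index and its mirror image have opposite parity, so exactly one of them
      carries the factor pi^k.\<close>
    have A: "(if even (tau i) then 1 else pi ^ k) * (if even (2 * n - 1 - tau i) then 1 else pi ^ k) = pi ^ k"
      using t by auto
    \<comment> \<open>Away from the ends \<open>tau\<close> shifts by one and flips the sign. At 0
      and 2n - 1 it jumps to n and n - 1, and the sign (-1)^(n+1) in \<open>b0\<close> restores the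
      same rule.\<close>
    have S: "(- 1) ^ (i + 1) * ((if i = 0 then (- 1) ^ (n + 1) else 1) * (if 2 * n - 1 - i = 0 then (- 1) ^ (n + 1) else 1))
       = - ((- 1 :: 'l) ^ (tau i + 1))"
      using i n_ge_1 by (auto simp: tau_def minus_one_power_iff)
    have "(- 1) ^ (i + 1) * (coef i * coef (2 * n - 1 - i)) =
      ((- 1) ^ (i + 1) * ((if i = 0 then (- 1) ^ (n + 1) else 1) * (if 2 * n - 1 - i = 0 then (- 1) ^ (n + 1) else 1))) *
      ((if even (tau i) then 1 else pi ^ k) * (if even (2 * n - 1 - tau i) then 1 else pi ^ k))"
      unfolding coef_def tau_flip[OF i(1)] by (simp only: mult_ac)
    also have "\<dots> = - ((- 1) ^ (tau i + 1)) * pi ^ k" by (simp only: A S)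
    finally have C: "(- 1) ^ (i + 1) * (coef i * coef (2 * n - 1 - i)) = - ((- 1) ^ (tau i + 1)) * pi ^ k" .
    have "(- 1) ^ (i + 1) * F x $ i * F y $ (2 * n - 1 - i) =
      ((- 1) ^ (i + 1) * (coef i * coef (2 * n - 1 - i))) * (sg (x $ tau i) * sg (y $ (2 * n - 1 - tau i)))"
      unfolding F_index[OF assms(1) i(1)] F_index[OF assms(2) i(2)] tau_flip[OF i(1)] by (simp only: mult_ac)
    also have "\<dots> = ?g (tau i)" unfolding C sg_mult sg_sign by (simp only: mult_ac mult_minus_left mult_minus_right)
    finally show "(- 1) ^ (i + 1) * F x $ i * F y $ (2 * n - 1 - i) = ?g (tau i)" .
  qed
  also have "\<dots> = (\<Sum>j<2 * n. ?g j)"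
    by (rule sum.reindex_bij_witness[of _ tau_inv tau]) (auto simp: tau_less tau_inv_less tau_inv_tau tau_tau_inv)
  also have "\<dots> = - (pi ^ k * sg \<langle>x, y\<rangle>)"
    unfolding sform_sum[OF assms] sg_sum sum_distrib_left sum_negf by simp
  finally show ?thesis .
qed

definition F_inv :: "'l vec \<Rightarrow> 'l vec" where
  "F_inv y = vec (2 * n) (\<lambda>j. sgi (y $ tau_inv j / coef (tau_inv j)))"

lemma F_inv_carrier [simp]: "F_inv y \<in> CV"
  by (simp add: F_inv_def)

lemma F_F_inv [simp]: "y \<in> CV \<Longrightarrow> F (F_inv y) = y"
  by (rule eq_vecI) (auto simp: F_index F_inv_def tau_less tau_inv_tau)

lemma F_inv_F [simp]: "x \<in> CV \<Longrightarrow> F_inv (F x) = x"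
  by (rule eq_vecI) (auto simp: F_index F_inv_def tau_inv_less tau_tau_inv)

lemma F_eq_iff: "x \<in> CV \<Longrightarrow> y \<in> CV \<Longrightarrow> F x = F y \<longleftrightarrow> x = y"
  by (metis F_inv_F)

lemma inv_into_F: "y \<in> CV \<Longrightarrow> inv_into CV F y = F_inv y"
  by (rule inv_into_f_eq) (auto simp: inj_on_def F_eq_iff)

lemma V_eq: "y \<in> CV \<Longrightarrow> V y = pi ^ k \<cdot>\<^sub>v F_inv y"
  by (simp add: Ver_def inv_into_F)

lemma V_carrier [simp]: "y \<in> CV \<Longrightarrow> V y \<in> CV"
  by (simp add: V_eq)

lemma F_V: "y \<in> CV \<Longrightarrow> F (V y) = pi ^ k \<cdot>\<^sub>v y"
  by (simp add: V_eq F_smult sg_power)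

text \<open>\<open>F\<close> is injective, so this equation characterizes V y. The rules for
  \<open>V\<close> are then read off from those for \<open>F\<close>.\<close>

lemma V_eqI: "x \<in> CV \<Longrightarrow> y \<in> CV \<Longrightarrow> F x = pi ^ k \<cdot>\<^sub>v y \<Longrightarrow> V y = x"
  using F_eq_iff[of "V y" x] F_V[of y] by simp

lemma V_smult: "x \<in> CV \<Longrightarrow> V (c \<cdot>\<^sub>v x) = sgi c \<cdot>\<^sub>v V x"
  by (intro V_eqI) (auto simp: F_smult F_V smult_smult_assoc mult.commute[of _ c])

lemma V_diff: "x \<in> CV \<Longrightarrow> y \<in> CV \<Longrightarrow> V (x - y) = V x - V y"
  by (intro V_eqI) (auto simp: F_diff F_V right_diff_distrib intro!: eq_vecI)

text \<open>Insert V x into \<open>F_form\<close> and cancel pi^k: up to sign and a Frobenius twist,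
  \<open>V\<close> is the adjoint of \<open>F\<close>. This is how the recursion for the G_i is
  controlled below.\<close>

lemma V_form_left:
  assumes "x \<in> CV" "y \<in> CV"
  shows "\<langle>V x, y\<rangle> = - sgi \<langle>x, F y\<rangle>"
proof -
  have "pi ^ k * \<langle>x, F y\<rangle> = - (pi ^ k * sg \<langle>V x, y\<rangle>)"
    using F_form[of "V x" y] assms by (simp add: F_V sform_smult_left)
  then have "pi ^ k * (\<langle>x, F y\<rangle> + sg \<langle>V x, y\<rangle>) = 0" by (simp add: distrib_left)
  then have "\<langle>x, F y\<rangle> = sg (- \<langle>V x, y\<rangle>)" by (simp add: sg_minus eq_neg_iff_add_eq_0)
  then show ?thesis by simp
qed

lemma V_form:
  assumes "x \<in> CV" "y \<in> CV"
  shows "\<langle>V x, V y\<rangle> = - (pi ^ k * sgi \<langle>x, y\<rangle>)"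
  using assms by (simp add: V_form_left F_V sgi_minus sform_smult_right sgi_mult sgi_power)

text \<open>Twice the weights of a norm that \<open>F\<close> scales by the slope \<open>k / 2\<close>.\<close>

definition W :: "nat \<Rightarrow> int" where
  "W i = (if odd i \<and> (i < n \<or> odd n) then int k
          else if even n \<and> n \<le> i \<and> even i then - int k else 0)"

definition weight_ge :: "int \<Rightarrow> 'l vec \<Rightarrow> bool" where
  "weight_ge t x \<longleftrightarrow> x \<in> CV \<and> (\<forall>i<2 * n. x $ i = 0 \<or> t \<le> 2 * ordL D (x $ i) + W i)"

text \<open>The balance that determines the weights: passing from coordinate \<open>tau i\<close> to
  i multiplies by \<open>coef i\<close>, and the weights absorb all of its valuation except the
  constant slope.\<close>

lemma W_tau: "i < 2 * n \<Longrightarrow> W i + 2 * ordL D (coef i) = W (tau i) + int k"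
proof -
  have "2 \<le> n" if "even n" using that n_ge_1 by (cases "n = 1") auto
  then show "i < 2 * n \<Longrightarrow> W i + 2 * ordL D (coef i) = W (tau i) + int k"
    using n_ge_1 by (cases "even n") (auto simp: W_def ord_coef tau_def)
qed

lemma weight_ge_carrier: "weight_ge t x \<Longrightarrow> x \<in> CV"
  by (simp add: weight_ge_def)

lemma weight_ge_F:
  assumes "weight_ge t x"
  shows "weight_ge (t + int k) (F x)"
  unfolding weight_ge_def
proof (intro conjI allI impI)
  fix i assume i: "i < 2 * n"
  have "x $ tau i = 0 \<or> t \<le> 2 * ordL D (x $ tau i) + W (tau i)"
    using assms tau_less[OF i] by (simp add: weight_ge_def)
  then show "F x $ i = 0 \<or> t + int k \<le> 2 * ordL D (F x $ i) + W i"
    using W_tau[OF i] F_index[OF weight_ge_carrier[OF assms] i]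
    by (cases "x $ tau i = 0") (auto simp: ord_mult)
qed simp

text \<open>In the doubled scale pi^k contributes 2k, of which the inverse of \<open>F\<close> takes
  back k.\<close>

lemma weight_ge_V:
  assumes "weight_ge t x"
  shows "weight_ge (t + int k) (V x)"
  unfolding weight_ge_def
proof (intro conjI allI impI)
  fix i assume i: "i < 2 * n"
  let ?j = "tau_inv i"
  have "x $ ?j = 0 \<or> t \<le> 2 * ordL D (x $ ?j) + W ?j"
    using assms tau_inv_less[OF i] by (simp add: weight_ge_def)
  then show "V x $ i = 0 \<or> t + int k \<le> 2 * ordL D (V x $ i) + W i"
    using W_tau[OF tau_inv_less[OF i]] V_eq[OF weight_ge_carrier[OF assms]] i
    by (cases "x $ ?j = 0") (auto simp: F_inv_def tau_tau_inv ord_mult ord_divide)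
qed (use assms weight_ge_carrier in simp)

lemma weight_ge_add:
  assumes "weight_ge t x" "weight_ge t y"
  shows "weight_ge t (x + y)"
  unfolding weight_ge_def
proof (intro conjI allI impI)
  fix i assume i: "i < 2 * n"
  have "x $ i = 0 \<or> t \<le> 2 * ordL D (x $ i) + W i" "y $ i = 0 \<or> t \<le> 2 * ordL D (y $ i) + W i"
    using assms i by (auto simp: weight_ge_def)
  then show "(x + y) $ i = 0 \<or> t \<le> 2 * ordL D ((x + y) $ i) + W i"
    using ord_add[of "x $ i" "y $ i"] i weight_ge_carrier[OF assms(2)]
    by (cases "x $ i = 0"; cases "y $ i = 0"; cases "x $ i + y $ i = 0") auto
qed (use assms weight_ge_carrier in simp)

lemma weight_ge_smult: "weight_ge t x \<Longrightarrow> c \<in> P 0 \<Longrightarrow> weight_ge t (c \<cdot>\<^sub>v x)"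
proof -
  assume x: "weight_ge t x" and c: "c \<in> P 0"
  have "(c \<cdot>\<^sub>v x) $ i = 0 \<or> t \<le> 2 * ordL D ((c \<cdot>\<^sub>v x) $ i) + W i" if "i < 2 * n" for i
  proof (cases "c = 0 \<or> x $ i = 0")
    case False
    then have "0 \<le> ordL D c" "t \<le> 2 * ordL D (x $ i) + W i"
      using x c that by (auto simp: weight_ge_def ppow_iff)
    then show ?thesis using False that weight_ge_carrier[OF x] by (simp add: ord_mult)
  qed (use that weight_ge_carrier[OF x] in auto)
  then show "weight_ge t (c \<cdot>\<^sub>v x)" using weight_ge_carrier[OF x] by (simp add: weight_ge_def)
qed

lemma weight_ge_mono: "weight_ge t x \<Longrightarrow> s \<le> t \<Longrightarrow> weight_ge s x"
  by (fastforce simp: weight_ge_def)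

lemma lattice_of_iff: "x \<in> lattice_of D n a \<longleftrightarrow> x \<in> CV \<and> (\<forall>i<2 * n. x $ i \<in> P (a (Suc i)))"
proof -
  have "(\<forall>i\<in>{1..2 * n}. x $ (i - 1) \<in> P (a i)) \<longleftrightarrow> (\<forall>i\<in>Suc ` {..<2 * n}. x $ (i - 1) \<in> P (a i))"
    by (simp only: image_Suc_lessThan)
  then show ?thesis unfolding lattice_of_def by auto
qed

lemma Lat_iff: "x \<in> Lat D n k \<longleftrightarrow> x \<in> CV \<and> (\<forall>i<2 * n. x $ i \<in> P (if even n \<and> n \<le> i \<and> even i then int k else 0))"
  unfolding Lat_def lattice_of_iff by (simp add: less_Suc_eq_le)

text \<open>Rounding to integers: since k is 0 or 1, the bound -k/2 on a valuation amounts to 0, and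
  the bound k/2 amounts to k. So \<open>Lat\<close> is the unit ball of the norm.\<close>

lemma Lat_iff_weight: "x \<in> Lat D n k \<longleftrightarrow> weight_ge 0 x"
proof -
  have "x $ i \<in> P (if even n \<and> n \<le> i \<and> even i then int k else 0) \<longleftrightarrow>
     x $ i = 0 \<or> 0 \<le> 2 * ordL D (x $ i) + W i" for i
    using k01 n_ge_1 by (cases "x $ i = 0") (auto simp: ppow_iff W_def)
  then show ?thesis by (simp only: Lat_iff weight_ge_def)
qed

end

section \<open>Integrality of the iterates of the Frobenius\<close>

lemma mat_solve_nonzero_det:
  fixes A :: "'a::field mat"
  assumes A: "A \<in> carrier_mat N N" "det A \<noteq> 0" and x: "x \<in> carrier_vec N"
  obtains a where "a \<in> carrier_vec N" "A *\<^sub>v a = x"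
proof -
  have "A \<in> Units (ring_mat TYPE('a) N ())" by (rule det_non_zero_imp_unit[OF A])
  then obtain B where B: "B \<in> carrier_mat N N" "A * B = 1\<^sub>m N"
    by (auto simp: Units_def ring_mat_simps)
  then have "A *\<^sub>v (B *\<^sub>v x) = x"
    using A x by (simp add: assoc_mult_mat_vec[symmetric, of _ N N _ N])
  with B x that show ?thesis by (metis mult_mat_vec_carrier)
qed

lemma mult_mat_vec_inj_nonzero_det:
  fixes A :: "'a::field mat"
  assumes A: "A \<in> carrier_mat N N" "det A \<noteq> 0"
    and "x \<in> carrier_vec N" "y \<in> carrier_vec N" "A *\<^sub>v x = A *\<^sub>v y"
  shows "x = y"
proof -
  have "A *\<^sub>v (x - y) = A *\<^sub>v x - A *\<^sub>v y" using assms by (simp add: mult_minus_distrib_mat_vec)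
  also have "\<dots> = 0\<^sub>v N" unfolding assms(5) by (rule minus_cancel_vec) (use assms in \<open>simp add: mult_mat_vec_carrier\<close>)
  finally have "x - y = 0\<^sub>v N"
    using det_0_iff_vec_prod_zero_field[OF A(1)] A(2) assms(3,4) by (metis minus_carrier_vec)
  then have "(x - y) $ i = 0" if "i < N" for i using that by simp
  then show ?thesis using assms(3,4) by (intro eq_vecI) auto
qed

lemma mult_mat_vec_index:
  assumes "A \<in> carrier_mat N M" "z \<in> carrier_vec M" "i < N"
  shows "(A *\<^sub>v z) $ i = (\<Sum>c<M. A $$ (i, c) * z $ c)"
  using assms by (auto simp: scalar_prod_def atLeast0LessThan intro!: sum.cong)

lemma mult_mat_unit_vec:
  fixes A :: "'a::field mat"
  assumes A: "A \<in> carrier_mat N M" and c: "c < M"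
  shows "A *\<^sub>v unit_vec M c = col A c"
proof (rule eq_vecI)
  fix i assume "i < dim_vec (col A c)"
  then have i: "i < N" using A by simp
  have "(A *\<^sub>v unit_vec M c) $ i = (\<Sum>d<M. if d = c then A $$ (i, d) else 0)"
    unfolding mult_mat_vec_index[OF A unit_vec_carrier i]
    by (intro sum.cong) (auto simp: unit_vec_def)
  then show "(A *\<^sub>v unit_vec M c) $ i = col A c $ i" using A c i by simp
qed (use A in simp)

context coxeter
begin

lemma F_mult_mat_vec:
  assumes "A \<in> carrier_mat (2 * n) m" "z \<in> carrier_vec m" "i < 2 * n"
  shows "F (A *\<^sub>v z) $ i = (\<Sum>c<m. F (col A c) $ i * sg (z $ c))"
proof -
  have Az: "A *\<^sub>v z \<in> CV" using assms by (metis mult_mat_vec_carrier)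
  have "F (A *\<^sub>v z) $ i = coef i * sg (\<Sum>c<m. A $$ (tau i, c) * z $ c)"
    using F_index[OF Az assms(3)] mult_mat_vec_index[OF assms(1,2) tau_less[OF assms(3)]] by simp
  also have "\<dots> = (\<Sum>c<m. coef i * sg (col A c $ tau i) * sg (z $ c))"
    using assms tau_less[OF assms(3)] by (auto simp: sg_sum sg_mult sum_distrib_left mult.assoc intro!: sum.cong)
  also have "\<dots> = (\<Sum>c<m. F (col A c) $ i * sg (z $ c))"
    using assms by (intro sum.cong refl) (subst F_index, auto)
  finally show ?thesis .
qed

text \<open>The proposed expansion is verified after applying \<open>F\<close>, where the
  corresponding rule for \<open>F\<close> is at hand.\<close>

lemma V_mult_mat_vec:
  assumes "A \<in> carrier_mat (2 * n) m" "z \<in> carrier_vec m" "i < 2 * n"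
  shows "V (A *\<^sub>v z) $ i = (\<Sum>c<m. V (col A c) $ i * sgi (z $ c))"
proof -
  define B where "B = mat (2 * n) m (\<lambda>(i, c). V (col A c) $ i)"
  define z' where "z' = vec m (\<lambda>c. sgi (z $ c))"
  have B: "B \<in> carrier_mat (2 * n) m" and z': "z' \<in> carrier_vec m" by (auto simp: B_def z'_def)
  have Vc: "V (col A c) \<in> CV" if "c < m" for c using assms(1) that by (metis V_carrier carrier_matD col_carrier_vec)
  have colB: "col B c = V (col A c)" if "c < m" for c
    using that Vc[OF that] by (intro eq_vecI) (auto simp: B_def)
  have cA: "col A c \<in> CV" if "c < m" for c using assms(1) that by (metis carrier_matD col_carrier_vec)
  have Az: "A *\<^sub>v z \<in> CV" using assms by (metis mult_mat_vec_carrier)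
  have "V (A *\<^sub>v z) = B *\<^sub>v z'"
  proof (rule V_eqI)
    show "B *\<^sub>v z' \<in> CV" using B z' by (metis mult_mat_vec_carrier)
    show "F (B *\<^sub>v z') = pi ^ k \<cdot>\<^sub>v (A *\<^sub>v z)"
    proof (rule eq_vecI)
      fix i assume "i < dim_vec (pi ^ k \<cdot>\<^sub>v (A *\<^sub>v z))"
      then have i: "i < 2 * n" using assms by simp
      have "F (B *\<^sub>v z') $ i = (\<Sum>c<m. (pi ^ k \<cdot>\<^sub>v col A c) $ i * z $ c)"
        unfolding F_mult_mat_vec[OF B z' i] using cA
        by (intro sum.cong refl) (auto simp: colB F_V z'_def)
      also have "\<dots> = (pi ^ k \<cdot>\<^sub>v (A *\<^sub>v z)) $ i"
        using mult_mat_vec_index[OF assms(1,2) i] i assms cA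
        by (auto simp: sum_distrib_left mult.assoc intro!: sum.cong)
      finally show "F (B *\<^sub>v z') $ i = (pi ^ k \<cdot>\<^sub>v (A *\<^sub>v z)) $ i" .
    qed (use assms in simp)
  qed (rule Az)
  then show ?thesis using mult_mat_vec_index[OF B z' assms(3)] assms(3) by (simp add: B_def z'_def)
qed

text \<open>The index counts half units: relations between iterates of an operator of slope k/2 have
  coefficients with half-integral natural bounds.\<close>

definition half_ppow :: "int \<Rightarrow> 'l set" where
  "half_ppow t = {x. x = 0 \<or> t \<le> 2 * ordL D x}"

lemma half_ppow_add: "x \<in> half_ppow t \<Longrightarrow> y \<in> half_ppow t \<Longrightarrow> x + y \<in> half_ppow t"
  using ord_add[of x y] by (cases "x = 0"; cases "y = 0"; cases "x + y = 0") (auto simp: half_ppow_def)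

lemma half_ppow_mult: "x \<in> half_ppow s \<Longrightarrow> y \<in> half_ppow t \<Longrightarrow> x * y \<in> half_ppow (s + t)"
  using ord_mult[of x y] by (cases "x = 0"; cases "y = 0") (auto simp: half_ppow_def)

lemma half_ppow_sum: "(\<And>i. i \<in> A \<Longrightarrow> f i \<in> half_ppow t) \<Longrightarrow> sum f A \<in> half_ppow t"
proof (induction A rule: infinite_finite_induct)
  case (insert x A)
  then show ?case using half_ppow_add[of "f x" t "sum f A"] by simp
qed (auto simp: half_ppow_def)

lemma half_ppow_prod:
  "finite A \<Longrightarrow> (\<And>i. i \<in> A \<Longrightarrow> f i \<in> half_ppow (t i)) \<Longrightarrow> prod f A \<in> half_ppow (sum t A)"
  by (induction A rule: finite_induct) (auto intro: half_ppow_mult simp: half_ppow_def[of 0])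

lemma half_ppow_mono: "x \<in> half_ppow t \<Longrightarrow> s \<le> t \<Longrightarrow> x \<in> half_ppow s"
  by (auto simp: half_ppow_def)

lemma half_ppow_sg [simp]: "sg x \<in> half_ppow t \<longleftrightarrow> x \<in> half_ppow t"
  by (auto simp: half_ppow_def)

lemma weight_ge_funpow: "weight_ge t x \<Longrightarrow> weight_ge (t + int k * int j) ((F ^^ j) x)"
proof (induction j)
  case (Suc j)
  then show ?case using weight_ge_F[of "t + int k * int j" "(F ^^ j) x"] by (simp add: algebra_simps)
qed simp

lemma weight_ge_exists: "x \<in> CV \<Longrightarrow> \<exists>t. weight_ge t x"
proof (intro exI)
  assume x: "x \<in> CV"
  let ?g = "\<lambda>i. \<bar>2 * ordL D (x $ i) + W i\<bar>"
  have "- (\<Sum>i<2 * n. ?g i) \<le> 2 * ordL D (x $ i) + W i" if "i < 2 * n" for i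
    using member_le_sum[of i "{..<2 * n}" ?g] that by force
  then show "weight_ge (- (\<Sum>i<2 * n. ?g i)) x" using x by (auto simp: weight_ge_def)
qed

text \<open>
  Among the families of \<open>2n\<close> iterates of \<open>F\<close> on a cyclic vector, take one whose determinant has
  minimal valuation after normalizing \<open>F\<close> by its slope, with smallest total exponent among those.
  By Cramer's rule all iterates are integral over it, and a gap in the exponents would contradict
  minimality; hence the first \<open>2n\<close> iterates already have this property.
\<close>

lemma slope_bound:
  assumes v: "v \<in> CV" and indep: "det (mat (2 * n) (2 * n) (\<lambda>(i, c). (F ^^ c) v $ i)) \<noteq> 0"
  shows "\<exists>a. (\<forall>i<2 * n. a i \<in> half_ppow (int k * (int j - int i))) \<and>
    (\<forall>x\<in>CV. \<langle>x, (F ^^ j) v\<rangle> = (\<Sum>i<2 * n. \<langle>x, (F ^^ i) v\<rangle> * a i))"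
proof -
  define f where "f = (\<lambda>j. (F ^^ j) v)"
  define M where "M = (\<lambda>s. mat (2 * n) (2 * n) (\<lambda>(i, c). f (s c) $ i))"
  define S where "S = (\<lambda>s :: nat \<Rightarrow> nat. \<Sum>c<2 * n. s c)"
  \<comment> \<open>Twice the valuation of the determinant of the family with exponents s, once each
    iterate F^j v has been freed of its expected growth jk/2.\<close>
  define Q where "Q = (\<lambda>s. 2 * ordL D (det (M s)) - int k * int (S s))"
  have f_CV: "f j \<in> CV" for j by (simp add: f_def v)
  have f_Suc: "f (Suc j) = F (f j)" for j by (simp add: f_def)
  have M: "M s \<in> carrier_mat (2 * n) (2 * n)" for s by (simp add: M_def)
  have colM: "col (M s) c = f (s c)" if "c < 2 * n" for s c
    using that f_CV[of "s c"] by (intro eq_vecI) (auto simp: M_def)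
  obtain t where t: "weight_ge t v" using weight_ge_exists[OF v] by blast
  \<comment> \<open>A lower bound for \<open>Q\<close> over all independent families, so that a
    minimum exists: every term of the Leibniz expansion contains each row and each exponent exactly
    once.\<close>
  define Q0 where "Q0 = (\<Sum>i<2 * n. t - W i)"
  have Q0: "Q0 \<le> Q s" if "det (M s) \<noteq> 0" for s
  proof -
    have "det (M s) \<in> half_ppow (Q0 + int k * int (S s))"
      unfolding det_def'[OF M]
    proof (rule half_ppow_sum)
      fix p assume "p \<in> {p. p permutes {0..<2 * n}}"
      then have p: "p permutes {0..<2 * n}" by simp
      have "(\<Prod>i = 0..<2 * n. M s $$ (i, p i)) \<in>
        half_ppow (\<Sum>i = 0..<2 * n. t + int k * int (s (p i)) - W i)"
      proof (rule half_ppow_prod)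
        fix i assume i: "i \<in> {0..<2 * n}"
        then have "p i < 2 * n" using p permutes_in_image by fastforce
        then have "M s $$ (i, p i) = f (s (p i)) $ i" using i by (simp add: M_def)
        then show "M s $$ (i, p i) \<in> half_ppow (t + int k * int (s (p i)) - W i)"
          using weight_ge_funpow[OF t, of "s (p i)"] i by (auto simp: weight_ge_def half_ppow_def f_def)
      qed simp
      moreover have "(\<Sum>i = 0..<2 * n. t + int k * int (s (p i)) - W i) = Q0 + int k * int (S s)"
      proof -
        have "(\<Sum>i = 0..<2 * n. int (s (p i))) = (\<Sum>i = 0..<2 * n. int (s i))"
          using sum.permute[OF p, of "\<lambda>i. int (s i)"] by (simp add: o_def)
        then show ?thesis
          by (simp add: Q0_def S_def sum.distrib sum_subtractf atLeast0LessThan flip: sum_distrib_left)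
      qed
      moreover have "signof p \<in> half_ppow 0" by (simp add: half_ppow_def sign_def)
      ultimately show "signof p * (\<Prod>i = 0..<2 * n. M s $$ (i, p i)) \<in> half_ppow (Q0 + int k * int (S s))"
        using half_ppow_mult[of "signof p" 0] by fastforce
    qed
    then show ?thesis using that by (simp add: half_ppow_def Q_def)
  qed
  have id: "det (M id) \<noteq> 0" using indep by (simp add: M_def f_def)
  obtain s0 where s0: "det (M s0) \<noteq> 0" "\<And>s. det (M s) \<noteq> 0 \<Longrightarrow> nat (Q s0 - Q0) \<le> nat (Q s - Q0)"
    using ex_has_least_nat[of "\<lambda>s. det (M s) \<noteq> 0" id "\<lambda>s. nat (Q s - Q0)"] id by blast
  obtain s where s: "det (M s) \<noteq> 0" "Q s = Q s0" "\<And>s'. det (M s') \<noteq> 0 \<Longrightarrow> Q s' = Q s0 \<Longrightarrow> S s \<le> S s'"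
    using ex_has_least_nat[of "\<lambda>s. det (M s) \<noteq> 0 \<and> Q s = Q s0" s0 S] s0(1) by blast
  have min: "Q s \<le> Q s'" if "det (M s') \<noteq> 0" for s'
    using s0(2)[OF that] Q0[OF that] Q0[OF s0(1)] s(2) by linarith
  obtain A where A: "\<And>j. A j \<in> CV" "\<And>j. M s *\<^sub>v A j = f j"
  proof -
    have "\<exists>a. a \<in> CV \<and> M s *\<^sub>v a = f j" for j
      using mat_solve_nonzero_det[OF M s(1) f_CV[of j]] by blast
    then show ?thesis using that by metis
  qed
  have bound: "A j $ c \<in> half_ppow (int k * (int j - int (s c)))"
    and strict: "j < s c \<Longrightarrow> A j $ c \<in> half_ppow (int k * (int j - int (s c)) + 1)"
    if c: "c < 2 * n" for j c
  proof -
    let ?s = "s(c := j)"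
    \<comment> \<open>Exchanging column c for the j-th iterate multiplies the determinant by the
      coefficient \<open>A j $ c\<close>. Minimality of \<open>Q\<close> bounds it from below; if j
      < s c, the exchange lowers the total exponent, so by the second minimality \<open>Q\<close>
      must rise strictly.\<close>
    have "M ?s = replace_col (M s) (M s *\<^sub>v A j) c"
      using c f_CV unfolding A(2) by (intro eq_matI) (auto simp: replace_col_def M_def)
    then have d: "det (M ?s) = A j $ c * det (M s)" using cramer_lemma_mat[OF M A(1) c] by simp
    have "S ?s + s c = S s + j"
      using c by (simp add: S_def sum.remove[of "{..<2 * n}" c])
    then have S: "int (S ?s) = int (S s) + int j - int (s c)" by linarith
    have Q: "Q ?s = Q s + 2 * ordL D (A j $ c) - int k * (int j - int (s c))" if "A j $ c \<noteq> 0"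
    proof -
      have "int k * int (S ?s) = int k * int (S s) + int k * (int j - int (s c))"
        unfolding S by (simp add: algebra_simps)
      then show ?thesis using that s(1) d by (simp add: Q_def ord_mult)
    qed
    show "A j $ c \<in> half_ppow (int k * (int j - int (s c)))"
      using Q min[of ?s] d s(1) by (fastforce simp: half_ppow_def)
    assume "j < s c"
    then have "Q ?s \<noteq> Q s" if "A j $ c \<noteq> 0" using s(2) s(3)[of ?s] d s(1) S that by auto
    then show "A j $ c \<in> half_ppow (int k * (int j - int (s c)) + 1)"
      using Q min[of ?s] d s(1) by (fastforce simp: half_ppow_def)
  qed
  have A_unit: "A (s c) = unit_vec (2 * n) c" if "c < 2 * n" for c
  proof (rule mult_mat_vec_inj_nonzero_det[OF M s(1) A(1)])
    show "M s *\<^sub>v A (s c) = M s *\<^sub>v unit_vec (2 * n) c"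
      unfolding A(2) using colM[OF that, of s] mult_mat_unit_vec[OF M that] by simp
  qed simp
  \<comment> \<open>Apply the semilinear \<open>F\<close> to the relation for f j and expand each f
    (Suc (s c)) again in the chosen family.\<close>
  have A_Suc: "A (Suc j) $ e = (\<Sum>c<2 * n. sg (A j $ c) * A (Suc (s c)) $ e)" if e: "e < 2 * n" for j e
  proof -
    define y where "y = vec (2 * n) (\<lambda>e. \<Sum>c<2 * n. sg (A j $ c) * A (Suc (s c)) $ e)"
    have "M s *\<^sub>v A (Suc j) = M s *\<^sub>v y"
    proof (rule eq_vecI)
      fix i assume "i < dim_vec (M s *\<^sub>v y)"
      then have i: "i < 2 * n" using M[of s] by simp
      have "(M s *\<^sub>v A (Suc j)) $ i = F (M s *\<^sub>v A j) $ i" by (simp add: A(2) f_Suc)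
      also have "\<dots> = (\<Sum>c<2 * n. f (Suc (s c)) $ i * sg (A j $ c))"
        unfolding F_mult_mat_vec[OF M A(1) i] by (intro sum.cong) (auto simp: colM f_Suc)
      also have "\<dots> = (\<Sum>c<2 * n. \<Sum>e<2 * n. M s $$ (i, e) * (sg (A j $ c) * A (Suc (s c)) $ e))"
      proof (intro sum.cong refl)
        fix c
        have "f (Suc (s c)) $ i = (\<Sum>e<2 * n. M s $$ (i, e) * A (Suc (s c)) $ e)"
          using mult_mat_vec_index[OF M[of s] A(1)[of "Suc (s c)"] i] by (simp only: A(2))
        then show "f (Suc (s c)) $ i * sg (A j $ c) =
          (\<Sum>e<2 * n. M s $$ (i, e) * (sg (A j $ c) * A (Suc (s c)) $ e))"
          by (simp only: sum_distrib_right) (simp only: mult_ac)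
      qed
      also have "\<dots> = (\<Sum>e<2 * n. \<Sum>c<2 * n. M s $$ (i, e) * (sg (A j $ c) * A (Suc (s c)) $ e))"
        by (rule sum.swap)
      also have "\<dots> = (M s *\<^sub>v y) $ i"
        by (subst mult_mat_vec_index[OF M _ i]) (auto simp: y_def sum_distrib_left)
      finally show "(M s *\<^sub>v A (Suc j)) $ i = (M s *\<^sub>v y) $ i" .
    qed (use M[of s] in simp)
    then have "A (Suc j) = y"
      by (intro mult_mat_vec_inj_nonzero_det[OF M s(1) A(1)]) (auto simp: y_def)
    then show ?thesis using e by (simp add: y_def)
  qed
  have inj: "inj_on s {..<2 * n}"
  proof (rule inj_onI)
    fix c c' assume c: "c \<in> {..<2 * n}" "c' \<in> {..<2 * n}" "s c = s c'"
    have u: "A (s c) = unit_vec (2 * n) c" "A (s c') = unit_vec (2 * n) c'" using A_unit c(1,2) by blast+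
    have "unit_vec (2 * n) c = (unit_vec (2 * n) c' :: 'l vec)"
      by (rule trans[OF u(1)[symmetric]]) (simp only: c(3) u(2))
    then have "(unit_vec (2 * n) c :: 'l vec) $ c = unit_vec (2 * n) c' $ c" by (rule arg_cong)
    then show "c = c'" using c(1,2) by (auto simp: unit_vec_def split: if_splits)
  qed
  have "{..<2 * n} \<subseteq> s ` {..<2 * n}"
  proof (rule ccontr)
    assume "\<not> ?thesis"
    then have ex: "\<exists>j. j < 2 * n \<and> j \<notin> s ` {..<2 * n}" by auto
    then obtain j where j: "j < 2 * n" "j \<notin> s ` {..<2 * n}" by blast
    \<comment> \<open>2n distinct exponents cannot all lie below j < 2n, so one of them lies beyond
      the gap j.\<close>
    obtain c0 where c0: "c0 < 2 * n" "j < s c0"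
    proof (rule ccontr)
      assume "\<not> thesis"
      with that have "\<forall>c<2 * n. s c \<le> j" by (meson not_less)
      then have "\<forall>c<2 * n. s c < j" using j(2) by (metis image_eqI lessThan_iff nat_less_le)
      then have "s ` {..<2 * n} \<subseteq> {..<j}" by auto
      then have "2 * n \<le> j" using card_mono[of "{..<j}" "s ` {..<2 * n}"] inj by (simp add: card_image)
      then show False using j(1) by simp
    qed
    \<comment> \<open>From the gap on, coefficients at exponents beyond it stay strictly better than
      the slope bound. A contribution through an exponent beyond the gap is strict by induction; one
      through an exponent below the gap advances to j at most, where \<open>strict\<close>
      applies.\<close>
    have claim: "c < 2 * n \<Longrightarrow> j < s c \<Longrightarrow> A (j + m) $ c \<in> half_ppow (int k * (int (j + m) - int (s c)) + 1)" for m c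
    proof (induction m arbitrary: c)
      case 0
      then show ?case using strict[of c j] by simp
    next
      case (Suc m)
      have "A (Suc (j + m)) $ c \<in> half_ppow (int k * (int (j + Suc m) - int (s c)) + 1)"
      proof (subst A_Suc[OF Suc.prems(1)], rule half_ppow_sum)
        fix d assume "d \<in> {..<2 * n}"
        then have d: "d < 2 * n" by simp
        show "sg (A (j + m) $ d) * A (Suc (s d)) $ c \<in> half_ppow (int k * (int (j + Suc m) - int (s c)) + 1)"
        proof (cases "j < s d")
          case True
          have "sg (A (j + m) $ d) \<in> half_ppow (int k * (int (j + m) - int (s d)) + 1)"
            using Suc.IH[OF d True] by simp
          from half_ppow_mult[OF this bound[OF Suc.prems(1), of "Suc (s d)"]] show ?thesis
            by (rule half_ppow_mono) (simp add: algebra_simps)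
        next
          case False
          then have "s d < j" using j(2) d by (metis image_eqI lessThan_iff linorder_neqE_nat)
          then have 1: "Suc (s d) < s c" using Suc.prems(2) by simp
          have "sg (A (j + m) $ d) \<in> half_ppow (int k * (int (j + m) - int (s d)))"
            using bound[OF d, of "j + m"] by simp
          from half_ppow_mult[OF this strict[OF Suc.prems(1) 1]] show ?thesis
            by (rule half_ppow_mono) (simp add: algebra_simps)
        qed
      qed
      then show ?case by simp
    qed
    \<comment> \<open>At its own exponent s c0 the member c0 has coefficient 1, of valuation exactly
      0.\<close>
    have "A (s c0) $ c0 \<in> half_ppow 1" using claim[OF c0, of "s c0 - j"] c0 by simp
    then show False using A_unit[OF c0(1)] c0 by (simp add: half_ppow_def)
  qed
  then have img: "s ` {..<2 * n} = {..<2 * n}"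
    using inj by (metis card_image card_subset_eq finite_imageI finite_lessThan)
  then have bij: "bij_betw s {..<2 * n} {..<2 * n}" using inj by (simp add: bij_betw_def)
  define r where "r = inv_into {..<2 * n} s"
  have r: "r i < 2 * n" "s (r i) = i" if "i < 2 * n" for i
    using that img unfolding r_def by (metis inv_into_into lessThan_iff, metis f_inv_into_f lessThan_iff)
  have rs: "r (s c) = c" if "c < 2 * n" for c using that inj by (simp add: r_def)
  have "\<langle>x, f j\<rangle> = (\<Sum>i<2 * n. \<langle>x, f i\<rangle> * A j $ r i)" if "x \<in> CV" for x
  proof -
    have "\<langle>x, f j\<rangle> = (\<Sum>c<2 * n. \<langle>x, f (s c)\<rangle> * A j $ r (s c))"
      unfolding A(2)[of j, symmetric] sform_mult_mat_vec_right[OF that M A(1)]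
      by (intro sum.cong) (auto simp: colM rs)
    then show ?thesis using sum.reindex_bij_betw[OF bij, of "\<lambda>i. \<langle>x, f i\<rangle> * A j $ r i"] by simp
  qed
  moreover have "A j $ r i \<in> half_ppow (int k * (int j - int i))" if "i < 2 * n" for i
    using bound[OF r(1)[OF that], of j] r(2)[OF that] by simp
  ultimately show ?thesis unfolding f_def by (intro exI[of _ "\<lambda>i. A j $ r i"]) auto
qed

section \<open>Pairings between the iterates of a vector in \<open>V_symp\<close>\<close>

lemma F_funpow_form:
  assumes "x \<in> CV" "y \<in> CV"
  shows "\<langle>(F ^^ i) x, (F ^^ i) y\<rangle> = (- (pi ^ k)) ^ i * (sg ^^ i) \<langle>x, y\<rangle>"
  using assms
  by (induction i) (auto simp: F_form sg_mult sg_power sg_minus)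

lemma sg_funpow_zero [simp]: "(sg ^^ i) x = 0 \<longleftrightarrow> x = 0"
  by (induction i) auto

lemma ord_sg_funpow [simp]: "ordL D ((sg ^^ i) x) = ordL D x"
  by (induction i) auto

lemma V_sympD:
  assumes "v \<in> VS"
  shows "v \<in> CV" "1 \<le> i \<Longrightarrow> i < n \<Longrightarrow> \<langle>v, (F ^^ i) v\<rangle> = 0" "\<alpha> v \<noteq> 0" "\<langle>v, (F ^^ n) v\<rangle> = \<alpha> v"
  using assms by (auto simp: V_symp_def alpha_def)

lemma F_form_less_n:
  assumes "v \<in> VS" "i \<le> j" "j < i + n"
  shows "\<langle>(F ^^ i) v, (F ^^ j) v\<rangle> = 0" "\<langle>(F ^^ j) v, (F ^^ i) v\<rangle> = 0"
proof -
  note v = V_sympD[OF assms(1)]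
  have "\<langle>v, (F ^^ (j - i)) v\<rangle> = 0"
    using v(2)[of "j - i"] sform_self[OF v(1)] assms by (cases "j = i") auto
  moreover have "(F ^^ j) v = (F ^^ i) ((F ^^ (j - i)) v)"
    using assms(2) by (metis add_diff_inverse_nat funpow_add not_less o_apply)
  ultimately show 1: "\<langle>(F ^^ i) v, (F ^^ j) v\<rangle> = 0"
    using F_funpow_form[of v "(F ^^ (j - i)) v" i] v(1) by simp
  show "\<langle>(F ^^ j) v, (F ^^ i) v\<rangle> = 0"
    using sform_commute[of "(F ^^ j) v" n "(F ^^ i) v"] 1 v(1) by simp
qed

lemma F_form_eq_n:
  assumes "v \<in> VS"
  shows "\<langle>(F ^^ i) v, (F ^^ (n + i)) v\<rangle> \<noteq> 0" "\<langle>(F ^^ (n + i)) v, (F ^^ i) v\<rangle> \<noteq> 0"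
proof -
  note v = V_sympD[OF assms(1)]
  have "(F ^^ (n + i)) v = (F ^^ i) ((F ^^ n) v)" by (metis add.commute funpow_add o_apply)
  then show 1: "\<langle>(F ^^ i) v, (F ^^ (n + i)) v\<rangle> \<noteq> 0"
    using F_funpow_form[of v "(F ^^ n) v" i] v by simp
  show "\<langle>(F ^^ (n + i)) v, (F ^^ i) v\<rangle> \<noteq> 0"
    using sform_commute[of "(F ^^ (n + i)) v" n "(F ^^ i) v"] 1 v(1) by simp
qed

text \<open>The Gram matrix of the iterates vanishes at distance less than n from the diagonal and
  is nonzero at distance n. Pairing a relation with F^j v, for j from n - 1 downwards, kills the
  coefficients n + j in turn; pairing with F^(n+j) v, for j upwards, then kills the coefficients
  j.\<close>

lemma iterates_independent:
  assumes v: "v \<in> VS"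
  shows "det (mat (2 * n) (2 * n) (\<lambda>(i, c). (F ^^ c) v $ i)) \<noteq> 0"
proof
  let ?M = "mat (2 * n) (2 * n) (\<lambda>(i, c). (F ^^ c) v $ i)"
  note vC = V_sympD(1)[OF v]
  have M: "?M \<in> carrier_mat (2 * n) (2 * n)" by simp
  assume "det ?M = 0"
  then obtain a where a: "a \<in> CV" "a \<noteq> 0\<^sub>v (2 * n)" "?M *\<^sub>v a = 0\<^sub>v (2 * n)"
    using det_0_iff_vec_prod_zero_field[OF M] by blast
  have col: "col ?M c = (F ^^ c) v" if "c < 2 * n" for c
    using that carrier_vecD[OF F_funpow_carrier[OF vC, of c]] by (intro eq_vecI) auto
  have rel: "(\<Sum>c<2 * n. \<langle>(F ^^ j) v, (F ^^ c) v\<rangle> * a $ c) = 0" for j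
  proof -
    have "\<langle>(F ^^ j) v, ?M *\<^sub>v a\<rangle> = (\<Sum>c<2 * n. \<langle>(F ^^ j) v, col ?M c\<rangle> * a $ c)"
      by (rule sform_mult_mat_vec_right[OF _ M a(1)]) (simp add: vC)
    also have "\<dots> = (\<Sum>c<2 * n. \<langle>(F ^^ j) v, (F ^^ c) v\<rangle> * a $ c)"
      by (rule sum.cong) (simp_all only: col lessThan_iff)
    finally show ?thesis unfolding a(3) using vC by simp
  qed
  have only: "a $ c = 0"
    if "c < 2 * n" "\<langle>(F ^^ j) v, (F ^^ c) v\<rangle> \<noteq> 0"
      "\<And>d. d < 2 * n \<Longrightarrow> d \<noteq> c \<Longrightarrow> \<langle>(F ^^ j) v, (F ^^ d) v\<rangle> * a $ d = 0" for c j
  proof -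
    have "(\<Sum>d<2 * n. \<langle>(F ^^ j) v, (F ^^ d) v\<rangle> * a $ d) = (\<Sum>d\<in>{c}. \<langle>(F ^^ j) v, (F ^^ d) v\<rangle> * a $ d)"
      using that by (intro sum.mono_neutral_right) auto
    then show ?thesis using rel[of j] that(2) by simp
  qed
  have upper: "a $ (n + j) = 0" if "j < n" for j
    using that
  proof (induction "n - j" arbitrary: j rule: less_induct)
    case less
    show ?case
    proof (rule only)
      show "\<langle>(F ^^ j) v, (F ^^ (n + j)) v\<rangle> \<noteq> 0" by (rule F_form_eq_n[OF v])
      fix d assume d: "d < 2 * n" "d \<noteq> n + j"
      consider "d < n + j" | "n + j < d" using d by linarith
      then show "\<langle>(F ^^ j) v, (F ^^ d) v\<rangle> * a $ d = 0"
      proof cases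
        case 1
        then show ?thesis using F_form_less_n[OF v] less.prems by (cases "j \<le> d") auto
      next
        case 2
        then have "a $ (n + (d - n)) = 0" using less.prems d by (intro less.hyps) auto
        then show ?thesis using 2 by simp
      qed
    qed (use less.prems in simp)
  qed
  have lower: "a $ j = 0" if "j < n" for j
    using that
  proof (induction j rule: less_induct)
    case (less j)
    show ?case
    proof (rule only)
      show "\<langle>(F ^^ (n + j)) v, (F ^^ j) v\<rangle> \<noteq> 0" by (rule F_form_eq_n[OF v])
      fix d assume d: "d < 2 * n" "d \<noteq> j"
      consider "d < j" | "j < d" "d < n" | "n \<le> d" using d by linarith
      then show "\<langle>(F ^^ (n + j)) v, (F ^^ d) v\<rangle> * a $ d = 0"
      proof cases
        case 1
        then show ?thesis using less by simp
      next
        case 2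
        then show ?thesis using F_form_less_n(2)[OF v, of d "n + j"] by simp
      next
        case 3
        then show ?thesis using upper[of "d - n"] d by simp
      qed
    qed (use less.prems in simp)
  qed
  have "a = 0\<^sub>v (2 * n)"
  proof (rule eq_vecI)
    fix i assume "i < dim_vec (0\<^sub>v (2 * n) :: 'l vec)"
    then show "a $ i = 0\<^sub>v (2 * n) $ i" using lower[of i] upper[of "i - n"] by (cases "i < n") auto
  qed (use a in simp)
  then show False using a(2) by simp
qed

text \<open>The pairing is shifted by F^(n-1) because among the first 2n iterates only F^(2n-1) v
  pairs nontrivially with F^(n-1) v. Expanding F^(n-1+j) v in them leaves a single term: up to
  common factors and twists it is \<alpha> times the last coefficient, which is integral because n -
  1 + j is at least 2n - 1.\<close>

lemma form_iterate_integral: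
  assumes v: "v \<in> VS"
  shows "\<langle>v, (F ^^ j) v\<rangle> \<in> P (ordL D (\<alpha> v))"
proof (cases "j < n")
  case True
  then show ?thesis using F_form_less_n(1)[OF v, of 0 j] by simp
next
  case False
  note vC = V_sympD(1)[OF v]
  define m where "m = j - n"
  have j: "j = n + m" using False by (simp add: m_def)
  obtain a where a: "\<And>i. i < 2 * n \<Longrightarrow> a i \<in> half_ppow (int k * (int (2 * n - 1 + m) - int i))"
    "\<And>x. x \<in> CV \<Longrightarrow> \<langle>x, (F ^^ (2 * n - 1 + m)) v\<rangle> = (\<Sum>i<2 * n. \<langle>x, (F ^^ i) v\<rangle> * a i)"
    using slope_bound[OF vC iterates_independent[OF v], of "2 * n - 1 + m"] by blast
  have shift: "\<langle>(F ^^ (n - 1)) v, (F ^^ (n - 1 + i)) v\<rangle> = (- (pi ^ k)) ^ (n - 1) * (sg ^^ (n - 1)) \<langle>v, (F ^^ i) v\<rangle>" for i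
    using F_funpow_form[of v "(F ^^ i) v" "n - 1"] vC by (simp add: funpow_add)
  have "\<langle>(F ^^ (n - 1)) v, (F ^^ (n - 1 + j)) v\<rangle> = (\<Sum>i<2 * n. \<langle>(F ^^ (n - 1)) v, (F ^^ i) v\<rangle> * a i)"
  proof -
    have "n - 1 + j = 2 * n - 1 + m" using j n_ge_1 by simp
    then show ?thesis using a(2)[of "(F ^^ (n - 1)) v"] vC by simp
  qed
  also have "\<dots> = (\<Sum>i\<in>{n - 1 + n}. \<langle>(F ^^ (n - 1)) v, (F ^^ i) v\<rangle> * a i)"
  proof (rule sum.mono_neutral_right)
    show "\<forall>i\<in>{..<2 * n} - {n - 1 + n}. \<langle>(F ^^ (n - 1)) v, (F ^^ i) v\<rangle> * a i = 0"
    proof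
      fix i assume "i \<in> {..<2 * n} - {n - 1 + n}"
      then have "i < n - 1 + n" by auto
      then show "\<langle>(F ^^ (n - 1)) v, (F ^^ i) v\<rangle> * a i = 0"
        using F_form_less_n[OF v] n_ge_1 by (cases "n - 1 \<le> i") auto
    qed
  qed (use n_ge_1 in auto)
  also have "\<dots> = \<langle>(F ^^ (n - 1)) v, (F ^^ (n - 1 + n)) v\<rangle> * a (n - 1 + n)" by simp
  finally have "(sg ^^ (n - 1)) \<langle>v, (F ^^ j) v\<rangle> = (sg ^^ (n - 1)) (\<alpha> v) * a (n - 1 + n)"
    unfolding shift V_sympD(4)[OF v] by (simp add: mult.assoc)
  moreover have "a (n - 1 + n) \<in> P 0"
  proof -
    have "a (n - 1 + n) \<in> half_ppow (int k * (int (2 * n - 1 + m) - int (n - 1 + n)))"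
      using n_ge_1 by (intro a(1)) auto
    moreover have "int (2 * n - 1 + m) - int (n - 1 + n) = int m" using n_ge_1 by simp
    ultimately have "a (n - 1 + n) \<in> half_ppow (int k * int m)" by (simp only:)
    then have "a (n - 1 + n) \<in> half_ppow 0" by (rule half_ppow_mono) simp
    then show ?thesis by (auto simp: half_ppow_def ppow_def)
  qed
  ultimately have "(sg ^^ (n - 1)) \<langle>v, (F ^^ j) v\<rangle> \<in> P (ordL D (\<alpha> v))"
    using ppow_mult_right[of "(sg ^^ (n - 1)) (\<alpha> v)" "ordL D (\<alpha> v)"] by (simp add: ppow_def)
  then show ?thesis by (simp add: ppow_def)
qed

end

section \<open>The Gram matrix of the Coxeter basis\<close>

definition similitude :: "nat \<Rightarrow> 'a::field mat \<Rightarrow> 'a \<Rightarrow> bool" where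
  "similitude n A c \<longleftrightarrow> A \<in> carrier_mat (2 * n) (2 * n) \<and>
     (\<forall>x\<in>carrier_vec (2 * n). \<forall>y\<in>carrier_vec (2 * n). sform n (A *\<^sub>v x) (A *\<^sub>v y) = c * sform n x y)"

lemma sform_unit_vec:
  assumes "i < 2 * n" "j < 2 * n"
  shows "sform n (unit_vec (2 * n) i) (unit_vec (2 * n) j :: 'a::field vec) =
    (if i + j + 1 = 2 * n then (- 1) ^ j else 0)"
proof -
  have "Omega n *\<^sub>v unit_vec (2 * n) j = (col (Omega n) j :: 'a vec)"
    by (rule mult_mat_unit_vec[OF Omega_carrier assms(2)])
  then show ?thesis using assms carrier_matD[OF Omega_carrier[of n, where ?'a='a]]
    by (simp add: sform_def Omega_index)
qed

lemma sform_mult_mat_vec_left: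
  assumes "x \<in> carrier_vec (2 * n)" "A \<in> carrier_mat (2 * n) m" "z \<in> carrier_vec m"
  shows "sform n (A *\<^sub>v z) x = (\<Sum>j<m. sform n (col A j) x * z $ j)"
proof -
  have "sform n (A *\<^sub>v z) x = - (\<Sum>j<m. sform n x (col A j) * z $ j)"
    using assms sform_mult_mat_vec_right[OF assms] sform_commute[of "A *\<^sub>v z" n x]
    by (metis mult_mat_vec_carrier)
  also have "\<dots> = (\<Sum>j<m. sform n (col A j) x * z $ j)"
    unfolding sum_negf[symmetric]
  proof (intro sum.cong refl)
    fix j assume "j \<in> {..<m}"
    then have "col A j \<in> carrier_vec (2 * n)" using assms(2) by auto
    from sform_commute[OF this assms(1)]
    show "- (sform n x (col A j) * z $ j) = sform n (col A j) x * z $ j" by simp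
  qed
  finally show ?thesis .
qed

lemma sform_mult_mat_vec_both:
  assumes A: "A \<in> carrier_mat (2 * n) m" and "x \<in> carrier_vec m" "y \<in> carrier_vec m"
  shows "sform n (A *\<^sub>v x) (A *\<^sub>v y) = (\<Sum>j<m. (\<Sum>i<m. sform n (col A i) (col A j) * x $ i) * y $ j)"
proof -
  have "A *\<^sub>v x \<in> carrier_vec (2 * n)" using assms by (metis mult_mat_vec_carrier)
  from sform_mult_mat_vec_right[OF this A assms(3)] show ?thesis
    using sform_mult_mat_vec_left[OF _ A assms(2)] A by (auto intro!: sum.cong)
qed

lemma similitude_iff_col:
  "similitude n A c \<longleftrightarrow> A \<in> carrier_mat (2 * n) (2 * n) \<and>
     (\<forall>i<2 * n. \<forall>j<2 * n. sform n (col A i) (col A j) = c * (if i + j + 1 = 2 * n then (- 1) ^ j else 0))"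
    (is "?l \<longleftrightarrow> ?r")
proof
  assume l: ?l
  then have A: "A \<in> carrier_mat (2 * n) (2 * n)" by (simp add: similitude_def)
  have "sform n (col A i) (col A j) = c * (if i + j + 1 = 2 * n then (- 1) ^ j else 0)"
    if "i < 2 * n" "j < 2 * n" for i j
    using l that unfolding similitude_def mult_mat_unit_vec[OF A, symmetric, OF that(1)]
      mult_mat_unit_vec[OF A, symmetric, OF that(2)] sform_unit_vec[OF that, symmetric] by simp
  with A show ?r by simp
next
  assume r: ?r
  then have A: "A \<in> carrier_mat (2 * n) (2 * n)" by simp
  have "sform n (A *\<^sub>v x) (A *\<^sub>v y) = c * sform n x y"
    if xy: "x \<in> carrier_vec (2 * n)" "y \<in> carrier_vec (2 * n)" for x y
  proof -
    let ?G = "\<lambda>i j. if i + j + 1 = 2 * n then (- 1) ^ j else 0 :: 'a"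
    have "sform n x y = sform n (1\<^sub>m (2 * n) *\<^sub>v x) (1\<^sub>m (2 * n) *\<^sub>v y)" using xy by simp
    also have "\<dots> = (\<Sum>j<2 * n. (\<Sum>i<2 * n. ?G i j * x $ i) * y $ j)"
      unfolding sform_mult_mat_vec_both[OF one_carrier_mat xy]
      by (intro sum.cong refl arg_cong2[where f = "(*)"])
        (simp only: col_one sform_unit_vec lessThan_iff)
    finally have 1: "sform n x y = (\<Sum>j<2 * n. (\<Sum>i<2 * n. ?G i j * x $ i) * y $ j)" .
    have "sform n (A *\<^sub>v x) (A *\<^sub>v y) = (\<Sum>j<2 * n. (\<Sum>i<2 * n. c * ?G i j * x $ i) * y $ j)"
      unfolding sform_mult_mat_vec_both[OF A xy]
      by (intro sum.cong refl arg_cong2[where f = "(*)"]) (use r in \<open>simp only: lessThan_iff\<close>)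
    then show ?thesis unfolding 1 by (simp add: sum_distrib_left sum_distrib_right mult.assoc)
  qed
  with A show ?l by (simp add: similitude_def)
qed

lemma gram_index:
  assumes A: "A \<in> carrier_mat (2 * n) (2 * n)" and "i < 2 * n" "j < 2 * n"
  shows "(A\<^sup>T * Omega n * A) $$ (i, j) = sform n (col A i) (col A j)"
proof -
  have "A\<^sup>T * Omega n * A = A\<^sup>T * (Omega n * A)"
    using A by (intro assoc_mult_mat[of _ "2 * n" "2 * n" _ "2 * n" _ "2 * n"]) auto
  then have "(A\<^sup>T * Omega n * A) $$ (i, j) = col A i \<bullet> col (Omega n * A) j"
    using assms carrier_matD[OF Omega_carrier[of n, where ?'a='a]] by simp
  also have "col (Omega n * A) j = Omega n *\<^sub>v col A j"
    using assms by (intro col_mult2[of _ "2 * n" "2 * n" _ "2 * n"]) auto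
  finally show ?thesis by (simp add: sform_def)
qed

text \<open>Replaces the matrix equation by a statement about vectors, so that products and inverses
  can be treated without transposes.\<close>

lemma GSp_iff: "A \<in> GSp n \<longleftrightarrow> (\<exists>c. c \<noteq> 0 \<and> similitude n A c)"
proof -
  have "A\<^sup>T * Omega n * A = c \<cdot>\<^sub>m Omega n \<longleftrightarrow>
      (\<forall>i<2 * n. \<forall>j<2 * n. sform n (col A i) (col A j) = c * (if i + j + 1 = 2 * n then (- 1) ^ j else 0))"
    if A: "A \<in> carrier_mat (2 * n) (2 * n)" for c
  proof
    assume eq: "A\<^sup>T * Omega n * A = c \<cdot>\<^sub>m Omega n"
    show "\<forall>i<2 * n. \<forall>j<2 * n. sform n (col A i) (col A j) = c * (if i + j + 1 = 2 * n then (- 1) ^ j else 0)"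
    proof (intro allI impI)
      fix i j assume ij: "i < 2 * n" "j < 2 * n"
      have "sform n (col A i) (col A j) = (c \<cdot>\<^sub>m Omega n) $$ (i, j)" using gram_index[OF A ij] eq by simp
      then show "sform n (col A i) (col A j) = c * (if i + j + 1 = 2 * n then (- 1) ^ j else 0)"
        using ij carrier_matD[OF Omega_carrier[of n, where ?'a='a]] Omega_index[OF ij, where ?'a='a] by simp
    qed
  next
    assume r: "\<forall>i<2 * n. \<forall>j<2 * n. sform n (col A i) (col A j) = c * (if i + j + 1 = 2 * n then (- 1) ^ j else 0)"
    show "A\<^sup>T * Omega n * A = c \<cdot>\<^sub>m Omega n"
    proof (rule eq_matI)
      fix i j assume "i < dim_row (c \<cdot>\<^sub>m Omega n)" "j < dim_col (c \<cdot>\<^sub>m Omega n)"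
      then have ij: "i < 2 * n" "j < 2 * n" using carrier_matD[OF Omega_carrier[of n, where ?'a='a]] by auto
      then show "(A\<^sup>T * Omega n * A) $$ (i, j) = (c \<cdot>\<^sub>m Omega n) $$ (i, j)"
        using r gram_index[OF A ij] carrier_matD[OF Omega_carrier[of n, where ?'a='a]]
          Omega_index[OF ij, where ?'a='a] by simp
    qed (use A carrier_matD[OF Omega_carrier[of n, where ?'a='a]] in auto)
  qed
  then show ?thesis unfolding GSp_def similitude_iff_col mem_Collect_eq by metis
qed

lemma similitude_carrier: "similitude n A c \<Longrightarrow> A \<in> carrier_mat (2 * n) (2 * n)"
  by (simp add: similitude_def)

lemma similitude_form:
  "similitude n A c \<Longrightarrow> x \<in> carrier_vec (2 * n) \<Longrightarrow> y \<in> carrier_vec (2 * n) \<Longrightarrow>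
    sform n (A *\<^sub>v x) (A *\<^sub>v y) = c * sform n x y"
  by (simp add: similitude_def)

lemma similitude_mult:
  assumes "similitude n A c" "similitude n B d"
  shows "similitude n (A * B) (c * d)"
proof -
  have A: "A \<in> carrier_mat (2 * n) (2 * n)" and B: "B \<in> carrier_mat (2 * n) (2 * n)"
    using assms by (auto simp: similitude_def)
  have "sform n (A * B *\<^sub>v x) (A * B *\<^sub>v y) = c * d * sform n x y"
    if "x \<in> carrier_vec (2 * n)" "y \<in> carrier_vec (2 * n)" for x y
  proof -
    have "B *\<^sub>v x \<in> carrier_vec (2 * n)" "B *\<^sub>v y \<in> carrier_vec (2 * n)"
      using B that by (metis mult_mat_vec_carrier)+
    then show ?thesis using assms that A B
      by (simp add: assoc_mult_mat_vec[of _ "2 * n" "2 * n" _ "2 * n"] similitude_form)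
  qed
  then show ?thesis using A B by (auto simp: similitude_def)
qed

lemma similitude_one: "similitude n (1\<^sub>m (2 * n)) 1"
  by (simp add: similitude_def)

lemma similitude_unique:
  assumes "similitude n A c" "similitude n A d" "1 \<le> n"
  shows "c = d"
proof -
  have "sform n (col A 0) (col A (2 * n - 1)) = c * (- 1) ^ (2 * n - 1)"
    "sform n (col A 0) (col A (2 * n - 1)) = d * (- 1) ^ (2 * n - 1)"
  proof -
    have "0 < 2 * n" "2 * n - 1 < 2 * n" "0 + (2 * n - 1) + 1 = 2 * n" using assms(3) by auto
    then show "sform n (col A 0) (col A (2 * n - 1)) = c * (- 1) ^ (2 * n - 1)"
      "sform n (col A 0) (col A (2 * n - 1)) = d * (- 1) ^ (2 * n - 1)"
      using assms(1,2) unfolding similitude_iff_col by presburger+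
  qed
  then show ?thesis by (simp del: minus_one_power_iff)
qed

text \<open>The adjoint for the form divided by the similitude factor, that is, the transpose of A
  conjugated by \<open>Omega\<close>. The explicit inverse allows the valuations of its entries to
  be read off.\<close>

definition symp_inv :: "nat \<Rightarrow> 'a::field \<Rightarrow> 'a mat \<Rightarrow> 'a mat" where
  "symp_inv n c A = mat (2 * n) (2 * n) (\<lambda>(i, j). (- 1) ^ (i + j) * A $$ (2 * n - 1 - j, 2 * n - 1 - i) / c)"

lemma symp_inv_carrier [simp]: "symp_inv n c A \<in> carrier_mat (2 * n) (2 * n)"
  by (simp add: symp_inv_def)

text \<open>Coordinates with respect to the columns of a similitude are pairings with the dual
  columns; questions of integrality of coordinates become questions about the form.\<close>

lemma symp_inv_mult_vec:
  assumes A: "A \<in> carrier_mat (2 * n) (2 * n)" and x: "x \<in> carrier_vec (2 * n)" and i: "i < 2 * n"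
  shows "(symp_inv n c A *\<^sub>v x) $ i = (- 1) ^ i * sform n (col A (2 * n - 1 - i)) x / c"
proof -
  let ?f = "\<lambda>j. (- 1) ^ (i + j) * A $$ (2 * n - 1 - j, 2 * n - 1 - i) / c * x $ j"
  have "(symp_inv n c A *\<^sub>v x) $ i = (\<Sum>j<2 * n. ?f j)"
    unfolding mult_mat_vec_index[OF symp_inv_carrier x i] using i by (intro sum.cong) (auto simp: symp_inv_def)
  also have "\<dots> = (\<Sum>j<2 * n. ?f (2 * n - 1 - j))"
    by (rule sum.reindex_bij_witness[of _ "\<lambda>i. 2 * n - 1 - i" "\<lambda>i. 2 * n - 1 - i"]) auto
  also have "\<dots> = (\<Sum>j<2 * n. (- 1) ^ i / c * ((- 1) ^ (j + 1) * col A (2 * n - 1 - i) $ j * x $ (2 * n - 1 - j)))"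
  proof (intro sum.cong refl)
    fix j assume "j \<in> {..<2 * n}"
    then have j: "j < 2 * n" "2 * n - 1 - (2 * n - 1 - j) = j" by auto
    have "(- 1 :: 'a) ^ (i + (2 * n - 1 - j)) = (- 1) ^ i * (- 1) ^ (j + 1)"
      using j(1) by (auto simp: minus_one_power_iff)
    then show "?f (2 * n - 1 - j) =
      (- 1) ^ i / c * ((- 1) ^ (j + 1) * col A (2 * n - 1 - i) $ j * x $ (2 * n - 1 - j))"
      using A i j by simp
  qed
  also have "\<dots> = (- 1) ^ i * sform n (col A (2 * n - 1 - i)) x / c"
  proof -
    have "col A (2 * n - 1 - i) \<in> carrier_vec (2 * n)"
      by (rule col_carrier_vec[OF _ A]) (use i in simp)
    then show ?thesis
      unfolding sform_sum[OF _ x, of "col A (2 * n - 1 - i)"]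
      by (simp only: sform_sum[OF _ x] sum_distrib_left sum_divide_distrib times_divide_eq_left)
  qed
  finally show ?thesis .
qed

lemma symp_inv:
  assumes s: "similitude n A c" "c \<noteq> 0"
  shows "symp_inv n c A * A = 1\<^sub>m (2 * n)" "A * symp_inv n c A = 1\<^sub>m (2 * n)"
proof -
  have A: "A \<in> carrier_mat (2 * n) (2 * n)" by (rule similitude_carrier[OF s(1)])
  show 1: "symp_inv n c A * A = 1\<^sub>m (2 * n)"
  proof (rule eq_matI)
    fix i j assume "i < dim_row (1\<^sub>m (2 * n) :: 'a mat)" "j < dim_col (1\<^sub>m (2 * n) :: 'a mat)"
    then have ij: "i < 2 * n" "j < 2 * n" by auto
    have "(symp_inv n c A * A) $$ (i, j) = (symp_inv n c A *\<^sub>v col A j) $ i"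
      using ij A carrier_matD[OF symp_inv_carrier[of n c A]] by simp
    also have "\<dots> = (- 1) ^ i * sform n (col A (2 * n - 1 - i)) (col A j) / c"
      using A ij by (intro symp_inv_mult_vec) auto
    also have "sform n (col A (2 * n - 1 - i)) (col A j) = c * (if i = j then (- 1) ^ j else 0)"
      using s(1) ij unfolding similitude_iff_col by auto
    finally show "(symp_inv n c A * A) $$ (i, j) = 1\<^sub>m (2 * n) $$ (i, j)"
      using ij s(2) by (auto simp: power_add[symmetric])
  qed (use A carrier_matD[OF symp_inv_carrier[of n c A]] in auto)
  show "A * symp_inv n c A = 1\<^sub>m (2 * n)"
    by (rule mat_mult_left_right_inverse[OF symp_inv_carrier A 1])
qed

lemma similitude_symp_inv:
  assumes s: "similitude n A c" "c \<noteq> 0"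
  shows "similitude n (symp_inv n c A) (1 / c)"
proof -
  have A: "A \<in> carrier_mat (2 * n) (2 * n)" by (rule similitude_carrier[OF s(1)])
  have AA: "A *\<^sub>v (symp_inv n c A *\<^sub>v x) = x" if "x \<in> carrier_vec (2 * n)" for x
    using that A symp_inv(2)[OF s] by (simp add: assoc_mult_mat_vec[symmetric, of _ "2 * n" "2 * n" _ "2 * n"])
  have C: "symp_inv n c A *\<^sub>v x \<in> carrier_vec (2 * n)" if "x \<in> carrier_vec (2 * n)" for x
    using that by (metis mult_mat_vec_carrier symp_inv_carrier)
  have "sform n (symp_inv n c A *\<^sub>v x) (symp_inv n c A *\<^sub>v y) = 1 / c * sform n x y"
    if "x \<in> carrier_vec (2 * n)" "y \<in> carrier_vec (2 * n)" for x y
    using similitude_form[OF s(1) C[OF that(1)] C[OF that(2)]] that s(2) by (simp add: AA)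
  then show ?thesis by (simp add: similitude_def)
qed

context coxeter
begin

text \<open>
  Starting the recursion at a multiple of \<open>v\<close>, one index before \<open>G_vec\<close>, makes the Gram matrix
  entries uniform.
\<close>

primrec GG :: "'l vec \<Rightarrow> nat \<Rightarrow> 'l vec" where
  "GG v 0 = (- 1) ^ (n + 1) \<cdot>\<^sub>v v"
| "GG v (Suc i) = G_step D n k v (GG v i)"

declare GG.simps(2) [simp del]

abbreviation cc :: "'l vec \<Rightarrow> nat \<Rightarrow> 'l" where "cc v i \<equiv> \<langle>V (GG v i), (F ^^ n) v\<rangle> / \<alpha> v"
abbreviation uu :: "'l vec \<Rightarrow> 'l" where "uu v \<equiv> \<alpha> v / sgi (\<alpha> v)"

lemma G_step_eq: "G_step D n k v x = uu v \<cdot>\<^sub>v (V x - (\<langle>V x, (F ^^ n) v\<rangle> / \<alpha> v) \<cdot>\<^sub>v v)"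
  by (simp add: G_step_def)

lemma GG_carrier [simp]: "v \<in> CV \<Longrightarrow> GG v i \<in> CV"
  by (induction i) (auto simp: GG.simps(2) G_step_eq)

lemma G_step_smult:
  assumes "v \<in> CV" "x \<in> CV"
  shows "G_step D n k v (c \<cdot>\<^sub>v x) = sgi c \<cdot>\<^sub>v G_step D n k v x"
proof -
  have "V (c \<cdot>\<^sub>v x) = sgi c \<cdot>\<^sub>v V x"
    "\<langle>sgi c \<cdot>\<^sub>v V x, (F ^^ n) v\<rangle> = sgi c * \<langle>V x, (F ^^ n) v\<rangle>"
    using assms by (simp_all add: V_smult sform_smult_left)
  moreover have "dim_vec v = 2 * n" "dim_vec (V x) = 2 * n" using assms by auto
  ultimately show ?thesis
    by (intro eq_vecI) (simp_all add: G_step_eq right_diff_distrib mult.left_commute)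
qed

lemma G_vec_eq: "v \<in> CV \<Longrightarrow> G_vec D n k v i = GG v (Suc i)"
proof (induction i)
  case 0
  then show ?case using G_step_smult[of v v "(- 1) ^ (n + 1)"] sgi_sign[of "n + 1"]
    by (simp only: GG.simps G_vec.simps)
qed (simp add: GG.simps(2))

section \<open>The columns of \<open>g_mat\<close> as scaled basis vectors\<close>

definition basis_vec :: "'l vec \<Rightarrow> nat \<Rightarrow> 'l vec" where
  "basis_vec v j = (if j < n then (F ^^ j) v else if j < 2 * n - 1 then GG v (j - n + 1) else (F ^^ n) v)"

text \<open>The multiple of r to which pi is raised in column j, so that \<open>g_mat r v\<close> is
  \<open>g_mat 0 v\<close> times a diagonal matrix. The second branch covers the last column as
  well, where it gives n.\<close>

definition expo :: "nat \<Rightarrow> nat" where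
  "expo j = (if j < n then j else j - n + 1)"

lemma basis_vec_last: "basis_vec v (2 * n - 1) = (F ^^ n) v"
  using n_ge_1 by (auto simp: basis_vec_def)

lemma basis_vec_carrier [simp]: "v \<in> CV \<Longrightarrow> basis_vec v j \<in> CV"
  by (simp add: basis_vec_def)

lemma g_mat_carrier [simp]: "gm r v \<in> carrier_mat (2 * n) (2 * n)"
  using n_ge_1 unfolding g_mat_def by (intro carrier_matI) auto

lemma g_mat_index:
  assumes "v \<in> CV" "i < 2 * n" "j < 2 * n"
  shows "gm r v $$ (i, j) = pi ^ (r * expo j) * basis_vec v j $ i"
proof -
  let ?l1 = "map (\<lambda>i. pi ^ (i * r) \<cdot>\<^sub>v (F ^^ i) v) [0..<n]"
  let ?l2 = "map (\<lambda>i. pi ^ (i * r) \<cdot>\<^sub>v G_vec D n k v (i - 1)) [1..<n]"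
  let ?l = "?l1 @ ?l2 @ [pi ^ (n * r) \<cdot>\<^sub>v (F ^^ n) v]"
  have "gm r v $$ (i, j) = ?l ! j $ i"
    unfolding g_mat_def using assms n_ge_1 by (subst mat_of_cols_index) auto
  also have "?l ! j = pi ^ (r * expo j) \<cdot>\<^sub>v basis_vec v j"
  proof -
    consider "j < n" | "n \<le> j" "j < 2 * n - 1" | "j = 2 * n - 1" using assms by linarith
    then show ?thesis
    proof cases
      case 1
      then show ?thesis by (simp add: nth_append expo_def basis_vec_def mult.commute)
    next
      case 2
      then have "j - n < length ?l2" by auto
      then have "?l ! j = ?l2 ! (j - n)" using 2 by (simp only: nth_append length_map) simp
      also have "\<dots> = pi ^ ((1 + (j - n)) * r) \<cdot>\<^sub>v G_vec D n k v (j - n)"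
        using 2 by (subst nth_map) auto
      finally show ?thesis using 2 assms by (simp add: G_vec_eq expo_def basis_vec_def mult.commute)
    next
      case 3
      then have "\<not> j < n" using n_ge_1 by linarith
      with 3 have "?l ! j = pi ^ (n * r) \<cdot>\<^sub>v (F ^^ n) v" using n_ge_1 by (simp add: nth_append)
      moreover have "expo j = n" "basis_vec v j = (F ^^ n) v"
        using 3 n_ge_1 by (auto simp: expo_def basis_vec_def)
      ultimately show ?thesis by (simp add: mult.commute)
    qed
  qed
  also have "(pi ^ (r * expo j) \<cdot>\<^sub>v basis_vec v j) $ i = pi ^ (r * expo j) * basis_vec v j $ i"
    using assms basis_vec_carrier[of v j] by (metis carrier_vecD index_smult_vec(1))
  finally show ?thesis .
qed

lemma g_mat_col:
  assumes "v \<in> CV" "j < 2 * n"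
  shows "col (gm r v) j = pi ^ (r * expo j) \<cdot>\<^sub>v basis_vec v j"
proof (rule eq_vecI)
  have d: "dim_vec (basis_vec v j) = 2 * n" "dim_row (gm r v) = 2 * n" "dim_col (gm r v) = 2 * n"
    using carrier_vecD[OF basis_vec_carrier[OF assms(1)]] carrier_matD[OF g_mat_carrier] by auto
  show "dim_vec (col (gm r v) j) = dim_vec (pi ^ (r * expo j) \<cdot>\<^sub>v basis_vec v j)" by (simp add: d)
  fix i assume "i < dim_vec (pi ^ (r * expo j) \<cdot>\<^sub>v basis_vec v j)"
  then show "col (gm r v) j $ i = (pi ^ (r * expo j) \<cdot>\<^sub>v basis_vec v j) $ i"
    using assms g_mat_index[OF assms(1) _ assms(2)] by (simp add: d)
qed

lemma ord_uu: "v \<in> VS \<Longrightarrow> ordL D (uu v) = 0"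
  using V_sympD(3) by (simp add: ord_divide)

lemma uu_integral: "v \<in> VS \<Longrightarrow> uu v \<in> P 0"
  using ord_uu[of v] by (simp only: ppow_def mem_Collect_eq order_refl simp_thms)

lemma GG_Suc_form_left:
  assumes "v \<in> CV" "y \<in> CV"
  shows "\<langle>GG v (Suc i), y\<rangle> = uu v * (- sgi \<langle>GG v i, F y\<rangle> - cc v i * \<langle>v, y\<rangle>)"
  using assms by (simp add: GG.simps(2) G_step_eq sform_bilinear V_form_left)

lemma GG_Suc_form_Fn:
  assumes "v \<in> VS"
  shows "\<langle>GG v (Suc i), (F ^^ n) v\<rangle> = 0"
  using V_sympD[OF assms] by (simp add: GG.simps(2) G_step_eq sform_bilinear)

text \<open>Adjunction trades one step of the recursion for one more \<open>F\<close> on the other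
  side, so up to sign only i + j matters while j < n. The factor \<open>uu v\<close> undoes the
  inverse Frobenius on \<alpha>, and the subtracted multiple of v forces orthogonality to F^n
  v.\<close>

lemma GG_form_F:
  assumes v: "v \<in> VS"
  shows "i < n \<Longrightarrow> j \<le> n \<Longrightarrow> \<langle>GG v i, (F ^^ j) v\<rangle> = (if i + j = n then (- 1) ^ (n + 1 + i) * \<alpha> v else 0)"
proof (induction i arbitrary: j)
  case 0
  then show ?case
    using V_sympD[OF v] F_form_less_n(1)[OF v, of 0 j] by (cases "j = n") (auto simp: sform_smult_left)
next
  case (Suc i)
  note vC = V_sympD(1)[OF v]
  show ?case
  proof (cases "j = n")
    case True
    then show ?thesis using GG_Suc_form_Fn[OF v] by simp
  next
    case False
    then have j: "j < n" using Suc.prems by simp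
    have "\<langle>v, (F ^^ j) v\<rangle> = 0" using F_form_less_n(1)[OF v, of 0 j] j by simp
    moreover have "\<langle>GG v i, F ((F ^^ j) v)\<rangle> = (if i + Suc j = n then (- 1) ^ (n + 1 + i) * \<alpha> v else 0)"
      using Suc.IH[of "Suc j"] Suc.prems j by simp
    ultimately have "\<langle>GG v (Suc i), (F ^^ j) v\<rangle> =
        uu v * (- sgi (if i + Suc j = n then (- 1) ^ (n + 1 + i) * \<alpha> v else 0))"
      using vC by (simp add: GG_Suc_form_left)
    also have "\<dots> = (if Suc i + j = n then (- 1) ^ (n + 1 + Suc i) * \<alpha> v else 0)"
      using V_sympD(3)[OF v] by (auto simp: sgi_mult)
    finally show ?thesis .
  qed
qed

text \<open>Unfold both arguments by one step. The term with two \<open>V\<close> reduces to smaller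
  indices by \<open>V_form\<close>. In the mixed terms the pairing of V (GG v l) with v is, up to
  sign and twist, that of GG v l with F v, which vanishes since l + 1 < n.\<close>

lemma GG_form_GG:
  assumes v: "v \<in> VS"
  shows "i < n \<Longrightarrow> j < n \<Longrightarrow> \<langle>GG v i, GG v j\<rangle> = 0"
proof (induction i arbitrary: j)
  case 0
  note vC = V_sympD(1)[OF v]
  have "\<langle>v, GG v j\<rangle> = 0"
    using sform_commute[of v n "GG v j"] GG_form_F[OF v 0(2), of 0] 0 vC by simp
  then show ?case using vC by (simp add: sform_smult_left)
next
  case (Suc i)
  note vC = V_sympD(1)[OF v]
  have swap: "\<langle>v, V x\<rangle> = - \<langle>V x, v\<rangle>" if "x \<in> CV" for x
    using sform_commute[of v n "V x"] vC that by simp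
  have Vv: "\<langle>V (GG v l), v\<rangle> = 0" if "Suc l < n" for l
    using GG_form_F[OF v, of l 1] that vC n_ge_1 by (simp add: V_form_left)
  show ?case
  proof (cases j)
    case 0
    have "\<langle>GG v (Suc i), v\<rangle> = 0" using GG_form_F[OF v Suc.prems(1), of 0] Suc.prems by simp
    then show ?thesis using 0 vC by (simp add: sform_smult_right)
  next
    case (Suc j')
    have alg: "a * (a * (p - c1 * q) - c2 * (a * (r - c1 * s))) = a * (a * (p - c2 * r - c1 * (q - c2 * s)))"
      for a p q r s c1 c2 :: 'l by (simp add: algebra_simps)
    have "\<langle>GG v (Suc i), GG v (Suc j')\<rangle> = uu v * (uu v * (\<langle>V (GG v i), V (GG v j')\<rangle>
        - cc v j' * \<langle>V (GG v i), v\<rangle> - (cc v i * (\<langle>v, V (GG v j')\<rangle> - cc v j' * \<langle>v, v\<rangle>))))"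
      using vC by (simp only: GG.simps(2) G_step_eq sform_bilinear smult_carrier_vec
          minus_carrier_vec V_carrier GG_carrier F_funpow_carrier alg)
    also have "\<dots> = 0"
      using Suc.IH[of j'] Suc.prems Suc Vv[of i] Vv[of j'] swap[of "GG v j'"] vC
      by (simp add: V_form sform_self)
    finally show ?thesis using Suc by simp
  qed
qed

text \<open>The exponent j is left free because adjunction raises it by one; the case j = n + 1 of
  the induction hypothesis also makes the coefficient \<open>cc v i\<close> integral.\<close>

lemma GG_form_integral:
  assumes v: "v \<in> VS"
  shows "\<langle>GG v i, (F ^^ j) v\<rangle> \<in> P (ordL D (\<alpha> v))"
proof (induction i arbitrary: j)
  case 0
  then show ?case using form_iterate_integral[OF v] V_sympD(1)[OF v] by (simp add: sform_smult_left)
next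
  case (Suc i)
  note vC = V_sympD(1)[OF v]
  have "cc v i \<in> P 0"
  proof (rule ppow_divide)
    show "\<langle>V (GG v i), (F ^^ n) v\<rangle> \<in> P (0 + ordL D (\<alpha> v))"
      using Suc[of "Suc n"] vC by (simp add: V_form_left)
  qed (use V_sympD[OF v] in simp)
  then have "- sgi \<langle>GG v i, F ((F ^^ j) v)\<rangle> - cc v i * \<langle>v, (F ^^ j) v\<rangle> \<in> P (ordL D (\<alpha> v))"
    using Suc[of "Suc j"] form_iterate_integral[OF v, of j]
    by (intro ppow_diff ppow_mult_left) auto
  then have "uu v * (- sgi \<langle>GG v i, F ((F ^^ j) v)\<rangle> - cc v i * \<langle>v, (F ^^ j) v\<rangle>) \<in> P (ordL D (\<alpha> v))"
    by (rule ppow_mult_left[OF uu_integral[OF v]])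
  then show ?case using vC by (simp only: GG_Suc_form_left F_funpow_carrier)
qed

lemma cc_integral:
  assumes v: "v \<in> VS"
  shows "cc v i \<in> P 0"
proof (rule ppow_divide)
  show "\<langle>V (GG v i), (F ^^ n) v\<rangle> \<in> P (0 + ordL D (\<alpha> v))"
    using GG_form_integral[OF v, of i "Suc n"] V_sympD(1)[OF v] by (simp add: V_form_left)
qed (use V_sympD[OF v] in simp)

text \<open>The dual partner of v is F^n v, and for 0 < j < n that of F^j v is
  \<open>GG v (n - j)\<close>. Only pairs with j < i are computed; skew-symmetry gives the others,
  with the right sign because partners have opposite parity.\<close>

lemma basis_vec_gram:
  assumes v: "v \<in> VS" and ij: "i < 2 * n" "j < 2 * n"
  shows "\<langle>basis_vec v i, basis_vec v j\<rangle> = - \<alpha> v * (if i + j + 1 = 2 * n then (- 1) ^ j else 0)"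
proof -
  note vC = V_sympD(1)[OF v]
  have sorted: "\<langle>basis_vec v i, basis_vec v j\<rangle> = - \<alpha> v * (if i + j + 1 = 2 * n then (- 1) ^ j else 0)"
    if ij: "j < i" "i < 2 * n" for i j
  proof -
    consider "i < n" | "n \<le> i" "i < 2 * n - 1" "j < n" | "n \<le> i" "i < 2 * n - 1" "n \<le> j"
      | "i = 2 * n - 1" "j < n" | "i = 2 * n - 1" "n \<le> j" using ij by linarith
    then show ?thesis
    proof cases
      case 1
      then show ?thesis using ij F_form_less_n(2)[OF v, of j i] by (simp add: basis_vec_def)
    next
      case 2
      then have eq: "i - n + 1 + j = n \<longleftrightarrow> i + j + 1 = 2 * n" by auto
      have "i + j + 1 = 2 * n \<Longrightarrow> (- 1 :: 'l) ^ (n + 1 + (i - n + 1)) = - ((- 1) ^ j)"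
        using 2 by (auto simp: minus_one_power_iff) presburger+
      moreover have "\<langle>basis_vec v i, basis_vec v j\<rangle> = \<langle>GG v (i - n + 1), (F ^^ j) v\<rangle>"
        using 2 by (simp add: basis_vec_def)
      moreover have "i - n + 1 < n" using 2 by auto
      ultimately show ?thesis using 2 GG_form_F[OF v, of "i - n + 1" j] eq by auto
    next
      case 3
      then show ?thesis using ij GG_form_GG[OF v, of "i - n + 1" "j - n + 1"] by (simp add: basis_vec_def)
    next
      case 4
      then have b: "basis_vec v i = (F ^^ n) v" "basis_vec v j = (F ^^ j) v"
        using n_ge_1 by (auto simp: basis_vec_def)
      show ?thesis
      proof (cases "j = 0")
        case True
        then show ?thesis using b 4 V_sympD[OF v] sform_commute[of "(F ^^ n) v" n v] by simp
      next
        case False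
        then show ?thesis unfolding b using 4 F_form_less_n(2)[OF v, of j n] by simp
      qed
    next
      case 5
      then have b: "basis_vec v i = (F ^^ n) v" "basis_vec v j = GG v (Suc (j - n))"
        using ij n_ge_1 by (auto simp: basis_vec_def)
      show ?thesis unfolding b using GG_Suc_form_Fn[OF v, of "j - n"] 5 ij vC
          sform_commute[of "(F ^^ n) v" n "GG v (Suc (j - n))"]
        by (simp)
    qed
  qed
  consider "j < i" | "i = j" | "i < j" by linarith
  then show ?thesis
  proof cases
    case 1
    then show ?thesis using sorted ij by simp
  next
    case 2
    then have "i + j + 1 \<noteq> 2 * n" by presburger
    then show ?thesis using 2 vC by (simp add: sform_self)
  next
    case 3
    have "i + j + 1 = 2 * n \<Longrightarrow> (- 1 :: 'l) ^ i = - ((- 1) ^ j)"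
      by (auto simp: minus_one_power_iff) presburger+
    then show ?thesis using sorted[OF 3] ij vC sform_commute[of "basis_vec v i" n "basis_vec v j"]
      by (auto simp: add.commute)
  qed
qed

lemma expo_sum: "i < 2 * n \<Longrightarrow> j < 2 * n \<Longrightarrow> i + j + 1 = 2 * n \<Longrightarrow> expo i + expo j = n"
  by (auto simp: expo_def)

lemma g_mat_similitude:
  assumes v: "v \<in> VS"
  shows "similitude n (gm r v) (- \<alpha> v * pi ^ (r * n))"
proof -
  note vC = V_sympD(1)[OF v]
  have "\<langle>col (gm r v) i, col (gm r v) j\<rangle> =
    - \<alpha> v * pi ^ (r * n) * (if i + j + 1 = 2 * n then (- 1) ^ j else 0)"
    if ij: "i < 2 * n" "j < 2 * n" for i j
  proof -
    have "\<langle>col (gm r v) i, col (gm r v) j\<rangle> =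
      pi ^ (r * expo i) * pi ^ (r * expo j) * \<langle>basis_vec v i, basis_vec v j\<rangle>"
      using vC ij by (simp add: g_mat_col sform_bilinear mult.assoc)
    also have "pi ^ (r * expo i) * pi ^ (r * expo j) = pi ^ (r * (expo i + expo j))"
      by (simp add: power_add distrib_left)
    finally show ?thesis using expo_sum[OF ij] basis_vec_gram[OF v ij] by auto
  qed
  then show ?thesis unfolding similitude_iff_col by simp
qed

lemma g_mat_similitude_nonzero: "v \<in> VS \<Longrightarrow> - \<alpha> v * pi ^ (r * n) \<noteq> 0"
  using V_sympD(3)[of v] by simp

lemma g_mat_GSp: "v \<in> VS \<Longrightarrow> gm r v \<in> GSp n"
  unfolding GSp_iff using g_mat_similitude g_mat_similitude_nonzero by blast

lemma F_GG_Suc: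
  assumes "v \<in> CV"
  shows "F (GG v (Suc i)) = sg (uu v) \<cdot>\<^sub>v (pi ^ k \<cdot>\<^sub>v GG v i - sg (cc v i) \<cdot>\<^sub>v F v)"
  using assms by (simp add: GG.simps(2) G_step_eq F_smult F_diff F_V)

text \<open>\<open>F\<close> maps iterates to iterates and \<open>GG v (Suc i)\<close> to an
  integral combination of \<open>GG v i\<close> and F v, so everything reduces to pairings already
  bounded. Since the Gram matrix is antidiagonal with entries \<alpha> up to sign, the bound makes
  the matrix of \<open>F\<close> in this basis integral.\<close>

lemma F_basis_vec_integral:
  assumes v: "v \<in> VS" and ij: "i < 2 * n" "j < 2 * n"
  shows "\<langle>basis_vec v i, F (basis_vec v j)\<rangle> \<in> P (ordL D (\<alpha> v))"
proof -
  note vC = V_sympD(1)[OF v]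
  have FF: "\<langle>(F ^^ a) v, (F ^^ b) v\<rangle> \<in> P (ordL D (\<alpha> v))" if "a \<le> b" for a b
  proof -
    have "(F ^^ (a + (b - a))) v = (F ^^ a) ((F ^^ (b - a)) v)" by (simp only: funpow_add o_apply)
    then have "(F ^^ b) v = (F ^^ a) ((F ^^ (b - a)) v)" using that by simp
    then have "\<langle>(F ^^ a) v, (F ^^ b) v\<rangle> = (- (pi ^ k)) ^ a * (sg ^^ a) \<langle>v, (F ^^ (b - a)) v\<rangle>"
      using F_funpow_form[OF vC F_funpow_carrier[OF vC]] by simp
    also have "(- (pi ^ k)) ^ a = (- 1) ^ a * pi ^ (k * a)"
      by (subst power_minus) (simp only: power_mult)
    finally have "\<langle>(F ^^ a) v, (F ^^ b) v\<rangle> = (- 1) ^ a * (pi ^ (k * a) * (sg ^^ a) \<langle>v, (F ^^ (b - a)) v\<rangle>)"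
      by (simp only: mult.assoc)
    moreover have "(sg ^^ a) \<langle>v, (F ^^ (b - a)) v\<rangle> \<in> P (ordL D (\<alpha> v))"
      using form_iterate_integral[OF v, of "b - a"] by (simp add: ppow_def)
    ultimately show ?thesis using pi_power_mult_integral by (simp only: ppow_sign_iff)
  qed
  have FF: "\<langle>(F ^^ a) v, (F ^^ b) v\<rangle> \<in> P (ordL D (\<alpha> v))" for a b
    using FF[of a b] FF[of b a] sform_commute[of "(F ^^ a) v" n "(F ^^ b) v"] vC by (cases "a \<le> b") auto
  have bF: "\<langle>basis_vec v i, (F ^^ b) v\<rangle> \<in> P (ordL D (\<alpha> v))" for b
    unfolding basis_vec_def using FF GG_form_integral[OF v] by simp
  have bG: "\<langle>basis_vec v i, GG v a\<rangle> \<in> P (ordL D (\<alpha> v))" if "a < n" for a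
  proof -
    have "\<langle>(F ^^ b) v, GG v a\<rangle> \<in> P (ordL D (\<alpha> v))" for b
      using GG_form_integral[OF v, of a b] sform_commute[of "(F ^^ b) v" n "GG v a"] vC by simp
    moreover have "n \<le> i \<Longrightarrow> i < 2 * n - 1 \<Longrightarrow> \<langle>GG v (i - n + 1), GG v a\<rangle> = 0"
      using that by (intro GG_form_GG[OF v]) auto
    ultimately show ?thesis unfolding basis_vec_def by auto
  qed
  consider "j < n" | "j = 2 * n - 1" | "n \<le> j" "j < 2 * n - 1" using ij by linarith
  then show ?thesis
  proof cases
    case 1
    then show ?thesis using bF[of "Suc j"] by (simp add: basis_vec_def)
  next
    case 2
    then show ?thesis using bF[of "Suc n"] unfolding 2 basis_vec_last by simp
  next
    case 3
    have "\<langle>basis_vec v i, F (GG v (Suc (j - n)))\<rangle> =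
      sg (uu v) * (pi ^ k * \<langle>basis_vec v i, GG v (j - n)\<rangle> - sg (cc v (j - n)) * \<langle>basis_vec v i, F v\<rangle>)"
      unfolding F_GG_Suc[OF vC] using vC by (simp add: sform_bilinear)
    moreover have "\<dots> \<in> P (ordL D (\<alpha> v))"
      using uu_integral[OF v] cc_integral[OF v] bG[of "j - n"] bF[of 1] 3
      by (intro ppow_mult_left ppow_diff pi_power_mult_integral) auto
    moreover have "basis_vec v j = GG v (Suc (j - n))" using 3 by (simp add: basis_vec_def)
    ultimately show ?thesis by simp
  qed
qed

lemma V_basis_vec_integral:
  assumes v: "v \<in> VS" and ij: "i < 2 * n" "j < 2 * n"
  shows "\<langle>basis_vec v i, V (basis_vec v j)\<rangle> \<in> P (ordL D (\<alpha> v))"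
  using F_basis_vec_integral[OF v ij(2,1)] sform_commute[of "basis_vec v i" n "V (basis_vec v j)"]
    V_sympD(1)[OF v] by (simp add: V_form_left)

end

section \<open>The lattice spanned by the Coxeter basis\<close>

lemma sform_linear_combination_right:
  fixes w y :: "'a::field vec" and h :: "nat \<Rightarrow> 'a vec"
  assumes y: "y \<in> carrier_vec (2 * n)" and w: "w \<in> carrier_vec (2 * n)"
    and h: "\<And>c. c < m \<Longrightarrow> h c \<in> carrier_vec (2 * n)"
    and eq: "\<And>i. i < 2 * n \<Longrightarrow> w $ i = (\<Sum>c<m. h c $ i * s c)"
  shows "sform n y w = (\<Sum>c<m. sform n y (h c) * s c)"
proof -
  have "sform n y w = (\<Sum>i<2 * n. \<Sum>c<m. (- 1) ^ (i + 1) * y $ i * h c $ (2 * n - 1 - i) * s c)"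
    unfolding sform_sum[OF y w]
  proof (intro sum.cong refl)
    fix i assume "i \<in> {..<2 * n}"
    then have "2 * n - 1 - i < 2 * n" by auto
    from eq[OF this] show "(- 1) ^ (i + 1) * y $ i * w $ (2 * n - 1 - i) =
      (\<Sum>c<m. (- 1) ^ (i + 1) * y $ i * h c $ (2 * n - 1 - i) * s c)"
      by (simp only: sum_distrib_left mult.assoc)
  qed
  also have "\<dots> = (\<Sum>c<m. \<Sum>i<2 * n. (- 1) ^ (i + 1) * y $ i * h c $ (2 * n - 1 - i) * s c)"
    by (rule sum.swap)
  also have "\<dots> = (\<Sum>c<m. sform n y (h c) * s c)"
    using h by (intro sum.cong refl) (simp add: sform_sum[OF y] sum_distrib_right)
  finally show ?thesis .
qed

section \<open>Cosets of matrix groups\<close>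

definition matrix_group :: "nat \<Rightarrow> 'a::field mat set \<Rightarrow> bool" where
  "matrix_group N H \<longleftrightarrow> H \<subseteq> carrier_mat N N \<and> 1\<^sub>m N \<in> H \<and>
     (\<forall>x\<in>H. \<forall>y\<in>H. x * y \<in> H) \<and> (\<forall>x\<in>H. \<exists>y\<in>H. x * y = 1\<^sub>m N)"

lemma lcoset_mult_right:
  assumes H: "matrix_group N H" and g: "g \<in> carrier_mat N N" and h: "h \<in> H"
  shows "lcoset (g * h) H = lcoset g H"
proof -
  have C: "x \<in> carrier_mat N N" if "x \<in> H" for x using H that by (auto simp: matrix_group_def)
  obtain h' where h': "h' \<in> H" "h * h' = 1\<^sub>m N" using H h by (auto simp: matrix_group_def)
  have "g * h * x \<in> lcoset g H" if "x \<in> H" for x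
  proof -
    have "g * h * x = g * (h * x)" by (rule assoc_mult_mat[OF g C[OF h] C[OF that]])
    moreover have "h * x \<in> H" using H h that by (auto simp: matrix_group_def)
    ultimately show ?thesis by (auto simp: lcoset_def)
  qed
  moreover have "g * x \<in> lcoset (g * h) H" if "x \<in> H" for x
  proof -
    have "g * h * (h' * x) = g * (h * (h' * x))" 
      by (rule assoc_mult_mat[OF g C[OF h]]) (use C h' that in \<open>auto intro: mult_carrier_mat\<close>)
    also have "h * (h' * x) = x"
      using assoc_mult_mat[OF C[OF h] C[OF h'(1)] C[OF that]] h'(2) C[OF that] by simp
    finally have "g * x = g * h * (h' * x)" by simp
    moreover have "h' * x \<in> H" using H h' that by (auto simp: matrix_group_def)
    ultimately show ?thesis by (auto simp: lcoset_def)
  qed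
  ultimately show ?thesis unfolding lcoset_def by auto
qed

lemma lcoset_self:
  assumes "matrix_group N H" "g \<in> carrier_mat N N"
  shows "g \<in> lcoset g H"
  using assms by (auto simp: lcoset_def matrix_group_def intro!: image_eqI[of _ _ "1\<^sub>m N"])

lemma lcoset_eqD:
  assumes "matrix_group N H" "g \<in> carrier_mat N N" "lcoset g H = lcoset g' H"
  obtains h where "h \<in> H" "g = g' * h"
  using lcoset_self[OF assms(1,2)] assms(3) by (auto simp: lcoset_def)

context local_fields
begin

text \<open>By the ultrametric inequality the whole tail after m is as small as its first
  difference; the limit thus inherits a precise estimate at every m.\<close>

lemma complete_seq:
  fixes s :: "nat \<Rightarrow> 'l"
  assumes s: "\<And>m. s (Suc m) - s m \<in> P (int m + c)"
  obtains x where "\<And>m. x - s m \<in> P (int m + c)"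
proof -
  have diff: "s (m + j) - s m \<in> P (int m + c)" for m j
  proof (induction j)
    case (Suc j)
    have "s (Suc (m + j)) - s (m + j) \<in> P (int m + c)" by (rule ppow_mono[OF s]) simp
    from ppow_trans[OF this Suc] show ?case by simp
  qed simp
  have diff': "s i - s m \<in> P (int m + c)" if "m \<le> i" for i m
    using diff[of m "i - m"] that by simp
  have "\<exists>M. \<forall>i\<ge>M. \<forall>j\<ge>M. s i - s j \<in> P N" for N
  proof (intro exI[of _ "nat (N - c)"] allI impI)
    fix i j assume ij: "nat (N - c) \<le> i" "nat (N - c) \<le> j"
    have "s i - s (nat (N - c)) \<in> P N" "s j - s (nat (N - c)) \<in> P N"
      by (rule ppow_mono[OF diff'], use ij in simp, simp)+
    then show "s i - s j \<in> P N" using ppow_trans ppow_diff_commute by metis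
  qed
  moreover have "val_complete (ordL D)"
    using datum by (simp add: is_local_datum_def is_completed_max_unramified_def)
  ultimately obtain x where x: "\<And>N. \<exists>M. \<forall>i\<ge>M. s i - x \<in> P N"
    unfolding val_complete_def by blast
  have "x - s m \<in> P (int m + c)" for m
  proof -
    obtain M where "\<forall>i\<ge>M. s i - x \<in> P (int m + c)" using x by blast
    then have "s (max M m) - x \<in> P (int m + c)" by simp
    then have "x - s (max M m) \<in> P (int m + c)" using ppow_diff_commute by metis
    moreover have "s (max M m) - s m \<in> P (int m + c)" by (rule diff') simp
    ultimately show ?thesis by (rule ppow_trans)
  qed
  then show ?thesis using that by blast
qed

end

context coxeter
begin

section \<open>Self-duality and stability of the lattice\<close>

abbreviation g0 :: "'l vec \<Rightarrow> 'l mat" where "g0 v \<equiv> gm 0 v"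

lemma g0_col [simp]: "v \<in> CV \<Longrightarrow> j < 2 * n \<Longrightarrow> col (g0 v) j = basis_vec v j"
  by (simp add: g_mat_col)

lemma g0_similitude: "v \<in> VS \<Longrightarrow> similitude n (g0 v) (- \<alpha> v)"
  using g_mat_similitude[of v 0] by simp

definition Lam :: "'l vec \<Rightarrow> int \<Rightarrow> 'l vec set" where
  "Lam v N = {g0 v *\<^sub>v z | z. z \<in> CV \<and> (\<forall>i<2 * n. z $ i \<in> P N)}"

lemma LamI: "z \<in> CV \<Longrightarrow> (\<And>i. i < 2 * n \<Longrightarrow> z $ i \<in> P N) \<Longrightarrow> g0 v *\<^sub>v z \<in> Lam v N"
  by (auto simp: Lam_def)

lemma LamE:
  assumes "x \<in> Lam v N"
  obtains z where "z \<in> CV" "\<forall>i<2 * n. z $ i \<in> P N" "x = g0 v *\<^sub>v z"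
  using assms by (auto simp: Lam_def)

lemma Lam_carrier [simp]: "x \<in> Lam v N \<Longrightarrow> x \<in> CV"
  by (auto simp: Lam_def intro: mult_mat_vec_carrier[OF g_mat_carrier])

lemma Lam_mono: "x \<in> Lam v N \<Longrightarrow> M \<le> N \<Longrightarrow> x \<in> Lam v M"
proof (elim LamE)
  fix z assume MN: "M \<le> N" and z: "z \<in> CV" "\<forall>i<2 * n. z $ i \<in> P N" "x = g0 v *\<^sub>v z"
  show "x \<in> Lam v M" unfolding z(3) by (rule LamI[OF z(1)]) (use z(2) ppow_mono[OF _ MN] in blast)
qed

lemma Lam_add: "x \<in> Lam v N \<Longrightarrow> y \<in> Lam v N \<Longrightarrow> x + y \<in> Lam v N"
proof (elim LamE)
  fix z z' assume z: "z \<in> CV" "\<forall>i<2 * n. z $ i \<in> P N" "x = g0 v *\<^sub>v z"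
    and z': "z' \<in> CV" "\<forall>i<2 * n. z' $ i \<in> P N" "y = g0 v *\<^sub>v z'"
  have "x + y = g0 v *\<^sub>v (z + z')"
    unfolding z(3) z'(3) by (rule mult_add_distrib_mat_vec[symmetric, OF g_mat_carrier z(1) z'(1)])
  moreover have "g0 v *\<^sub>v (z + z') \<in> Lam v N"
    using z z' by (intro LamI) (auto intro: ppow_add)
  ultimately show "x + y \<in> Lam v N" by simp
qed

lemma Lam_smult: "x \<in> Lam v N \<Longrightarrow> c \<in> P M \<Longrightarrow> c \<cdot>\<^sub>v x \<in> Lam v (M + N)"
proof (elim LamE)
  fix z assume c: "c \<in> P M" and z: "z \<in> CV" "\<forall>i<2 * n. z $ i \<in> P N" "x = g0 v *\<^sub>v z"
  have "c \<cdot>\<^sub>v x = g0 v *\<^sub>v (c \<cdot>\<^sub>v z)"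
    unfolding z(3) by (rule mult_mat_vec[symmetric, OF g_mat_carrier z(1)])
  moreover have "g0 v *\<^sub>v (c \<cdot>\<^sub>v z) \<in> Lam v (M + N)"
    using z c by (intro LamI) (auto intro: ppow_mult)
  ultimately show "c \<cdot>\<^sub>v x \<in> Lam v (M + N)" by simp
qed

lemma Lam_smult_left: "c \<in> P 0 \<Longrightarrow> x \<in> Lam v N \<Longrightarrow> c \<cdot>\<^sub>v x \<in> Lam v N"
  using Lam_smult[of x v N c 0] by simp

lemma Lam_smult_right: "c \<in> P N \<Longrightarrow> x \<in> Lam v 0 \<Longrightarrow> c \<cdot>\<^sub>v x \<in> Lam v N"
  using Lam_smult[of x v 0 c N] by simp

lemma Lam_cong_smult:
  assumes "s - s' \<in> P N" "s \<in> P 0" "p - q \<in> Lam v N" "q \<in> Lam v 0" "p \<in> CV"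
  shows "s \<cdot>\<^sub>v p - s' \<cdot>\<^sub>v q \<in> Lam v N"
proof -
  have "s \<cdot>\<^sub>v p - s' \<cdot>\<^sub>v q = s \<cdot>\<^sub>v (p - q) + (s - s') \<cdot>\<^sub>v q"
    using assms(5) Lam_carrier[OF assms(4)] by (intro eq_vecI) (auto simp: algebra_simps)
  then show ?thesis using assms by (simp add: Lam_add Lam_smult_left Lam_smult_right)
qed

lemma Lam_cong_diff:
  assumes "p - p' \<in> Lam v N" "q - q' \<in> Lam v N" "p \<in> CV" "p' \<in> CV" "q \<in> CV" "q' \<in> CV"
  shows "(p - q) - (p' - q') \<in> Lam v N"
proof -
  have "(p - q) - (p' - q') = (p - p') + (- 1) \<cdot>\<^sub>v (q - q')"
    using assms(3-6) by (intro eq_vecI) auto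
  moreover have "(- 1) \<cdot>\<^sub>v (q - q') \<in> Lam v N" by (rule Lam_smult_left) (use assms in auto)
  ultimately show ?thesis using assms(1) by (simp add: Lam_add)
qed

lemma Lam_cong_smult_left:
  assumes "p - q \<in> Lam v N" "c \<in> P 0" "p \<in> CV" "q \<in> CV"
  shows "c \<cdot>\<^sub>v p - c \<cdot>\<^sub>v q \<in> Lam v N"
proof -
  have "c \<cdot>\<^sub>v p - c \<cdot>\<^sub>v q = c \<cdot>\<^sub>v (p - q)"
    using assms(3,4) by (intro eq_vecI) (auto simp: algebra_simps)
  then show ?thesis using Lam_smult_left[OF assms(2,1)] by simp
qed

lemma g0_coordinates:
  assumes v: "v \<in> VS" and x: "x \<in> CV"
  shows "x = g0 v *\<^sub>v (symp_inv n (- \<alpha> v) (g0 v) *\<^sub>v x)"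
proof -
  have "g0 v * symp_inv n (- \<alpha> v) (g0 v) = 1\<^sub>m (2 * n)"
    using symp_inv(2)[OF g0_similitude[OF v]] V_sympD(3)[OF v] by simp
  then show ?thesis
    using x assoc_mult_mat_vec[OF g_mat_carrier symp_inv_carrier x, of 0 v "- \<alpha> v" "g0 v"] by simp
qed

text \<open>The coordinates of x are, up to sign, its pairings with the dual basis vectors divided
  by \<alpha>. Stability under an operator is thereby reduced to pairings.\<close>

lemma Lam_criterion:
  assumes v: "v \<in> VS" and x: "x \<in> CV"
    and b: "\<And>i. i < 2 * n \<Longrightarrow> \<langle>basis_vec v i, x\<rangle> \<in> P (ordL D (\<alpha> v) + N)"
  shows "x \<in> Lam v N"
proof -
  define z where "z = symp_inv n (- \<alpha> v) (g0 v) *\<^sub>v x"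
  have z: "z \<in> CV" unfolding z_def by (rule mult_mat_vec_carrier[OF symp_inv_carrier x])
  have "x = g0 v *\<^sub>v z" unfolding z_def by (rule g0_coordinates[OF v x])
  moreover have "z $ i \<in> P N" if i: "i < 2 * n" for i
  proof -
    have i': "2 * n - 1 - i < 2 * n" using i by simp
    have "\<langle>basis_vec v (2 * n - 1 - i), x\<rangle> / (- \<alpha> v) \<in> P N"
      using b[OF i'] V_sympD(3)[OF v] by (intro ppow_divide) (auto simp: add.commute)
    moreover have "z $ i = (- 1) ^ i * (\<langle>basis_vec v (2 * n - 1 - i), x\<rangle> / (- \<alpha> v))"
      unfolding z_def symp_inv_mult_vec[OF g_mat_carrier x i]
      using g0_col[OF V_sympD(1)[OF v] i'] by simp
    ultimately show ?thesis by (simp only: ppow_sign_iff)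
  qed
  ultimately show ?thesis using LamI[OF z] by simp
qed

lemma sform_ppow:
  assumes "x \<in> CV" "y \<in> CV" "\<And>i. i < 2 * n \<Longrightarrow> x $ i \<in> P M" "\<And>i. i < 2 * n \<Longrightarrow> y $ i \<in> P N"
  shows "\<langle>x, y\<rangle> \<in> P (M + N)"
  unfolding sform_sum[OF assms(1,2)]
proof (intro ppow_sum)
  fix i assume "i \<in> {..<2 * n}"
  then have "x $ i * y $ (2 * n - 1 - i) \<in> P (M + N)" using assms by (intro ppow_mult) auto
  then show "(- 1) ^ (i + 1) * x $ i * y $ (2 * n - 1 - i) \<in> P (M + N)"
    by (simp only: mult.assoc ppow_sign_iff)
qed

lemma Lam_form:
  assumes v: "v \<in> VS" and "x \<in> Lam v M" "y \<in> Lam v N"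
  shows "\<langle>x, y\<rangle> \<in> P (ordL D (\<alpha> v) + M + N)"
proof -
  obtain z where z: "z \<in> CV" "\<forall>i<2 * n. z $ i \<in> P M" "x = g0 v *\<^sub>v z"
    using assms(2) by (rule LamE)
  obtain z' where z': "z' \<in> CV" "\<forall>i<2 * n. z' $ i \<in> P N" "y = g0 v *\<^sub>v z'"
    using assms(3) by (rule LamE)
  have "\<langle>x, y\<rangle> = - (\<alpha> v * \<langle>z, z'\<rangle>)"
    unfolding z(3) z'(3) using similitude_form[OF g0_similitude[OF v] z(1) z'(1)] by simp
  moreover have "\<alpha> v * \<langle>z, z'\<rangle> \<in> P (ordL D (\<alpha> v) + (M + N))"
    by (intro ppow_mult ppow_self sform_ppow) (use z z' in auto)
  ultimately show ?thesis by (simp add: add.assoc)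
qed

lemma basis_vec_Lam:
  assumes v: "v \<in> CV" and i: "i < 2 * n"
  shows "basis_vec v i \<in> Lam v 0"
proof -
  have "g0 v *\<^sub>v unit_vec (2 * n) i = basis_vec v i"
    using mult_mat_unit_vec[OF g_mat_carrier i, of 0 v] v i by simp
  moreover have "g0 v *\<^sub>v unit_vec (2 * n) i \<in> Lam v 0"
    by (rule LamI) (auto simp: unit_vec_def)
  ultimately show ?thesis by simp
qed

lemma Lam_F:
  assumes v: "v \<in> VS" and x: "x \<in> Lam v N"
  shows "F x \<in> Lam v N"
proof (rule Lam_criterion[OF v F_carrier])
  fix i assume i: "i < 2 * n"
  note vC = V_sympD(1)[OF v]
  obtain z where z: "z \<in> CV" "\<forall>i<2 * n. z $ i \<in> P N" "x = g0 v *\<^sub>v z"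
    using x by (rule LamE)
  have "\<langle>basis_vec v i, F x\<rangle> = (\<Sum>c<2 * n. \<langle>basis_vec v i, F (col (g0 v) c)\<rangle> * sg (z $ c))"
    unfolding z(3) using vC by (intro sform_linear_combination_right F_mult_mat_vec[OF g_mat_carrier z(1)]) auto
  also have "\<dots> = (\<Sum>c<2 * n. \<langle>basis_vec v i, F (basis_vec v c)\<rangle> * sg (z $ c))"
    using vC by (intro sum.cong) auto
  also have "\<dots> \<in> P (ordL D (\<alpha> v) + N)"
    using F_basis_vec_integral[OF v i] z(2) by (intro ppow_sum ppow_mult) auto
  finally show "\<langle>basis_vec v i, F x\<rangle> \<in> P (ordL D (\<alpha> v) + N)" .
qed

lemma Lam_V:
  assumes v: "v \<in> VS" and x: "x \<in> Lam v N"
  shows "V x \<in> Lam v N"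
proof (rule Lam_criterion[OF v V_carrier[OF Lam_carrier[OF x]]])
  fix i assume i: "i < 2 * n"
  note vC = V_sympD(1)[OF v]
  obtain z where z: "z \<in> CV" "\<forall>i<2 * n. z $ i \<in> P N" "x = g0 v *\<^sub>v z"
    using x by (rule LamE)
  have xC: "g0 v *\<^sub>v z \<in> CV" using x z(3) Lam_carrier by blast
  have "\<langle>basis_vec v i, V x\<rangle> = (\<Sum>c<2 * n. \<langle>basis_vec v i, V (col (g0 v) c)\<rangle> * sgi (z $ c))"
    unfolding z(3) using vC xC by (intro sform_linear_combination_right V_mult_mat_vec[OF g_mat_carrier z(1)]) auto
  also have "\<dots> = (\<Sum>c<2 * n. \<langle>basis_vec v i, V (basis_vec v c)\<rangle> * sgi (z $ c))"
    using vC by (intro sum.cong) auto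
  also have "\<dots> \<in> P (ordL D (\<alpha> v) + N)"
    using V_basis_vec_integral[OF v i] z(2) by (intro ppow_sum ppow_mult) auto
  finally show "\<langle>basis_vec v i, V x\<rangle> \<in> P (ordL D (\<alpha> v) + N)" .
qed

lemma self_Lam: "v \<in> VS \<Longrightarrow> v \<in> Lam v 0"
  using basis_vec_Lam[of v 0] V_sympD(1)[of v] n_ge_1 by (simp add: basis_vec_def)

lemma Lam_F_funpow: "v \<in> VS \<Longrightarrow> x \<in> Lam v N \<Longrightarrow> (F ^^ j) x \<in> Lam v N"
  by (induction j) (auto intro: Lam_F)

lemma F_funpow_diff: "x \<in> CV \<Longrightarrow> y \<in> CV \<Longrightarrow> (F ^^ j) (x - y) = (F ^^ j) x - (F ^^ j) y"
  by (induction j) (auto simp: F_diff)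

lemma Lam_cong_integral:
  assumes "q \<in> Lam v 0" "p - q \<in> Lam v N" "0 \<le> N" "p \<in> CV"
  shows "p \<in> Lam v 0"
proof -
  have "p = (p - q) + q" using assms(4) Lam_carrier[OF assms(1)] by (intro eq_vecI) auto
  then show ?thesis using Lam_add[OF Lam_mono[OF assms(2,3)] assms(1)] by simp
qed

lemma Lam_form_cong:
  assumes v: "v \<in> VS" and p: "p - p' \<in> Lam v N" "p' \<in> Lam v 0" "p \<in> CV"
    and q: "q - q' \<in> Lam v N" "q' \<in> Lam v 0" "q \<in> CV" and N: "0 \<le> N"
  shows "\<langle>p, q\<rangle> - \<langle>p', q'\<rangle> \<in> P (ordL D (\<alpha> v) + N)"
proof -
  have "\<langle>p, q\<rangle> - \<langle>p', q'\<rangle> = \<langle>p - p', q\<rangle> + \<langle>p', q - q'\<rangle>"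
    using p(3) q(3) Lam_carrier[OF p(2)] Lam_carrier[OF q(2)] by (simp add: sform_bilinear)
  moreover have "q \<in> Lam v 0" by (rule Lam_cong_integral[OF q(2,1) N q(3)])
  then have "\<langle>p - p', q\<rangle> \<in> P (ordL D (\<alpha> v) + N)" using Lam_form[OF v p(1), of q 0] by simp
  moreover have "\<langle>p', q - q'\<rangle> \<in> P (ordL D (\<alpha> v) + N)" using Lam_form[OF v p(2) q(1)] by simp
  ultimately show ?thesis using ppow_add by simp
qed

section \<open>Dependence of the construction on v\<close>

context
  fixes u v :: "'l vec" and N :: int
  assumes v: "v \<in> VS" and N: "1 \<le> N" and close: "u - v \<in> Lam v N" and uC: "u \<in> CV"
begin

lemma close_carrier: "u \<in> CV" "v \<in> CV"
  using uC V_sympD(1)[OF v] by auto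

lemma close_F: "(F ^^ j) u - (F ^^ j) v \<in> Lam v N"
  using Lam_F_funpow[OF v close] close_carrier by (simp add: F_funpow_diff)

text \<open>Here u is any vector near v, without membership in \<open>VS\<close>: such estimates
  will show that a limit of vectors in \<open>VS\<close> is again in \<open>VS\<close>.\<close>

lemma close_form_F: "\<langle>u, (F ^^ j) u\<rangle> - \<langle>v, (F ^^ j) v\<rangle> \<in> P (ordL D (\<alpha> v) + N)"
  using close close_F[of j] self_Lam[OF v] Lam_F_funpow[OF v self_Lam[OF v]] close_carrier N
  by (intro Lam_form_cong[OF v]) auto

lemma close_alpha:
  "\<alpha> u \<noteq> 0" "ordL D (\<alpha> u) = ordL D (\<alpha> v)" "\<alpha> u / \<alpha> v - 1 \<in> P N" "\<alpha> v / \<alpha> u - 1 \<in> P N"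
proof -
  note nz = V_sympD(3)[OF v]
  have d: "\<alpha> u - \<alpha> v \<in> P (ordL D (\<alpha> v) + N)" using close_form_F[of n] by (simp add: alpha_def)
  then have "(\<alpha> u - \<alpha> v) / \<alpha> v \<in> P N" using nz by (intro ppow_divide) (auto simp: add.commute)
  then show 1: "\<alpha> u / \<alpha> v - 1 \<in> P N" using nz by (simp add: diff_divide_distrib)
  have d1: "\<alpha> u - \<alpha> v \<in> P (ordL D (\<alpha> v) + 1)" by (rule ppow_mono[OF d]) (use N in simp)
  show "\<alpha> u \<noteq> 0" "ordL D (\<alpha> u) = ordL D (\<alpha> v)" using ord_cong[OF d1 nz] by auto
  show "\<alpha> v / \<alpha> u - 1 \<in> P N" using one_unit(5)[OF 1 N] by simp
qed

text \<open>The quotient of \<alpha> u by \<alpha> v and its twist under the inverse Frobenius are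
  both 1 modulo \<open>P N\<close>, and their quotient is that of \<open>uu u\<close> by
  \<open>uu v\<close>.\<close>

lemma close_uu: "uu u - uu v \<in> P N" "uu u \<in> P 0"
proof -
  let ?x = "\<alpha> u / \<alpha> v"
  have x: "?x - 1 \<in> P N" by (rule close_alpha(3))
  have "sgi (?x - 1) \<in> P N" using x by (simp only: sgi_ppow_iff)
  then have "sgi ?x - 1 \<in> P N" by (simp only: sgi_diff sgi_one)
  from one_unit(5)[OF this N] have "inverse (sgi ?x) - 1 \<in> P N" .
  from one_unit_mult[OF x this N] have "?x * inverse (sgi ?x) - 1 \<in> P N" .
  from ppow_mult_left[OF uu_integral[OF v] this] have "uu v * (?x * inverse (sgi ?x) - 1) \<in> P N" .
  moreover have "uu u - uu v = uu v * (?x * inverse (sgi ?x) - 1)"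
    using V_sympD(3)[OF v] close_alpha(1) by (simp add: sgi_divide field_simps)
  ultimately show d: "uu u - uu v \<in> P N" by metis
  have "uu u - uu v \<in> P 0" by (rule ppow_mono[OF d]) (use N in simp)
  from ppow_add[OF this uu_integral[OF v]] show "uu u \<in> P 0" by simp
qed

lemma close_divide_alpha:
  assumes "A - B \<in> P (ordL D (\<alpha> v) + N)" "B \<in> P (ordL D (\<alpha> v))"
  shows "A / \<alpha> u - B / \<alpha> v \<in> P N"
proof -
  note nz = V_sympD(3)[OF v] close_alpha(1)
  have "A / \<alpha> u - B / \<alpha> v = (A - B) / \<alpha> v * (\<alpha> v / \<alpha> u) + B / \<alpha> v * (\<alpha> v / \<alpha> u - 1)"
    using nz by (simp add: field_simps)
  moreover have "(A - B) / \<alpha> v \<in> P N" using assms(1) nz by (intro ppow_divide) (auto simp: add.commute)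
  moreover have "\<alpha> v / \<alpha> u \<in> P 0" by (rule one_unit(3)[OF close_alpha(4) N])
  moreover have "B / \<alpha> v \<in> P 0" using assms(2) nz by (intro ppow_divide) auto
  ultimately show ?thesis
    using close_alpha(4) by (simp only: ppow_add ppow_mult_right ppow_mult_left)
qed

text \<open>\<open>V\<close>, the form divided by \<alpha>, and the factor \<open>uu\<close>
  preserve congruence modulo p^N without loss of precision, hence so does the recursion. Integrality
  of \<open>GG v i\<close> is carried along because a congruence of products relies on it.\<close>

lemma close_GG: "i < n \<Longrightarrow> GG u i - GG v i \<in> Lam v N \<and> GG v i \<in> Lam v 0"
proof (induction i)
  case 0
  have s: "(- 1) ^ (n + 1) \<in> P 0" by (rule sign_in_ppow)
  show ?case unfolding GG.simps(1)
    using Lam_cong_smult_left[OF close s close_carrier] Lam_smult_left[OF s self_Lam[OF v]] by blast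
next
  case (Suc i)
  let ?x = "GG u i" and ?y = "GG v i"
  have IH: "?x - ?y \<in> Lam v N" "?y \<in> Lam v 0" using Suc by auto
  note C = close_carrier
  have Vd: "V ?x - V ?y \<in> Lam v N" using Lam_V[OF v IH(1)] C by (simp add: V_diff)
  have Vy: "V ?y \<in> Lam v 0" by (rule Lam_V[OF v IH(2)])
  have Fv: "(F ^^ n) v \<in> Lam v 0" by (rule Lam_F_funpow[OF v self_Lam[OF v]])
  have fd: "\<langle>V ?x, (F ^^ n) u\<rangle> - \<langle>V ?y, (F ^^ n) v\<rangle> \<in> P (ordL D (\<alpha> v) + N)"
    using Vd Vy close_F Fv C N by (intro Lam_form_cong[OF v]) auto
  have cd: "cc u i - cc v i \<in> P N"
    by (rule close_divide_alpha[OF fd]) (use Lam_form[OF v Vy Fv] in simp)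
  have "cc u i - cc v i \<in> P 0" by (rule ppow_mono[OF cd]) (use N in simp)
  from ppow_add[OF this cc_integral[OF v, of i]] have cu: "cc u i \<in> P 0" by simp
  have "cc u i \<cdot>\<^sub>v u - cc v i \<cdot>\<^sub>v v \<in> Lam v N"
    by (rule Lam_cong_smult[OF cd cu close self_Lam[OF v] C(1)])
  then have inner: "(V ?x - cc u i \<cdot>\<^sub>v u) - (V ?y - cc v i \<cdot>\<^sub>v v) \<in> Lam v N"
    using C by (intro Lam_cong_diff[OF Vd]) auto
  have "n + i < 2 * n - 1" using Suc.prems by linarith
  then have "GG v (Suc i) = basis_vec v (n + i)" by (simp add: basis_vec_def)
  then have Gv: "GG v (Suc i) \<in> Lam v 0" using basis_vec_Lam[OF C(2), of "n + i"] Suc.prems by simp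
  have "cc v i \<cdot>\<^sub>v v \<in> Lam v 0" by (rule Lam_smult_left[OF cc_integral[OF v] self_Lam[OF v]])
  from Lam_cong_integral[OF Lam_smult_left[OF _ this, of "- 1"], of "V ?y - cc v i \<cdot>\<^sub>v v" 0]
  have inner0: "V ?y - cc v i \<cdot>\<^sub>v v \<in> Lam v 0"
  proof -
    have "V ?y - cc v i \<cdot>\<^sub>v v = V ?y + (- 1) \<cdot>\<^sub>v (cc v i \<cdot>\<^sub>v v)" using C by (intro eq_vecI) auto
    moreover have "(- 1) \<cdot>\<^sub>v (cc v i \<cdot>\<^sub>v v) \<in> Lam v 0"
      by (rule Lam_smult_left) (use \<open>cc v i \<cdot>\<^sub>v v \<in> Lam v 0\<close> in auto)
    ultimately show ?thesis using Lam_add[OF Vy] by simp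
  qed
  have "GG u (Suc i) - GG v (Suc i) \<in> Lam v N"
    unfolding GG.simps(2) G_step_eq
    using C by (intro Lam_cong_smult[OF close_uu inner inner0]) auto
  with Gv show ?case by simp
qed

lemma close_basis_vec: "j < 2 * n \<Longrightarrow> basis_vec u j - basis_vec v j \<in> Lam v N"
  using close_F close_GG[of "j - n + 1"] by (auto simp: basis_vec_def)

text \<open>One inclusion holds because the basis of u is integral over that of v; the other is dual
  to it, as \<alpha> u and \<alpha> v have the same valuation. Successive approximations can thus be
  measured in one fixed lattice.\<close>

lemma close_Lam: "Lam u M = Lam v M"
  if u: "u \<in> VS"
proof
  have bu: "basis_vec u j \<in> Lam v 0" if "j < 2 * n" for j
    using that N close_carrier by (intro Lam_cong_integral[OF basis_vec_Lam close_basis_vec]) auto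
  show "Lam u M \<subseteq> Lam v M"
  proof
    fix x assume x: "x \<in> Lam u M"
    then obtain z where z: "z \<in> CV" "\<forall>i<2 * n. z $ i \<in> P M" "x = g0 u *\<^sub>v z" by (rule LamE)
    show "x \<in> Lam v M"
    proof (rule Lam_criterion[OF v Lam_carrier[OF x]])
      fix i assume i: "i < 2 * n"
      have "\<langle>basis_vec v i, x\<rangle> = (\<Sum>c<2 * n. \<langle>basis_vec v i, basis_vec u c\<rangle> * z $ c)"
        unfolding z(3) using close_carrier
        by (subst sform_mult_mat_vec_right[OF _ g_mat_carrier z(1)]) (auto intro!: sum.cong)
      also have "\<dots> \<in> P (ordL D (\<alpha> v) + M)"
        using Lam_form[OF v basis_vec_Lam[OF close_carrier(2) i] bu] z(2) by (intro ppow_sum ppow_mult) auto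
      finally show "\<langle>basis_vec v i, x\<rangle> \<in> P (ordL D (\<alpha> v) + M)" .
    qed
  qed
  show "Lam v M \<subseteq> Lam u M"
  proof
    fix x assume x: "x \<in> Lam v M"
    show "x \<in> Lam u M"
    proof (rule Lam_criterion[OF u Lam_carrier[OF x]])
      fix i assume "i < 2 * n"
      from Lam_form[OF v bu[OF this] x]
      show "\<langle>basis_vec u i, x\<rangle> \<in> P (ordL D (\<alpha> u) + M)" by (simp add: close_alpha)
    qed
  qed
qed

end

section \<open>The change of basis between two vectors\<close>

definition trans_mat :: "nat \<Rightarrow> 'l vec \<Rightarrow> 'l vec \<Rightarrow> 'l mat" where
  "trans_mat r v u = symp_inv n (- \<alpha> v * pi ^ (r * n)) (gm r v) * gm r u"

lemma trans_mat_carrier [simp]: "trans_mat r v u \<in> carrier_mat (2 * n) (2 * n)"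
  unfolding trans_mat_def by (intro mult_carrier_mat[OF symp_inv_carrier g_mat_carrier])

lemma g_mat_trans_mat:
  assumes "v \<in> VS"
  shows "gm r v * trans_mat r v u = gm r u"
  unfolding trans_mat_def
  using symp_inv(2)[OF g_mat_similitude[OF assms] g_mat_similitude_nonzero[OF assms]]
    assoc_mult_mat[OF g_mat_carrier symp_inv_carrier g_mat_carrier, of r v _ _ r u, symmetric]
  by (simp add: left_mult_one_mat[OF g_mat_carrier])

lemma trans_mat_eqI:
  assumes v: "v \<in> VS" and y: "y \<in> carrier_mat (2 * n) (2 * n)" "gm r u = gm r v * y"
  shows "trans_mat r v u = y"
  unfolding trans_mat_def y(2)
  using symp_inv(1)[OF g_mat_similitude[OF v] g_mat_similitude_nonzero[OF v]]
    assoc_mult_mat[OF symp_inv_carrier g_mat_carrier y(1), of _ _ r v, symmetric]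
  by (simp add: left_mult_one_mat[OF y(1)])

lemma trans_mat_similitude:
  assumes "v \<in> VS" "u \<in> VS"
  shows "similitude n (trans_mat r v u) (\<alpha> u / \<alpha> v)"
proof -
  have "similitude n (trans_mat r v u) (1 / (- \<alpha> v * pi ^ (r * n)) * (- \<alpha> u * pi ^ (r * n)))"
    unfolding trans_mat_def
    by (intro similitude_mult similitude_symp_inv g_mat_similitude g_mat_similitude_nonzero assms)
  then show ?thesis by simp
qed

lemma trans_mat_GSp:
  assumes "v \<in> VS" "u \<in> VS"
  shows "trans_mat r v u \<in> GSp n"
  unfolding GSp_iff using trans_mat_similitude[OF assms] V_sympD(3)[OF assms(1)] V_sympD(3)[OF assms(2)]
  by (meson divide_eq_0_iff)

lemma trans_mat_index:
  assumes v: "v \<in> VS" and u: "u \<in> CV" and ij: "i < 2 * n" "j < 2 * n"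
  shows "trans_mat r v u $$ (i, j) = (- 1) ^ i * (pi ^ (r * expo (2 * n - 1 - i)) * pi ^ (r * expo j) *
    \<langle>basis_vec v (2 * n - 1 - i), basis_vec u j\<rangle>) / (- \<alpha> v * pi ^ (r * n))"
proof -
  note vC = V_sympD(1)[OF v]
  have i': "2 * n - 1 - i < 2 * n" using ij by simp
  have "trans_mat r v u $$ (i, j) =
    (symp_inv n (- \<alpha> v * pi ^ (r * n)) (gm r v) *\<^sub>v col (gm r u) j) $ i"
    unfolding trans_mat_def
    using ij carrier_matD[OF g_mat_carrier[of r u]]
      carrier_matD[OF symp_inv_carrier[of n "- \<alpha> v * pi ^ (r * n)" "gm r v"]]
    by (simp only: index_mult_mat index_mult_mat_vec)
  also have "\<dots> = (- 1) ^ i * \<langle>col (gm r v) (2 * n - 1 - i), col (gm r u) j\<rangle> / (- \<alpha> v * pi ^ (r * n))"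
    by (rule symp_inv_mult_vec[OF g_mat_carrier _ ij(1)]) (rule col_carrier_vec[OF ij(2) g_mat_carrier])
  also have "\<langle>col (gm r v) (2 * n - 1 - i), col (gm r u) j\<rangle> =
    pi ^ (r * expo (2 * n - 1 - i)) * pi ^ (r * expo j) * \<langle>basis_vec v (2 * n - 1 - i), basis_vec u j\<rangle>"
    unfolding g_mat_col[OF vC i'] g_mat_col[OF u ij(2)] using vC u by (simp add: sform_bilinear mult.assoc)
  finally show ?thesis .
qed

text \<open>Level r arises from level 0 by conjugation with the diagonal matrix of the powers pi^(r
  expo). The relation is multiplied out so that all exponents remain natural numbers; the similitude
  factor cancels because mirror exponents add up to n.\<close>

lemma trans_mat_conj:
  assumes v: "v \<in> VS" and u: "u \<in> CV" and ij: "i < 2 * n" "j < 2 * n"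
  shows "pi ^ (r * expo i) * trans_mat r v u $$ (i, j) = pi ^ (r * expo j) * trans_mat 0 v u $$ (i, j)"
proof -
  have "expo i + expo (2 * n - 1 - i) = n" using ij by (intro expo_sum) auto
  then have e: "pi ^ (r * expo i) * pi ^ (r * expo (2 * n - 1 - i)) = pi ^ (r * n)"
    by (simp flip: power_add distrib_left)
  have alg: "p * (s * (q * t * y) / (- a * e)) = t * (s * (1 * 1 * y) / (- a * 1))"
    if "p * q = e" "e \<noteq> 0" for p q t e y s a :: 'l
    using that by (cases "a = 0") (auto simp: field_simps)
  show ?thesis
    unfolding trans_mat_index[OF v u ij] using alg[OF e] by simp
qed

text \<open>Subtracting the identity amounts to subtracting the Gram matrix of v, which leaves
  pairings with the differences of basis vectors.\<close>

lemma trans_mat_0_cong: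
  assumes v: "v \<in> VS" and N: "1 \<le> N" and close: "u - v \<in> Lam v N" and uC: "u \<in> CV" and ij: "i < 2 * n" "j < 2 * n"
  shows "trans_mat 0 v u $$ (i, j) - (if i = j then 1 else 0) \<in> P N"
proof -
  note C = close_carrier[OF v N close uC]
  have i': "2 * n - 1 - i < 2 * n" using ij by simp
  have g: "\<langle>basis_vec v (2 * n - 1 - i), basis_vec v j\<rangle> = - \<alpha> v * (if i = j then (- 1) ^ i else 0)"
    using basis_vec_gram[OF v i' ij(2)] ij by auto
  have "\<langle>basis_vec v (2 * n - 1 - i), basis_vec u j - basis_vec v j\<rangle> \<in> P (ordL D (\<alpha> v) + N)"
    using Lam_form[OF v basis_vec_Lam[OF C(2) i'] close_basis_vec[OF v N close uC ij(2)]] by simp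
  then have "\<langle>basis_vec v (2 * n - 1 - i), basis_vec u j - basis_vec v j\<rangle> / (- \<alpha> v) \<in> P N"
    using V_sympD(3)[OF v] by (intro ppow_divide) (auto simp: add.commute)
  moreover have "trans_mat 0 v u $$ (i, j) - (if i = j then 1 else 0) =
    (- 1) ^ i * (\<langle>basis_vec v (2 * n - 1 - i), basis_vec u j - basis_vec v j\<rangle> / (- \<alpha> v))"
  proof -
    define p where "p = \<langle>basis_vec v (2 * n - 1 - i), basis_vec u j\<rangle>"
    have "\<langle>basis_vec v (2 * n - 1 - i), basis_vec u j - basis_vec v j\<rangle> =
        p + \<alpha> v * (if i = j then (- 1) ^ i else 0)"
      using C by (simp only: sform_diff_right basis_vec_carrier g p_def) simp
    moreover have "trans_mat 0 v u $$ (i, j) = (- 1) ^ i * p / (- \<alpha> v)"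
      unfolding trans_mat_index[OF v C(1) ij] p_def by simp
    moreover have "(- 1) ^ i * ((- 1) ^ i * y) = y" for y :: 'l
      by (simp flip: mult.assoc power_add)
    ultimately show ?thesis using V_sympD(3)[OF v]
      by (cases "i = j") (simp_all add: field_simps)
  qed
  ultimately show ?thesis by (simp only: ppow_sign_iff)
qed

end

section \<open>Limits of cosets\<close>

context coxeter
begin

abbreviation Idot :: "nat \<Rightarrow> 'l mat set" where "Idot m \<equiv> I_dot D n m"

section \<open>The groups \<open>I_dot\<close> and their cosets\<close>

lemma I_dotI:
  assumes "g \<in> GSp n"
    and "\<And>i. i < 2 * n \<Longrightarrow> g $$ (i, i) - 1 \<in> P (int m + 1)"
    and "\<And>i j. i < j \<Longrightarrow> j < 2 * n \<Longrightarrow> g $$ (i, j) \<in> P (int m + 1)"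
    and "\<And>i j. j < i \<Longrightarrow> i < 2 * n \<Longrightarrow> g $$ (i, j) \<in> P (int m)"
  shows "g \<in> Idot m"
  using assms by (auto simp: I_dot_def)

lemma I_dotD:
  assumes "g \<in> Idot m"
  shows "g \<in> GSp n" "g \<in> carrier_mat (2 * n) (2 * n)"
    and "i < 2 * n \<Longrightarrow> g $$ (i, i) - 1 \<in> P (int m + 1)"
    and "i < j \<Longrightarrow> j < 2 * n \<Longrightarrow> g $$ (i, j) \<in> P (int m + 1)"
    and "j < i \<Longrightarrow> i < 2 * n \<Longrightarrow> g $$ (i, j) \<in> P (int m)"
  using assms by (auto simp: I_dot_def GSp_def)

lemma I_dot_integral:
  assumes g: "g \<in> Idot m" and "i < 2 * n" "j < 2 * n"
  shows "g $$ (i, j) \<in> P 0"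
proof -
  consider "i = j" | "i < j" | "j < i" by linarith
  then show ?thesis
  proof cases
    case 1
    have "g $$ (i, i) - 1 \<in> P (int m + 1)" by (rule I_dotD(3)[OF g assms(2)])
    then show ?thesis using one_unit(3) 1 by simp
  next
    case 2
    then show ?thesis using ppow_mono[OF I_dotD(4)[OF g 2 assms(3)], of 0] by simp
  next
    case 3
    then show ?thesis using ppow_mono[OF I_dotD(5)[OF g 3 assms(2)], of 0] by simp
  qed
qed

lemma I_dot_mono: "g \<in> Idot (Suc m) \<Longrightarrow> g \<in> Idot m"
  by (rule I_dotI) (auto intro: ppow_mono[OF I_dotD(3)] ppow_mono[OF I_dotD(4)] ppow_mono[OF I_dotD(5)] I_dotD(1))

lemma GSp_mult: "g \<in> GSp n \<Longrightarrow> h \<in> GSp n \<Longrightarrow> (g * h :: 'l mat) \<in> GSp n"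
  unfolding GSp_iff by (meson mult_eq_0_iff similitude_mult)

lemma GSp_one: "(1\<^sub>m (2 * n) :: 'l mat) \<in> GSp n"
  unfolding GSp_iff by (intro exI[of _ 1]) (simp add: similitude_one)

lemma I_dot_one: "1\<^sub>m (2 * n) \<in> Idot m"
  by (rule I_dotI) (auto simp: GSp_one)

lemma mat_mult_index:
  assumes "A \<in> carrier_mat N N" "B \<in> carrier_mat N N" "i < N" "j < N"
  shows "(A * B) $$ (i, j) = (\<Sum>l<N. A $$ (i, l) * B $$ (l, j))"
  using assms by (auto simp: scalar_prod_def atLeast0LessThan intro!: sum.cong)

lemma I_dot_mult:
  assumes g: "g \<in> Idot m" and h: "h \<in> Idot m"
  shows "g * h \<in> Idot m"
proof (rule I_dotI)
  note C = I_dotD(2)[OF g] I_dotD(2)[OF h]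
  note gi = I_dot_integral[OF g] and hi = I_dot_integral[OF h]
  show "g * h \<in> GSp n" by (intro GSp_mult I_dotD(1)[OF g] I_dotD(1)[OF h])
  \<comment> \<open>On or above the diagonal, every product except that of two diagonal entries
    contains a factor strictly above the diagonal.\<close>
  have small: "g $$ (i, l) * h $$ (l, j) \<in> P (int m + 1)"
    if "i \<le> j" "l \<noteq> i \<or> i \<noteq> j" "i < 2 * n" "j < 2 * n" "l < 2 * n" for i j l
  proof (cases "i < l")
    case True
    then show ?thesis using that by (intro ppow_mult_right I_dotD(4)[OF g] hi)
  next
    case False
    then have "l < j" using that by linarith
    then show ?thesis using that by (intro ppow_mult_left I_dotD(4)[OF h] gi)
  qed
  show "(g * h) $$ (i, j) \<in> P (int m + 1)" if "i < j" "j < 2 * n" for i j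
    using that small by (subst mat_mult_index[OF C]) (auto intro!: ppow_sum)
  show "(g * h) $$ (i, j) \<in> P (int m)" if "j < i" "i < 2 * n" for i j
  proof (subst mat_mult_index[OF C])
    show "(\<Sum>l<2 * n. g $$ (i, l) * h $$ (l, j)) \<in> P (int m)"
    proof (rule ppow_sum)
      fix l assume l: "l \<in> {..<2 * n}"
      show "g $$ (i, l) * h $$ (l, j) \<in> P (int m)"
      proof (cases "l < i")
        case True
        then show ?thesis using that l by (intro ppow_mult_right I_dotD(5)[OF g] hi) auto
      next
        case False
        then show ?thesis using that l by (intro ppow_mult_left I_dotD(5)[OF h] gi) auto
      qed
    qed
  qed (use that in auto)
  show "(g * h) $$ (i, i) - 1 \<in> P (int m + 1)" if i: "i < 2 * n" for i
  proof -
    have "(g * h) $$ (i, i) - 1 =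
      (g $$ (i, i) * h $$ (i, i) - 1) + (\<Sum>l\<in>{..<2 * n} - {i}. g $$ (i, l) * h $$ (l, i))"
      using i by (subst mat_mult_index[OF C i i]) (simp add: sum.remove[of "{..<2 * n}" i])
    moreover have "g $$ (i, i) * h $$ (i, i) - 1 \<in> P (int m + 1)"
      by (intro one_unit_mult I_dotD(3)[OF g i] I_dotD(3)[OF h i]) simp
    moreover have "(\<Sum>l\<in>{..<2 * n} - {i}. g $$ (i, l) * h $$ (l, i)) \<in> P (int m + 1)"
      using i by (intro ppow_sum small) auto
    ultimately show ?thesis by (simp only: ppow_add)
  qed
qed

text \<open>Read off c from the pairing of the first and last columns: one term is a product of two
  diagonal entries, and each other term contains an entry of the last column above the
  diagonal.\<close>

lemma I_dot_similitude_cong: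
  assumes g: "g \<in> Idot m" and s: "similitude n g c"
  shows "c - 1 \<in> P (int m + 1)"
proof -
  note C = similitude_carrier[OF s]
  have i: "0 < 2 * n" "2 * n - 1 < 2 * n" "0 + (2 * n - 1) + 1 = 2 * n" "odd (2 * n - 1)" using n_ge_1 by auto
  have cols: "col g 0 \<in> CV" "col g (2 * n - 1) \<in> CV"
    by (rule col_carrier_vec[OF i(1) C], rule col_carrier_vec[OF i(2) C])
  let ?f = "\<lambda>l. (- 1) ^ (l + 1) * g $$ (l, 0) * g $$ (2 * n - 1 - l, 2 * n - 1)"
  have "\<langle>col g 0, col g (2 * n - 1)\<rangle> = c * (if 0 + (2 * n - 1) + 1 = 2 * n then (- 1) ^ (2 * n - 1) else 0)"
    using s i unfolding similitude_iff_col by blast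
  also have "\<dots> = - c" using i by simp
  finally have "- c = \<langle>col g 0, col g (2 * n - 1)\<rangle>" by simp
  also have "\<dots> = (\<Sum>l<2 * n. ?f l)"
    unfolding sform_sum[OF cols] using C i by (intro sum.cong) auto
  also have "\<dots> = ?f 0 + (\<Sum>l\<in>{..<2 * n} - {0}. ?f l)" using i by (subst sum.remove[of _ 0]) auto
  finally have "c - 1 = (g $$ (0, 0) * g $$ (2 * n - 1, 2 * n - 1) - 1) - (\<Sum>l\<in>{..<2 * n} - {0}. ?f l)"
    by (simp add: algebra_simps)
  moreover have "g $$ (0, 0) * g $$ (2 * n - 1, 2 * n - 1) - 1 \<in> P (int m + 1)"
    using i by (intro one_unit_mult I_dotD(3)[OF g]) auto
  moreover have "(\<Sum>l\<in>{..<2 * n} - {0}. ?f l) \<in> P (int m + 1)"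
  proof (rule ppow_sum)
    fix l assume l: "l \<in> {..<2 * n} - {0}"
    then have "g $$ (l, 0) * g $$ (2 * n - 1 - l, 2 * n - 1) \<in> P (int m + 1)"
      by (intro ppow_mult_left I_dot_integral[OF g] I_dotD(4)[OF g]) auto
    then show "?f l \<in> P (int m + 1)" by (simp only: mult.assoc ppow_sign_iff)
  qed
  ultimately show ?thesis by (simp only: ppow_diff)
qed

text \<open>\<open>symp_inv\<close> reflects in the antidiagonal, which respects the positions
  above, on and below the diagonal, and 1/c is 1 modulo p^(m+1).\<close>

lemma I_dot_inverse:
  assumes g: "g \<in> Idot m"
  shows "\<exists>h\<in>Idot m. g * h = 1\<^sub>m (2 * n)"
proof -
  obtain c where c: "c \<noteq> 0" "similitude n g c" using I_dotD(1)[OF g] by (auto simp: GSp_iff)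
  have c1: "c - 1 \<in> P (int m + 1)" by (rule I_dot_similitude_cong[OF g c(2)])
  have ic: "inverse c - 1 \<in> P (int m + 1)" "inverse c \<in> P 0" using one_unit[OF c1] by auto
  have idx: "symp_inv n c g $$ (i, j) = (- 1) ^ (i + j) * (inverse c * g $$ (2 * n - 1 - j, 2 * n - 1 - i))"
    if "i < 2 * n" "j < 2 * n" for i j
    using that by (simp add: symp_inv_def divide_inverse mult_ac)
  have "symp_inv n c g \<in> Idot m"
  proof (rule I_dotI)
    show "symp_inv n c g \<in> GSp n"
      unfolding GSp_iff using similitude_symp_inv[OF c(2,1)] c(1) by (intro exI[of _ "1 / c"]) simp
    show "symp_inv n c g $$ (i, i) - 1 \<in> P (int m + 1)" if "i < 2 * n" for i
    proof -
      have "inverse c * g $$ (2 * n - 1 - i, 2 * n - 1 - i) - 1 \<in> P (int m + 1)"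
        using that by (intro one_unit_mult ic(1) I_dotD(3)[OF g]) auto
      then show ?thesis using that by (simp add: idx)
    qed
    show "symp_inv n c g $$ (i, j) \<in> P (int m + 1)" if "i < j" "j < 2 * n" for i j
      unfolding idx[OF less_trans[OF that] that(2)] ppow_sign_iff
      using that by (intro ppow_mult_left ic(2) I_dotD(4)[OF g]) auto
    show "symp_inv n c g $$ (i, j) \<in> P (int m)" if "j < i" "i < 2 * n" for i j
      unfolding idx[OF that(2) less_trans[OF that]] ppow_sign_iff
      using that by (intro ppow_mult_left ic(2) I_dotD(5)[OF g]) auto
  qed
  then show ?thesis using symp_inv(2)[OF c(2,1)] by blast
qed

lemma I_dot_group: "matrix_group (2 * n) (Idot m)"
  unfolding matrix_group_def using I_dotD(2) I_dot_one I_dot_mult I_dot_inverse by blast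

abbreviation gI :: "nat \<Rightarrow> nat \<Rightarrow> 'l vec \<Rightarrow> 'l mat set" where
  "gI r m v \<equiv> lcoset (gm r v) (Idot m)"

lemma gI_eqI:
  assumes "v \<in> VS" "trans_mat r v u \<in> Idot m"
  shows "gI r m u = gI r m v"
  using lcoset_mult_right[OF I_dot_group g_mat_carrier[of r v] assms(2)] g_mat_trans_mat[OF assms(1), of r u]
  by simp

lemma gI_eqD:
  assumes "v \<in> VS" "gI r m u = gI r m v"
  shows "trans_mat r v u \<in> Idot m"
proof -
  obtain h where "h \<in> Idot m" "gm r u = gm r v * h"
    using lcoset_eqD[OF I_dot_group g_mat_carrier assms(2)] by blast
  then show ?thesis using trans_mat_eqI[OF assms(1) I_dotD(2)] by metis
qed

lemma m_projection_gI: "m_projection D n m (gI r (Suc m) v) = gI r m v"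
proof -
  have assoc: "gm r v * y * z = gm r v * (y * z)" if "y \<in> Idot (Suc m)" "z \<in> Idot m" for y z
    by (rule assoc_mult_mat[OF g_mat_carrier I_dotD(2)[OF that(1)] I_dotD(2)[OF that(2)]])
  show ?thesis
  proof
    show "m_projection D n m (gI r (Suc m) v) \<subseteq> gI r m v"
      using assoc I_dot_mult[OF I_dot_mono] by (auto simp: m_projection_def lcoset_def)
    show "gI r m v \<subseteq> m_projection D n m (gI r (Suc m) v)"
    proof
      fix x assume "x \<in> gI r m v"
      then obtain z where z: "z \<in> Idot m" "x = gm r v * z" by (auto simp: lcoset_def)
      have "gm r v \<in> gI r (Suc m) v" by (rule lcoset_self[OF I_dot_group g_mat_carrier])
      then show "x \<in> m_projection D n m (gI r (Suc m) v)" unfolding m_projection_def using z by blast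
    qed
  qed
qed

section \<open>Cosets versus congruences of vectors\<close>

lemma expo_pos: "i < 2 * n \<Longrightarrow> i \<noteq> 0 \<Longrightarrow> 1 \<le> expo i"
  by (auto simp: expo_def)

lemma expo_le: "i < 2 * n \<Longrightarrow> expo i \<le> n"
  by (auto simp: expo_def)

text \<open>The first column of the transition matrix holds the coordinates of u in the basis of
  level r. Passing to level 0 multiplies entry i by pi^(r expo i); for i > 0 this gains at least one
  power of pi, lifting the bound m below the diagonal to m + 1.\<close>

lemma first_column_close:
  assumes v: "v \<in> VS" and u: "u \<in> CV" and r: "1 \<le> r" and h: "trans_mat r v u \<in> Idot m"
  shows "u - v \<in> Lam v (int m + 1)"
proof -
  let ?h = "trans_mat r v u"
  note vC = V_sympD(1)[OF v]
  have pos: "0 < 2 * n" using n_ge_1 by simp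
  define z where "z = vec (2 * n) (\<lambda>i. pi ^ (r * expo i) * ?h $$ (i, 0) - (if i = 0 then 1 else 0))"
  have z: "z \<in> CV" by (simp add: z_def)
  have "g0 v *\<^sub>v z \<in> Lam v (int m + 1)"
  proof (rule LamI[OF z])
    fix i assume i: "i < 2 * n"
    show "z $ i \<in> P (int m + 1)"
    proof (cases "i = 0")
      case True
      then show ?thesis using I_dotD(3)[OF h pos] pos by (simp add: z_def expo_def)
    next
      case False
      then have "?h $$ (i, 0) \<in> P (int m)" using I_dotD(5)[OF h] i by simp
      from pi_power_mult_ppow[OF this, of "r * expo i"] have "pi ^ (r * expo i) * ?h $$ (i, 0) \<in> P (int m + 1)"
      proof (rule ppow_mono)
        have "1 \<le> r * expo i" using mult_le_mono[OF r expo_pos[OF i False]] by simp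
        then show "int m + 1 \<le> int m + int (r * expo i)" by linarith
      qed
      then show ?thesis using i False by (simp add: z_def)
    qed
  qed
  moreover have "g0 v *\<^sub>v z = u - v"
  proof (rule eq_vecI)
    fix i assume "i < dim_vec (u - v)"
    then have i: "i < 2 * n" using vC by simp
    have b0: "basis_vec w 0 = w" for w using n_ge_1 by (simp add: basis_vec_def)
    have e0: "expo 0 = 0" using n_ge_1 by (simp add: expo_def)
    have "u $ i = (gm r v * ?h) $$ (i, 0)"
      unfolding g_mat_trans_mat[OF v] g_mat_index[OF u i pos] by (simp add: b0 e0)
    also have "\<dots> = (\<Sum>l<2 * n. gm r v $$ (i, l) * ?h $$ (l, 0))"
      by (rule mat_mult_index[OF g_mat_carrier trans_mat_carrier i pos])
    also have "\<dots> = (\<Sum>l<2 * n. g0 v $$ (i, l) * z $ l + (if l = 0 then v $ i else 0))"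
      using vC i by (intro sum.cong) (auto simp: g_mat_index z_def b0 algebra_simps)
    also have "\<dots> = (g0 v *\<^sub>v z) $ i + v $ i"
      using pos by (simp add: sum.distrib mult_mat_vec_index[OF g_mat_carrier z i])
    finally show "(g0 v *\<^sub>v z) $ i = (u - v) $ i" using i vC by (simp add: algebra_simps)
  qed (use vC carrier_matD[OF g_mat_carrier[of 0 v]] in simp)
  ultimately show ?thesis by simp
qed

text \<open>
  Since \<open>trans_mat 0 v u\<close> is congruent to the identity, conjugation by the diagonal matrix with
  exponents \<open>r * expo i\<close> is harmless where it multiplies by a nonnegative power of the uniformizer.
  The other entries of \<open>trans_mat r v u\<close> are multiples of those of \<open>trans_mat (r + 1) v u\<close>.
\<close>

lemma gI_transition:
  assumes v: "v \<in> VS" and u: "u \<in> VS" and eq: "gI (Suc r) m u = gI (Suc r) m v"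
  shows "gI r m u = gI r m v"
proof -
  note uC = V_sympD(1)[OF u]
  have hR: "trans_mat (Suc r) v u \<in> Idot m" by (rule gI_eqD[OF v eq])
  have close: "u - v \<in> Lam v (int m + 1)" by (rule first_column_close[OF v uC _ hR]) simp
  have h0: "trans_mat 0 v u $$ (i, j) - (if i = j then 1 else 0) \<in> P (int m + 1)" if "i < 2 * n" "j < 2 * n" for i j
    by (rule trans_mat_0_cong[OF v _ close uC that]) simp
  have diag: "trans_mat r v u $$ (i, i) - 1 \<in> P (int m + 1)" if "i < 2 * n" for i
    using h0[OF that that] trans_mat_conj[OF v uC that that, of r] by simp
  have up: "trans_mat r v u $$ (i, j) \<in> P (int m + 1)"
    if "i < 2 * n" "j < 2 * n" "i \<noteq> j" "expo i \<le> expo j" for i j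
  proof -
    have "pi ^ (r * expo j) = pi ^ (r * expo i) * pi ^ (r * (expo j - expo i))"
      using that(4) by (simp flip: power_add distrib_left)
    then have "trans_mat r v u $$ (i, j) = pi ^ (r * (expo j - expo i)) * trans_mat 0 v u $$ (i, j)"
      using trans_mat_conj[OF v uC that(1,2), of r] by (simp add: mult.assoc)
    then show ?thesis using pi_power_mult_integral h0[OF that(1,2)] that(3) by simp
  qed
  have down: "trans_mat r v u $$ (i, j) \<in> P (int m + 1)"
    if ij: "i < 2 * n" "j < 2 * n" "i \<noteq> j" and e: "expo j < expo i" for i j
  proof -
    have conj1: "pi ^ (r * expo i) * trans_mat r v u $$ (i, j) = pi ^ (r * expo j) * trans_mat 0 v u $$ (i, j)"
      by (rule trans_mat_conj[OF v uC ij(1,2)])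
    have "pi ^ (Suc r * expo i) * trans_mat (Suc r) v u $$ (i, j) = pi ^ (Suc r * expo j) * trans_mat 0 v u $$ (i, j)"
      by (rule trans_mat_conj[OF v uC ij(1,2)])
    also have "\<dots> = pi ^ expo j * (pi ^ (r * expo i) * trans_mat r v u $$ (i, j))"
      unfolding conj1 by (simp add: power_add)
    finally have "pi ^ (r * expo i) * (pi ^ expo i * trans_mat (Suc r) v u $$ (i, j)) =
      pi ^ (r * expo i) * (pi ^ expo j * trans_mat r v u $$ (i, j))" by (simp add: power_add mult_ac)
    then have "pi ^ expo i * trans_mat (Suc r) v u $$ (i, j) = pi ^ expo j * trans_mat r v u $$ (i, j)" by simp
    moreover have "pi ^ expo i = pi ^ expo j * pi ^ (expo i - expo j)" using e by (simp flip: power_add)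
    ultimately have "trans_mat r v u $$ (i, j) = pi ^ (expo i - expo j) * trans_mat (Suc r) v u $$ (i, j)"
      by (simp add: mult.assoc)
    moreover have "trans_mat (Suc r) v u $$ (i, j) \<in> P (int m)"
      using I_dotD(4)[OF hR, of i j] I_dotD(5)[OF hR, of j i] ij ppow_mono[of _ "int m + 1" "int m"]
      by (cases "i < j") auto
    from pi_power_mult_ppow[OF this, of "expo i - expo j"]
    have "pi ^ (expo i - expo j) * trans_mat (Suc r) v u $$ (i, j) \<in> P (int m + 1)"
      by (rule ppow_mono) (use e in simp)
    ultimately show ?thesis by simp
  qed
  have off: "trans_mat r v u $$ (i, j) \<in> P (int m + 1)" if "i < 2 * n" "j < 2 * n" "i \<noteq> j" for i j
    using up[OF that] down[OF that] by (cases "expo i \<le> expo j") auto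
  have "trans_mat r v u \<in> Idot m"
    by (rule I_dotI) (use diag off ppow_mono[OF off, of _ _ "int m"] trans_mat_GSp[OF v u] in auto)
  then show ?thesis by (rule gI_eqI[OF v])
qed

text \<open>Undoing the conjugation costs at most pi^(r n), as the exponents \<open>expo\<close> lie
  between 0 and n. This is the surplus r n in the required precision.\<close>

lemma gI_limit:
  assumes v: "v \<in> VS" and u: "u \<in> VS" and close: "u - v \<in> Lam v (int (m + r * n) + 1)"
  shows "gI r m u = gI r m v"
proof -
  note uC = V_sympD(1)[OF u]
  have h0: "trans_mat 0 v u $$ (i, j) - (if i = j then 1 else 0) \<in> P (int (m + r * n) + 1)"
    if "i < 2 * n" "j < 2 * n" for i j
    by (rule trans_mat_0_cong[OF v _ close uC that]) simp
  have diag: "trans_mat r v u $$ (i, i) - 1 \<in> P (int m + 1)" if "i < 2 * n" for i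
    using ppow_mono[OF h0[OF that that], of "int m + 1"] trans_mat_conj[OF v uC that that, of r] by simp
  have off: "trans_mat r v u $$ (i, j) \<in> P (int m + 1)" if ij: "i < 2 * n" "j < 2 * n" "i \<noteq> j" for i j
  proof -
    have "pi ^ (r * expo j) * trans_mat 0 v u $$ (i, j) \<in> P (int (m + r * n) + 1)"
      using pi_power_mult_integral h0[OF ij(1,2)] ij(3) by simp
    then have "pi ^ (r * expo i) * trans_mat r v u $$ (i, j) \<in> P (int (m + r * n) + 1)"
      using trans_mat_conj[OF v uC ij(1,2), of r] by simp
    moreover have "r * expo i \<le> r * n" using expo_le[OF ij(1)] by simp
    then have "int m + 1 + int (r * expo i) \<le> int (m + r * n) + 1" by (simp flip: of_nat_mult)
    ultimately have "pi ^ (r * expo i) * trans_mat r v u $$ (i, j) \<in> P (int m + 1 + ordL D (pi ^ (r * expo i)))"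
      using ppow_mono[of _ "int (m + r * n) + 1"] by (simp only: ord_pi_power)
    then have "pi ^ (r * expo i) * trans_mat r v u $$ (i, j) / pi ^ (r * expo i) \<in> P (int m + 1)"
      by (rule ppow_divide) simp
    then show ?thesis by simp
  qed
  have "trans_mat r v u \<in> Idot m"
    by (rule I_dotI) (use diag off ppow_mono[OF off, of _ _ "int m"] trans_mat_GSp[OF v u] in auto)
  then show ?thesis by (rule gI_eqI[OF v])
qed

text \<open>The transition relation already presents each component as the class of some
  \<open>g_mat\<close>, so \<open>Y\<close> may be arbitrary and the lemma serves both limits.
  Vectors chosen along the components (m + 1, m) converge, and their limit represents every
  component.\<close>

lemma dot_limit_subset:
  assumes x: "x \<in> dot_limit D n k Y"
  shows "\<exists>v\<in>VS. \<alpha> v \<in> KtimesL D \<and> x = g_classes D n k v"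
proof -
  have ext: "x \<in> extensional {(r, m). m < r}"
    using x by (auto simp: dot_limit_def PiE_def)
  have tr: "\<exists>w\<in>VS. sg (\<alpha> w) / \<alpha> w - 1 \<in> P (int m + 1) \<and> x (Suc r, m) = gI (Suc r) m w \<and> x (r, m) = gI r m w"
    if "m < r" for r m
  proof -
    have "(x (r + 1, m), x (r, m)) \<in> r_transition D n k r m" using x that by (simp add: dot_limit_def)
    then show ?thesis unfolding r_transition_def by auto
  qed
  have pr: "m_projection D n m (x (r, Suc m)) = x (r, m)" if "Suc m < r" for r m
    using x that by (simp add: dot_limit_def)
  \<comment> \<open>One vector has to represent two components: at (m + 2, m) it meets its
    successor, and at (m + 1, m) the projections in m start.\<close>
  have "\<forall>m. \<exists>w. w \<in> VS \<and> sg (\<alpha> w) / \<alpha> w - 1 \<in> P (int m + 1) \<and>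
      x (Suc (Suc m), m) = gI (Suc (Suc m)) m w \<and> x (Suc m, m) = gI (Suc m) m w"
    using tr[of _ "Suc _"] by blast
  then obtain w where w: "\<And>m. w m \<in> VS" "\<And>m. sg (\<alpha> (w m)) / \<alpha> (w m) - 1 \<in> P (int m + 1)"
      "\<And>m. x (Suc (Suc m), m) = gI (Suc (Suc m)) m (w m)" "\<And>m. x (Suc m, m) = gI (Suc m) m (w m)"
    by metis
  note wC = V_sympD(1)[OF w(1)]
  have col: "x (Suc M, M - j) = gI (Suc M) (M - j) (w M)" for M j
  proof (induction j)
    case 0
    then show ?case using w(4) by simp
  next
    case (Suc j)
    show ?case
    proof (cases "j < M")
      case True
      then have eq: "M - j = Suc (M - Suc j)" by simp
      then show ?thesis using pr[of "M - Suc j" "Suc M"] Suc m_projection_gI[of "M - Suc j"] by simp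
    next
      case False
      then show ?thesis using Suc by simp
    qed
  qed
  \<comment> \<open>Now r is lowered at fixed m. The relation may exhibit another vector u here; its
    class at the higher level is that of w M, and \<open>gI_transition\<close> carries the equality
    down.\<close>
  have row: "m < Suc M - j \<Longrightarrow> x (Suc M - j, m) = gI (Suc M - j) m (w M)" for M m j
  proof (induction j)
    case 0
    then show ?case using col[of M "M - m"] by simp
  next
    case (Suc j)
    define r where "r = Suc M - Suc j"
    have r: "Suc M - j = Suc r" "m < r" using Suc.prems by (auto simp: r_def)
    obtain u where u: "u \<in> VS" "x (Suc r, m) = gI (Suc r) m u" "x (r, m) = gI r m u"
      using tr[OF r(2)] by blast
    have "x (Suc r, m) = gI (Suc r) m (w M)" using Suc.IH r(2) unfolding r(1) by simp
    with u(2) have "gI (Suc r) m u = gI (Suc r) m (w M)" by simp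
    from gI_transition[OF w(1) u(1) this] have "gI r m u = gI r m (w M)" .
    then show ?case using u(3) unfolding r_def[symmetric] by simp
  qed
  \<comment> \<open>Both vectors represent the component (m + 2, m).\<close>
  have next_close: "w (Suc m) - w m \<in> Lam (w m) (int m + 1)" for m
  proof -
    have "x (Suc (Suc m), m) = gI (Suc (Suc m)) m (w (Suc m))" using col[of "Suc m" 1] by simp
    then have "gI (Suc (Suc m)) m (w (Suc m)) = gI (Suc (Suc m)) m (w m)" using w(3) by simp
    from gI_eqD[OF w(1) this] show ?thesis by (intro first_column_close[OF w(1) wC]) auto
  qed
  have Lam_const: "Lam (w m) N = Lam (w 0) N" for m N
  proof (induction m)
    case (Suc m)
    have "Lam (w (Suc m)) N = Lam (w m) N"
      by (rule close_Lam[OF w(1) _ next_close wC w(1)]) simp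
    then show ?case using Suc by simp
  qed simp
  \<comment> \<open>Convergence takes place in the coordinates of the single basis
    \<open>g0 (w 0)\<close>.\<close>
  have step: "\<exists>z. z \<in> CV \<and> (\<forall>i<2 * n. z $ i \<in> P (int m + 1)) \<and> w (Suc m) - w m = g0 (w 0) *\<^sub>v z" for m
    using next_close[of m] unfolding Lam_const[of m] by (auto elim: LamE)
  then obtain z where z: "\<And>m. z m \<in> CV" "\<And>m i. i < 2 * n \<Longrightarrow> z m $ i \<in> P (int m + 1)"
      "\<And>m. w (Suc m) - w m = g0 (w 0) *\<^sub>v z m" by metis
  have "\<exists>y. \<forall>m. y - (\<Sum>l<m. z l $ i) \<in> P (int m + 1)" if "i < 2 * n" for i
  proof -
    have "(\<Sum>l<Suc m. z l $ i) - (\<Sum>l<m. z l $ i) \<in> P (int m + 1)" for m using z(2)[OF that] by simp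
    from complete_seq[of "\<lambda>m. \<Sum>l<m. z l $ i" 1, OF this] show ?thesis by blast
  qed
  then obtain y where y: "\<And>i m. i < 2 * n \<Longrightarrow> y i - (\<Sum>l<m. z l $ i) \<in> P (int m + 1)" by metis
  define t where "t = (\<lambda>m. vec (2 * n) (\<lambda>i. \<Sum>l<m. z l $ i))"
  have t: "t m \<in> CV" for m by (simp add: t_def)
  have wt: "w m = w 0 + g0 (w 0) *\<^sub>v t m" for m
  proof (induction m)
    case 0
    have "t 0 = 0\<^sub>v (2 * n)" by (rule eq_vecI) (auto simp: t_def)
    moreover have "g0 (w 0) *\<^sub>v 0\<^sub>v (2 * n) = 0\<^sub>v (2 * n)"
      using carrier_matD[OF g_mat_carrier[of 0 "w 0"]] by (intro eq_vecI) simp_all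
    ultimately show ?case using wC[of 0] by simp
  next
    case (Suc m)
    have "t (Suc m) = t m + z m" using z(1)[of m] by (intro eq_vecI) (auto simp: t_def)
    then have "g0 (w 0) *\<^sub>v t (Suc m) = g0 (w 0) *\<^sub>v t m + (w (Suc m) - w m)"
      using mult_add_distrib_mat_vec[OF g_mat_carrier t z(1)] z(3) by simp
    moreover have "w 0 + (a + (w (Suc m) - (w 0 + a))) = w (Suc m)" if "a \<in> CV" for a
      using that wC[of 0] wC[of "Suc m"] by (intro eq_vecI) auto
    moreover have "g0 (w 0) *\<^sub>v t m \<in> CV" by (rule mult_mat_vec_carrier[OF g_mat_carrier t])
    ultimately show ?case using Suc by metis
  qed
  define v where "v = w 0 + g0 (w 0) *\<^sub>v vec (2 * n) y"
  have mC: "g0 (w 0) *\<^sub>v a \<in> CV" if "a \<in> CV" for a by (rule mult_mat_vec_carrier[OF g_mat_carrier that])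
  have vC: "v \<in> CV" unfolding v_def using wC[of 0] mC[of "vec (2 * n) y"] by simp
  have close: "v - w m \<in> Lam (w m) (int m + 1)" for m
  proof -
    have "v - w m = g0 (w 0) *\<^sub>v vec (2 * n) y - g0 (w 0) *\<^sub>v t m"
      unfolding v_def wt[of m] using wC[of 0] mC[OF t, of m] mC[of "vec (2 * n) y"]
      by (intro eq_vecI) auto
    also have "\<dots> = g0 (w 0) *\<^sub>v (vec (2 * n) y - t m)"
      by (rule mult_minus_distrib_mat_vec[symmetric, OF g_mat_carrier _ t]) simp
    also have "\<dots> \<in> Lam (w 0) (int m + 1)" using y t by (intro LamI) (auto simp: t_def)
    finally show ?thesis unfolding Lam_const[of m] .
  qed
  \<comment> \<open>The estimates are relative to \<alpha> (w m); they tend to 0 because its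
    valuation does not vary with m.\<close>
  have ordw: "ordL D (\<alpha> (w m)) = ordL D (\<alpha> (w 0))" for m
    using close_alpha(2)[OF w(1) _ close vC, of m] close_alpha(2)[OF w(1) _ close vC, of 0] by simp
  have van: "\<langle>v, (F ^^ i) v\<rangle> = 0" if i: "1 \<le> i" "i < n" for i
  proof -
    have "\<langle>v, (F ^^ i) v\<rangle> / \<alpha> (w 0) \<in> P (int m)" for m
    proof (rule ppow_divide)
      have "\<langle>v, (F ^^ i) v\<rangle> - \<langle>w m, (F ^^ i) (w m)\<rangle> \<in> P (ordL D (\<alpha> (w m)) + (int m + 1))"
        by (rule close_form_F[OF w(1) _ close vC]) simp
      then have "\<langle>v, (F ^^ i) v\<rangle> \<in> P (ordL D (\<alpha> (w 0)) + (int m + 1))"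
        using V_sympD(2)[OF w(1) i, of m] unfolding ordw[of m] by simp
      then show "\<langle>v, (F ^^ i) v\<rangle> \<in> P (int m + ordL D (\<alpha> (w 0)))" by (rule ppow_mono) simp
    qed (rule V_sympD(3)[OF w(1)])
    then have "\<langle>v, (F ^^ i) v\<rangle> / \<alpha> (w 0) = 0" by (rule ppow_all_zero)
    then show ?thesis using V_sympD(3)[OF w(1)] by simp
  qed
  have nz: "\<alpha> v \<noteq> 0" by (rule close_alpha(1)[OF w(1) _ close vC, of 0]) simp
  have v: "v \<in> VS" using vC van nz n_ge_1 by (auto simp: V_symp_def)
  have "sg (\<alpha> v) / \<alpha> v - 1 \<in> P (int m)" for m
  proof -
    let ?q = "\<alpha> v / \<alpha> (w m)"
    have q: "?q - 1 \<in> P (int m + 1)" by (rule close_alpha(3)[OF w(1) _ close vC]) simp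
    then have "sg (?q - 1) \<in> P (int m + 1)" by (simp only: sg_ppow_iff)
    then have "sg ?q - 1 \<in> P (int m + 1)" by (simp only: sg_diff sg_one)
    then have "sg (\<alpha> (w m)) / \<alpha> (w m) * (sg ?q * inverse ?q) - 1 \<in> P (int m + 1)"
      by (intro one_unit_mult w(2) one_unit(5)[OF q]) auto
    moreover have "sg (\<alpha> (w m)) / \<alpha> (w m) * (sg ?q * inverse ?q) = sg (\<alpha> v) / \<alpha> v"
      using nz V_sympD(3)[OF w(1), of m] by (simp add: sg_divide field_simps)
    ultimately show ?thesis by (auto intro: ppow_mono)
  qed
  then have "sg (\<alpha> v) / \<alpha> v - 1 = 0" by (rule ppow_all_zero)
  then have "\<alpha> v \<in> KtimesL D" using nz by (simp add: KtimesL_iff)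
  moreover have "x = g_classes D n k v"
  proof (rule extensionalityI[OF ext])
    show "g_classes D n k v \<in> extensional {(r, m). m < r}" by (simp add: g_classes_def)
    fix p :: "nat \<times> nat" assume "p \<in> {(r, m). m < r}"
    then obtain r m where p: "p = (r, m)" "m < r" by auto
    \<comment> \<open>Large enough both for the precision in \<open>gI_limit\<close> and for
      \<open>row\<close> to reach down from M + 1 to r.\<close>
    define M where "M = m + r * n + r"
    have "x (r, m) = gI r m (w M)" using row[of m M "Suc M - r"] p(2) by (simp add: M_def)
    moreover have "gI r m v = gI r m (w M)"
    proof (rule gI_limit[OF w(1) v])
      show "v - w M \<in> Lam (w M) (int (m + r * n) + 1)" by (rule Lam_mono[OF close]) (simp add: M_def)
    qed
    ultimately show "x p = g_classes D n k v p" using p by (simp add: g_classes_def)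
  qed
  ultimately show ?thesis using v by blast
qed

lemma Lam_exhaust:
  assumes v: "v \<in> VS" and y: "y \<in> CV"
  shows "\<exists>t. y \<in> Lam v t"
proof -
  define z where "z = symp_inv n (- \<alpha> v) (g0 v) *\<^sub>v y"
  have z: "z \<in> CV" unfolding z_def by (rule mult_mat_vec_carrier[OF symp_inv_carrier y])
  have y: "y = g0 v *\<^sub>v z" unfolding z_def by (rule g0_coordinates[OF v y])
  have "z $ i \<in> P (- (\<Sum>i<2 * n. \<bar>ordL D (z $ i)\<bar>))" if "i < 2 * n" for i
    using member_le_sum[of i "{..<2 * n}" "\<lambda>i. \<bar>ordL D (z $ i)\<bar>"] that by (force simp: ppow_def)
  from LamI[OF z this] show ?thesis unfolding y by blast
qed

text \<open>The components (m + 1, m) put u - v into arbitrarily small multiples of the lattice of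
  v. Such a vector pairs to zero with everything, and the form is nondegenerate.\<close>

lemma g_classes_inj:
  assumes v: "v \<in> VS" and u: "u \<in> VS" and eq: "g_classes D n k u = g_classes D n k v"
  shows "u = v"
proof -
  have "u - v \<in> Lam v (int m)" for m
  proof -
    have "g_classes D n k u (Suc m, m) = g_classes D n k v (Suc m, m)" using eq by simp
    then have "gI (Suc m) m u = gI (Suc m) m v" by (simp add: g_classes_def)
    from gI_eqD[OF v this] have "u - v \<in> Lam v (int m + 1)"
      by (intro first_column_close[OF v V_sympD(1)[OF u]]) auto
    then show ?thesis by (rule Lam_mono) simp
  qed
  note small = this
  have form: "\<langle>u - v, y\<rangle> = 0" if "y \<in> CV" for y
  proof -
    obtain t where t: "y \<in> Lam v t" using Lam_exhaust[OF v \<open>y \<in> CV\<close>] by blast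
    have "\<langle>u - v, y\<rangle> \<in> P (int m)" for m
    proof -
      have "\<langle>u - v, y\<rangle> \<in> P (ordL D (\<alpha> v) + int (m + nat (- ordL D (\<alpha> v) - t)) + t)"
        by (rule Lam_form[OF v small t])
      then show ?thesis by (rule ppow_mono) simp
    qed
    then show ?thesis by (rule ppow_all_zero)
  qed
  have "u - v = 0\<^sub>v (2 * n)"
    by (rule vec_eq_0_if_sform_0) (use form V_sympD(1)[OF u] V_sympD(1)[OF v] in auto)
  then have "(u - v) $ i = 0" if "i < 2 * n" for i using that by simp
  then show ?thesis using V_sympD(1)[OF u] V_sympD(1)[OF v] by (intro eq_vecI) auto
qed

end

section \<open>Relative position of the Coxeter basis\<close>

lemma mat_inverse_eq:
  fixes A :: "'a::field mat"
  assumes A: "A \<in> carrier_mat N N" and B: "B \<in> carrier_mat N N" and AB: "A * B = 1\<^sub>m N" "B * A = 1\<^sub>m N"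
  shows "the (mat_inverse A) = B"
proof (cases "mat_inverse A")
  case None
  then have "A \<notin> Units (ring_mat TYPE('a) N ())" by (rule mat_inverse(1)[OF A])
  then show ?thesis using A B AB by (auto simp: Units_def ring_mat_simps)
next
  case (Some C)
  then have C: "A * C = 1\<^sub>m N" "C * A = 1\<^sub>m N" "C \<in> carrier_mat N N" using mat_inverse(2)[OF A] by auto
  have "C = C * (A * B)" using AB C by simp
  also have "\<dots> = C * A * B" by (rule assoc_mult_mat[symmetric, OF C(3) A B])
  also have "\<dots> = B" using C(2) B by simp
  finally show ?thesis using Some by simp
qed

context coxeter
begin

section \<open>The matrices b \<sigma>(g) and w\<close>

abbreviation fmat :: "'l mat \<Rightarrow> 'l mat" where "fmat g \<equiv> b_mat D n k * map_mat sg g"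

lemma fmat_carrier [simp]: "g \<in> carrier_mat (2 * n) (2 * n) \<Longrightarrow> fmat g \<in> carrier_mat (2 * n) (2 * n)"
  by (intro mult_carrier_mat[OF b_mat_carrier]) simp

lemma fmat_col:
  assumes "g \<in> carrier_mat (2 * n) (2 * n)" "j < 2 * n"
  shows "col (fmat g) j = F (col g j)"
proof -
  have "col (fmat g) j = b_mat D n k *\<^sub>v col (map_mat sg g) j"
    using assms by (intro col_mult2[OF b_mat_carrier]) auto
  also have "col (map_mat sg g) j = map_vec sg (col g j)"
    using assms by (intro eq_vecI) auto
  finally show ?thesis by (simp add: Fr_def)
qed

lemma fmat_similitude:
  assumes g: "similitude n g c"
  shows "similitude n (fmat g) (- (pi ^ k) * sg c)"
  unfolding similitude_iff_col
proof (intro conjI allI impI)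
  note C = similitude_carrier[OF g]
  show "fmat g \<in> carrier_mat (2 * n) (2 * n)" by (rule fmat_carrier[OF C])
  fix i j assume ij: "i < 2 * n" "j < 2 * n"
  have cols: "col g i \<in> CV" "col g j \<in> CV" using C ij by (auto intro: col_carrier_vec)
  have gram: "\<langle>col g i, col g j\<rangle> = c * (if i + j + 1 = 2 * n then (- 1) ^ j else 0)"
    using g ij unfolding similitude_iff_col by blast
  have "\<langle>col (fmat g) i, col (fmat g) j\<rangle> = - (pi ^ k * sg (c * (if i + j + 1 = 2 * n then (- 1) ^ j else 0)))"
    unfolding fmat_col[OF C ij(1)] fmat_col[OF C ij(2)] F_form[OF cols] gram by simp
  then show "\<langle>col (fmat g) i, col (fmat g) j\<rangle> =
      - (pi ^ k) * sg c * (if i + j + 1 = 2 * n then (- 1) ^ j else 0)"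
    by (simp add: sg_mult)
qed

definition wcoef :: "nat \<Rightarrow> nat \<Rightarrow> 'l" where
  "wcoef r j = (if j < n then pi powi (- int r) else if j = n then (- 1) ^ (n + 1) * pi ^ (r + k) else pi ^ (r + k))"

abbreviation w :: "nat \<Rightarrow> 'l mat" where "w r \<equiv> w_mat D n k r"

lemma w_carrier [simp]: "w r \<in> carrier_mat (2 * n) (2 * n)"
  unfolding w_mat_def by (intro carrier_matI) (simp_all del: upt_Suc)

lemma w_col:
  assumes j: "j < 2 * n"
  shows "col (w r) j = wcoef r j \<cdot>\<^sub>v unit_vec (2 * n) (tau_inv j)"
proof -
  have nth: "[1..<2 * n + 1] ! j = j + 1" using assms by (subst nth_upt) auto
  have len: "length [1..<2 * n + 1] = 2 * n" by (simp only: length_upt add_diff_cancel_right')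
  have "col (w r) j =
    (if j + 1 < n then (pi powi (- int r)) \<cdot>\<^sub>v basis n (j + 2)
     else if j + 1 = n then (pi powi (- int r)) \<cdot>\<^sub>v basis n (2 * n)
     else if j = n then ((- 1) ^ (n + 1) * pi ^ (r + k)) \<cdot>\<^sub>v basis n 1
     else pi ^ (r + k) \<cdot>\<^sub>v basis n j)"
    unfolding w_mat_def using assms
    by (subst col_mat_of_cols) (auto simp: len nth basis_def simp del: upt_Suc)
  also have "\<dots> = wcoef r j \<cdot>\<^sub>v unit_vec (2 * n) (tau_inv j)"
    using j n_ge_1 unfolding basis_def wcoef_def tau_inv_def by auto
  finally show ?thesis .
qed

lemma tau_inv_flip: "i < 2 * n \<Longrightarrow> tau_inv (2 * n - 1 - i) = 2 * n - 1 - tau_inv i"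
proof -
  assume i: "i < 2 * n"
  have t: "tau_inv i < 2 * n" "2 * n - 1 - tau_inv i < 2 * n" using tau_inv_less[OF i] by auto
  have "tau (2 * n - 1 - tau_inv i) = 2 * n - 1 - i" using tau_flip[OF t(1)] tau_tau_inv[OF i] by simp
  then show ?thesis using tau_inv_tau[OF t(2)] by metis
qed

text \<open>A column and its mirror lie in different halves, so pi^(-r) always meets pi^(r+k). Hence
  w has the same factor as b for every r, which is necessary for the two to be related.\<close>

lemma w_similitude: "similitude n (w r) (- (pi ^ k))"
  unfolding similitude_iff_col
proof (intro conjI allI impI)
  fix i j assume ij: "i < 2 * n" "j < 2 * n"
  have iff: "tau_inv i + tau_inv j + 1 = 2 * n \<longleftrightarrow> i + j + 1 = 2 * n"
  proof
    assume "tau_inv i + tau_inv j + 1 = 2 * n"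
    then have "tau_inv i = 2 * n - 1 - tau_inv j" by simp
    then have "tau_inv i = tau_inv (2 * n - 1 - j)" using tau_inv_flip[OF ij(2)] by simp
    then have "tau (tau_inv i) = tau (tau_inv (2 * n - 1 - j))" by simp
    then have "i = 2 * n - 1 - j" using tau_tau_inv ij by simp
    then show "i + j + 1 = 2 * n" using ij by simp
  next
    assume "i + j + 1 = 2 * n"
    then have "i = 2 * n - 1 - j" by simp
    then show "tau_inv i + tau_inv j + 1 = 2 * n" using tau_inv_flip[OF ij(2)] tau_inv_less[OF ij(2)] by simp
  qed
  have val: "wcoef r i * wcoef r j * (- 1) ^ tau_inv j = - (pi ^ k) * (- 1) ^ j" if e: "i + j + 1 = 2 * n"
  proof -
    have pw: "pi powi (- int r) * pi ^ (r + k) = pi ^ k" "pi ^ (r + k) * pi powi (- int r) = pi ^ k"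
      by (simp_all add: power_int_minus power_add field_simps)
    consider "j < n - 1" | "j = n - 1" | "j = n" | "n < j" by linarith
    then show ?thesis
    proof cases
      case 1
      then have "wcoef r i = pi ^ (r + k)" "wcoef r j = pi powi (- int r)" "tau_inv j = j + 1"
        using e by (auto simp: wcoef_def tau_inv_def)
      then show ?thesis using pw by simp
    next
      case 2
      then have "wcoef r i = (- 1) ^ (n + 1) * pi ^ (r + k)" "wcoef r j = pi powi (- int r)" "tau_inv j = 2 * n - 1"
        using e n_ge_1 by (auto simp: wcoef_def tau_inv_def)
      moreover have "(- 1 :: 'l) ^ (n + 1) * (- 1) ^ (2 * n - 1) = - ((- 1) ^ j)"
        using 2 n_ge_1 by (auto simp: minus_one_power_iff)
      ultimately have "wcoef r i * wcoef r j * (- 1) ^ tau_inv j =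
          (- 1) ^ (n + 1) * pi ^ (r + k) * pi powi (- int r) * (- 1) ^ (2 * n - 1)"
        and sgn: "(- 1 :: 'l) ^ (n + 1) * (- 1) ^ (2 * n - 1) = - ((- 1) ^ j)" by (simp_all only:)
      moreover have "s * p * q * t = (s * t) * (p * q)" for s p q t :: 'l by (simp add: mult_ac)
      ultimately have "wcoef r i * wcoef r j * (- 1) ^ tau_inv j = - ((- 1) ^ j) * pi ^ k"
        by (simp only: sgn pw)
      then show ?thesis by simp
    next
      case 3
      then have "wcoef r i = pi powi (- int r)" "wcoef r j = (- 1) ^ (n + 1) * pi ^ (r + k)" "tau_inv j = 0"
        using e by (auto simp: wcoef_def tau_inv_def)
      then have "wcoef r i * wcoef r j * (- 1) ^ tau_inv j = (- 1) ^ (n + 1) * (pi powi (- int r) * pi ^ (r + k))"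
        by (simp only: mult_ac power_0 mult_1_right mult_1_left)
      then show ?thesis unfolding pw using 3 by simp
    next
      case 4
      then have "wcoef r i = pi powi (- int r)" "wcoef r j = pi ^ (r + k)" "tau_inv j = j - 1"
        using e by (auto simp: wcoef_def tau_inv_def)
      moreover have "(- 1 :: 'l) ^ j = - ((- 1) ^ (j - 1))" using 4 by (cases j) auto
      ultimately show ?thesis using pw by simp
    qed
  qed
  have t: "tau_inv i < 2 * n" "tau_inv j < 2 * n" using ij tau_inv_less by auto
  have "\<langle>col (w r) i, col (w r) j\<rangle> =
      wcoef r i * wcoef r j * (if tau_inv i + tau_inv j + 1 = 2 * n then (- 1) ^ tau_inv j else 0)"
    unfolding w_col[OF ij(1)] w_col[OF ij(2)] sform_unit_vec[OF t, symmetric]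
    by (simp add: sform_smult_left sform_smult_right)
  also have "\<dots> = - (pi ^ k) * (if i + j + 1 = 2 * n then (- 1) ^ j else 0)"
    using val unfolding iff by (cases "i + j + 1 = 2 * n") (simp_all only: if_True if_False mult_zero_right simp_thms)
  finally show "\<langle>col (w r) i, col (w r) j\<rangle> = - (pi ^ k) * (if i + j + 1 = 2 * n then (- 1) ^ j else 0)" .
qed simp

text \<open>w is shaped so that g w and b \<sigma>(g) agree in the first n columns. The other
  columns of g w show the vectors that precede in the recursion; starting \<open>GG\<close> at the
  signed v makes column n no exception.\<close>

lemma g_mat_w_col_upper:
  assumes v: "v \<in> CV" and j: "j < n"
  shows "col (gm r v * w r) j = F (col (gm r v) j)"
    and "col (gm r v * w r) (n + j) = pi ^ (k + r * (j + 1)) \<cdot>\<^sub>v GG v j"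
proof -
  let ?g = "gm r v"
  have col: "col (?g * w r) l = wcoef r l \<cdot>\<^sub>v (pi ^ (r * expo (tau_inv l)) \<cdot>\<^sub>v basis_vec v (tau_inv l))"
    if l: "l < 2 * n" for l
  proof -
    have "col (?g * w r) l = ?g *\<^sub>v col (w r) l" by (rule col_mult2[OF g_mat_carrier w_carrier l])
    also have "\<dots> = wcoef r l \<cdot>\<^sub>v (?g *\<^sub>v unit_vec (2 * n) (tau_inv l))"
      unfolding w_col[OF l] by (rule mult_mat_vec[OF g_mat_carrier unit_vec_carrier])
    also have "?g *\<^sub>v unit_vec (2 * n) (tau_inv l) = col ?g (tau_inv l)"
      by (rule mult_mat_unit_vec[OF g_mat_carrier tau_inv_less[OF l]])
    also have "\<dots> = pi ^ (r * expo (tau_inv l)) \<cdot>\<^sub>v basis_vec v (tau_inv l)"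
      by (rule g_mat_col[OF v tau_inv_less[OF l]])
    finally show ?thesis .
  qed
  have j2: "j < 2 * n" "n + j < 2 * n" using j by auto
  have e: "expo (tau_inv j) = j + 1" "basis_vec v (tau_inv j) = F ((F ^^ j) v)"
  proof -
    show "expo (tau_inv j) = j + 1" using j by (auto simp: expo_def tau_inv_def)
    show "basis_vec v (tau_inv j) = F ((F ^^ j) v)"
    proof (cases "j = n - 1")
      case True
      then have "Suc j = n" using j by simp
      then have "tau_inv j = 2 * n - 1" using j True by (simp add: tau_inv_def)
      then show ?thesis using basis_vec_last \<open>Suc j = n\<close> by (metis funpow.simps(2) o_apply)
    next
      case False
      then have "tau_inv j = Suc j" "Suc j < n" using j by (auto simp: tau_inv_def)
      then show ?thesis by (simp add: basis_vec_def)
    qed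
  qed
  have "pi powi (- int r) * pi ^ (r * (j + 1)) = pi ^ (r * j)"
    by (simp add: power_int_minus power_add field_simps)
  then have "col (?g * w r) j = pi ^ (r * j) \<cdot>\<^sub>v F ((F ^^ j) v)"
    unfolding col[OF j2(1)] e using j by (simp add: wcoef_def smult_smult_assoc)
  also have "\<dots> = F (col ?g j)"
    unfolding g_mat_col[OF v j2(1)] using j v by (simp add: F_smult sg_power expo_def basis_vec_def)
  finally show "col (?g * w r) j = F (col ?g j)" .
  show "col (?g * w r) (n + j) = pi ^ (k + r * (j + 1)) \<cdot>\<^sub>v GG v j"
  proof (cases j)
    case 0
    have "col (?g * w r) n = ((- 1) ^ (n + 1) * pi ^ (r + k)) \<cdot>\<^sub>v v"
      using col[OF j2(2)] 0 n_ge_1 by (simp add: wcoef_def tau_inv_def expo_def basis_vec_def smult_smult_assoc)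
    also have "\<dots> = pi ^ (k + r) \<cdot>\<^sub>v ((- 1) ^ (n + 1) \<cdot>\<^sub>v v)"
      by (simp add: smult_smult_assoc add.commute mult.commute)
    finally show ?thesis using 0 by simp
  next
    case (Suc i)
    then have "\<not> n + j = n" "\<not> n + j < n - 1" "\<not> n + j = n - 1" by linarith+
    then have "tau_inv (n + j) = n + i" using Suc by (simp add: tau_inv_def)
    moreover have "n + i < 2 * n - 1" using j Suc by linarith
    then have "basis_vec v (n + i) = GG v j" using Suc by (simp add: basis_vec_def)
    moreover have "expo (n + i) = j" using Suc by (simp add: expo_def)
    moreover have "pi ^ (r + k) * pi ^ (r * j) = pi ^ (k + r * (j + 1))" by (simp add: power_add algebra_simps)
    ultimately show ?thesis using col[OF j2(2)] Suc by (simp add: wcoef_def smult_smult_assoc)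
  qed
qed

lemma uu_fixed: "sg (\<alpha> v) = \<alpha> v \<Longrightarrow> \<alpha> v \<noteq> 0 \<Longrightarrow> uu v = 1"
  using sgi_sg[of "\<alpha> v"] by simp

text \<open>
  The upper right block of \<open>y\<close> is supported on its first row and last column, where \<open>expo j\<close> exceeds
  \<open>expo i\<close>; this is where the factor \<open>pi ^ r\<close> comes from.
\<close>

lemma frobenius_factor:
  assumes v: "v \<in> VS" and fix\<alpha>: "sg (\<alpha> v) = \<alpha> v"
  obtains y where "similitude n y 1" "fmat (gm r v) = gm r v * w r * y"
    "\<And>i j. i < 2 * n \<Longrightarrow> j < 2 * n \<Longrightarrow> \<not> (i < n \<and> n \<le> j) \<Longrightarrow> y $$ (i, j) = (if i = j then 1 else 0)"
    "\<And>i j. i < n \<Longrightarrow> n \<le> j \<Longrightarrow> j < 2 * n \<Longrightarrow> y $$ (i, j) \<in> P (int r)"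
proof -
  let ?g = "gm r v"
  let ?A = "?g * w r"
  let ?c = "- \<alpha> v * pi ^ (r * n)"
  let ?d = "?c * - (pi ^ k)"
  note vC = V_sympD(1)[OF v]
  have A: "?A \<in> carrier_mat (2 * n) (2 * n)" by (rule mult_carrier_mat[OF g_mat_carrier w_carrier])
  have sA: "similitude n ?A ?d" by (rule similitude_mult[OF g_mat_similitude[OF v] w_similitude])
  have d0: "?d \<noteq> 0" using V_sympD(3)[OF v] by simp
  \<comment> \<open>Invariance of \<alpha> gives b \<sigma>(g) and g w the same similitude factor,
    so their quotient y has factor 1.\<close>
  have sgc: "sg ?c = ?c" by (simp add: sg_mult sg_minus sg_power fix\<alpha>)
  have sf: "similitude n (fmat ?g) ?d"
    using fmat_similitude[OF g_mat_similitude[OF v, of r]] unfolding sgc by (simp only: mult.commute)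
  define y where "y = symp_inv n ?d ?A * fmat ?g"
  have y: "y \<in> carrier_mat (2 * n) (2 * n)" unfolding y_def by (rule mult_carrier_mat[OF symp_inv_carrier fmat_carrier[OF g_mat_carrier]])
  have sy: "similitude n y 1"
    using similitude_mult[OF similitude_symp_inv[OF sA d0] sf] d0 by (simp add: y_def)
  have eq: "fmat ?g = ?A * y"
  proof -
    have "?A * y = ?A * symp_inv n ?d ?A * fmat ?g"
      unfolding y_def by (rule assoc_mult_mat[symmetric, OF A symp_inv_carrier fmat_carrier[OF g_mat_carrier]])
    also have "\<dots> = fmat ?g"
      unfolding symp_inv(2)[OF sA d0] by (rule left_mult_one_mat[OF fmat_carrier[OF g_mat_carrier]])
    finally show ?thesis by simp
  qed
  have idx: "y $$ (i, j) = (- 1) ^ i * \<langle>col ?A (2 * n - 1 - i), F (col ?g j)\<rangle> / ?d" if ij: "i < 2 * n" "j < 2 * n" for i j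
  proof -
    have "y $$ (i, j) = (symp_inv n ?d ?A *\<^sub>v col (fmat ?g) j) $ i"
      unfolding y_def using ij carrier_matD[OF symp_inv_carrier[of n ?d ?A]] carrier_matD[OF fmat_carrier[OF g_mat_carrier[of r v]]]
      by (simp only: index_mult_mat index_mult_mat_vec)
    also have "\<dots> = (- 1) ^ i * \<langle>col ?A (2 * n - 1 - i), col (fmat ?g) j\<rangle> / ?d"
      by (rule symp_inv_mult_vec[OF A col_carrier_vec[OF ij(2) fmat_carrier[OF g_mat_carrier]] ij(1)])
    finally show ?thesis unfolding fmat_col[OF g_mat_carrier ij(2)] .
  qed
  have gram: "(- 1) ^ i * (d * (if (2 * n - 1 - i) + j + 1 = 2 * n then (- 1) ^ j else 0)) / d = (if i = j then 1 else 0)"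
    if "i < 2 * n" "d \<noteq> 0" for i j and d :: 'l
  proof -
    have "(2 * n - 1 - i) + j + 1 = 2 * n \<longleftrightarrow> i = j" using that by auto
    moreover have "(- 1) ^ j * (d * (- 1) ^ j) / d = 1"
      using that by (simp add: mult.left_commute[of "(- 1) ^ j"] flip: power_add)
    ultimately show ?thesis by (cases "i = j") simp_all
  qed
  have left: "y $$ (i, j) = (if i = j then 1 else 0)" if ij: "i < 2 * n" "j < n" for i j
  proof -
    have i': "2 * n - 1 - i < 2 * n" "j < 2 * n" using ij by auto
    have "\<langle>col ?A (2 * n - 1 - i), col ?A j\<rangle> = ?d * (if (2 * n - 1 - i) + j + 1 = 2 * n then (- 1) ^ j else 0)"
      using sA i' unfolding similitude_iff_col by blast
    then show ?thesis unfolding idx[OF ij(1) i'(2)] g_mat_w_col_upper(1)[OF vC ij(2), symmetric]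
      using gram[OF ij(1) d0] by simp
  qed
  \<comment> \<open>Row i of y consists of pairings with the mirror column of g w. For i at least n
    that column is in the first half, where it is a column of b \<sigma>(g), and the Gram matrix of
    the latter decides.\<close>
  have lower: "y $$ (i, j) = (if i = j then 1 else 0)" if ij: "n \<le> i" "i < 2 * n" "j < 2 * n" for i j
  proof -
    have i': "2 * n - 1 - i < 2 * n" "2 * n - 1 - i < n" using ij by auto
    have "\<langle>col (fmat ?g) (2 * n - 1 - i), col (fmat ?g) j\<rangle> = ?d * (if (2 * n - 1 - i) + j + 1 = 2 * n then (- 1) ^ j else 0)"
      using sf i' ij unfolding similitude_iff_col by blast
    then have "\<langle>F (col ?g (2 * n - 1 - i)), F (col ?g j)\<rangle> = ?d * (if (2 * n - 1 - i) + j + 1 = 2 * n then (- 1) ^ j else 0)"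
      unfolding fmat_col[OF g_mat_carrier i'(1)] fmat_col[OF g_mat_carrier ij(3)] .
    then show ?thesis unfolding idx[OF ij(2,3)] g_mat_w_col_upper(1)[OF vC i'(2)]
      using gram[OF ij(2) d0] by simp
  qed
  have block: "y $$ (i, j) \<in> P (int r)" if ij: "i < n" "n \<le> j" "j < 2 * n" for i j
  proof -
    have i: "i < 2 * n" using ij by simp
    define a where "a = n - 1 - i"
    have a: "a < n" "2 * n - 1 - i = n + a" using ij by (auto simp: a_def)
    define q where "q = \<langle>GG v a, F (basis_vec v j)\<rangle> / \<alpha> v"
    have "\<langle>GG v a, F (basis_vec v j)\<rangle> \<in> P (ordL D (\<alpha> v)) \<and> (\<langle>GG v a, F (basis_vec v j)\<rangle> = 0 \<or> i < expo j)"
    proof (cases "j = 2 * n - 1")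
      case True
      then show ?thesis using GG_form_integral[OF v, of a "Suc n"] ij basis_vec_last n_ge_1
        by (auto simp: expo_def)
    next
      case False
      define b where "b = j - n"
      have b: "b < n" "basis_vec v j = GG v (Suc b)" "expo j = Suc b"
        using False ij by (auto simp: b_def basis_vec_def expo_def)
      have "\<langle>GG v a, F (basis_vec v j)\<rangle> = pi ^ k * \<langle>GG v a, GG v b\<rangle> - sg (cc v b) * \<langle>GG v a, F v\<rangle>"
        unfolding b(2) F_GG_Suc[OF vC] uu_fixed[OF fix\<alpha> V_sympD(3)[OF v]]
        using vC by (simp add: sform_bilinear)
      also have "\<dots> = - sg (cc v b) * \<langle>GG v a, (F ^^ 1) v\<rangle>" using GG_form_GG[OF v a(1) b(1)] by simp
      finally have fe: "\<langle>GG v a, F (basis_vec v j)\<rangle> = - sg (cc v b) * \<langle>GG v a, (F ^^ 1) v\<rangle>" .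
      \<comment> \<open>Before the last column only a multiple of F v survives, and it pairs with
        \<open>GG v a\<close> only for a = n - 1, that is, in the first row.\<close>
      have "\<langle>GG v a, (F ^^ 1) v\<rangle> = 0 \<or> i = 0"
        using GG_form_F[OF v a(1), of 1] n_ge_1 ij by (auto simp: a_def)
      moreover have "- sg (cc v b) * \<langle>GG v a, (F ^^ 1) v\<rangle> \<in> P (ordL D (\<alpha> v))"
        using cc_integral[OF v, of b] by (intro ppow_mult_left GG_form_integral[OF v]) simp
      ultimately show ?thesis unfolding fe b(3) by auto
    qed
    then have q: "q \<in> P 0" "q = 0 \<or> i < expo j"
      unfolding q_def using V_sympD(3)[OF v] by (auto intro!: ppow_divide)
    have "col ?A (2 * n - 1 - i) = pi ^ (k + r * (a + 1)) \<cdot>\<^sub>v GG v a"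
      unfolding a(2) by (rule g_mat_w_col_upper(2)[OF vC a(1)])
    then have "y $$ (i, j) = (- 1) ^ i * (pi ^ (k + r * (a + 1)) * (pi ^ (r * expo j) * (\<alpha> v * q))) / ?d"
      unfolding idx[OF i ij(3)] g_mat_col[OF vC ij(3)] using vC V_sympD(3)[OF v]
      by (simp add: F_smult sg_power sform_bilinear q_def)
    moreover have "pi ^ k * (pi ^ (r * i) * pi ^ (r * (a + 1))) = pi ^ (r * n) * pi ^ k"
    proof -
      have "i + (a + 1) = n" using ij by (simp add: a_def)
      then have "pi ^ (r * n) = pi ^ (r * i) * pi ^ (r * (a + 1))" by (metis distrib_left power_add)
      then show ?thesis by simp
    qed
    ultimately have e: "pi ^ (r * i) * y $$ (i, j) = (- 1) ^ i * (pi ^ (r * expo j) * q)"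
    proof -
      assume 1: "y $$ (i, j) = (- 1) ^ i * (pi ^ (k + r * (a + 1)) * (pi ^ (r * expo j) * (\<alpha> v * q))) / ?d"
        and 2: "pi ^ k * (pi ^ (r * i) * pi ^ (r * (a + 1))) = pi ^ (r * n) * pi ^ k"
      have "pi ^ (r * i) * y $$ (i, j) =
        (- 1) ^ i * ((pi ^ k * (pi ^ (r * i) * pi ^ (r * (a + 1)))) * (pi ^ (r * expo j) * (\<alpha> v * q))) / ?d"
        unfolding 1 power_add[of pi k] times_divide_eq_right by (simp only: mult_ac)
      also have "\<dots> = (- 1) ^ i * (pi ^ (r * expo j) * q) * ((pi ^ (r * n) * pi ^ k * \<alpha> v) / ?d)"
        unfolding 2 times_divide_eq_right by (simp only: mult_ac)
      also have "(pi ^ (r * n) * pi ^ k * \<alpha> v) / ?d = 1" using d0 by (simp add: mult_ac)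
      finally show ?thesis by simp
    qed
    show ?thesis
    proof (cases "q = 0")
      case True
      then show ?thesis using e by simp
    next
      case False
      then have "i < expo j" using q by simp
      then have "pi ^ (r * expo j) = pi ^ (r * i) * pi ^ (r * (expo j - i))" by (simp flip: power_add distrib_left)
      with e have "pi ^ (r * i) * y $$ (i, j) = pi ^ (r * i) * ((- 1) ^ i * (pi ^ (r * (expo j - i)) * q))"
        by (simp only: mult_ac)
      then have "y $$ (i, j) = (- 1) ^ i * (pi ^ (r * (expo j - i)) * q)" by simp
      moreover have "pi ^ (r * (expo j - i)) * q \<in> P (int r)"
      proof (rule ppow_mono[OF pi_power_mult_ppow[OF q(1)]])
        have "r * 1 \<le> r * (expo j - i)" using \<open>i < expo j\<close> by (intro mult_le_mono2) simp
        then show "int r \<le> 0 + int (r * (expo j - i))" by linarith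
      qed
      ultimately show ?thesis by (simp only: ppow_sign_iff)
    qed
  qed
  show thesis
  proof (rule that[OF sy eq])
    show "y $$ (i, j) = (if i = j then 1 else 0)" if "i < 2 * n" "j < 2 * n" "\<not> (i < n \<and> n \<le> j)" for i j
      using left[of i j] lower[of i j] that by (cases "j < n") auto
  qed (use block in auto)
qed

text \<open>The factorization gives g^(-1) b \<sigma>(g) = w y, so the left factor in the double
  coset is the identity.\<close>

lemma adlvI:
  assumes v: "v \<in> VS" and y: "y \<in> H" and H: "matrix_group (2 * n) H"
    and eq: "fmat (gm r v) = gm r v * w r * y"
  shows "lcoset (gm r v) H \<in> adlv D n k H (w r)"
proof -
  let ?g = "gm r v"
  let ?c = "- \<alpha> v * pi ^ (r * n)"
  let ?h = "symp_inv n ?c ?g"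
  have yC: "y \<in> carrier_mat (2 * n) (2 * n)" using y H by (auto simp: matrix_group_def)
  note inv = symp_inv[OF g_mat_similitude[OF v] g_mat_similitude_nonzero[OF v], of r]
  have "the (mat_inverse ?g) = ?h" by (rule mat_inverse_eq[OF g_mat_carrier symp_inv_carrier inv(2,1)])
  then have "the (mat_inverse ?g) * b_mat D n k * map_mat sg ?g = ?h * b_mat D n k * map_mat sg ?g" by simp
  also have "\<dots> = ?h * fmat ?g"
  proof (rule assoc_mult_mat[OF symp_inv_carrier b_mat_carrier])
    show "map_mat sg ?g \<in> carrier_mat (2 * n) (2 * n)" by simp
  qed
  also have "\<dots> = ?h * (?g * (w r * y))"
    unfolding eq by (simp only: assoc_mult_mat[OF g_mat_carrier w_carrier yC])
  also have "\<dots> = (?h * ?g) * (w r * y)"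
    by (rule assoc_mult_mat[symmetric, OF symp_inv_carrier g_mat_carrier mult_carrier_mat[OF w_carrier yC]])
  also have "\<dots> = w r * y" unfolding inv(1) by (rule left_mult_one_mat[OF mult_carrier_mat[OF w_carrier yC]])
  also have "\<dots> = 1\<^sub>m (2 * n) * w r * y" by (simp only: left_mult_one_mat[OF w_carrier])
  finally show ?thesis using g_mat_GSp[OF v] y H unfolding adlv_def matrix_group_def by blast
qed

text \<open>The exceptional block of y lies in p^r, hence in p^(m+1) because r > m.\<close>

lemma g_mat_X_dot:
  assumes v: "v \<in> VS" and fix\<alpha>: "sg (\<alpha> v) = \<alpha> v" and rm: "m < r"
  shows "gI r m v \<in> X_dot D n k r m"
proof -
  obtain y where y: "similitude n y 1" "fmat (gm r v) = gm r v * w r * y"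
    "\<And>i j. i < 2 * n \<Longrightarrow> j < 2 * n \<Longrightarrow> \<not> (i < n \<and> n \<le> j) \<Longrightarrow> y $$ (i, j) = (if i = j then 1 else 0)"
    "\<And>i j. i < n \<Longrightarrow> n \<le> j \<Longrightarrow> j < 2 * n \<Longrightarrow> y $$ (i, j) \<in> P (int r)"
    using frobenius_factor[OF v fix\<alpha>] by metis
  have "y \<in> Idot m"
  proof (rule I_dotI)
    show "y \<in> GSp n" unfolding GSp_iff using y(1) by (intro exI[of _ 1]) simp
    show "y $$ (i, i) - 1 \<in> P (int m + 1)" if "i < 2 * n" for i using y(3)[OF that that] by auto
    show "y $$ (i, j) \<in> P (int m + 1)" if ij: "i < j" "j < 2 * n" for i j
    proof (cases "i < n \<and> n \<le> j")
      case True
      then show ?thesis using ppow_mono[OF y(4)[of i j], of "int m + 1"] ij rm by simp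
    next
      case False
      then show ?thesis using y(3)[of i j] ij by simp
    qed
    show "y $$ (i, j) \<in> P (int m)" if "j < i" "i < 2 * n" for i j using y(3)[of i j] that by auto
  qed
  then show ?thesis unfolding X_dot_def by (rule adlvI[OF v _ I_dot_group y(2)])
qed

section \<open>The unipotent group and \<open>X_U\<close>\<close>

abbreviation U :: "'l mat set" where "U \<equiv> U_unip n"

lemma U_similitude:
  assumes g: "g \<in> U"
  shows "similitude n g 1"
proof -
  obtain c where c: "similitude n g c" using g by (auto simp: U_unip_def GSp_iff)
  note C = similitude_carrier[OF c]
  have i: "0 < 2 * n" "2 * n - 1 < 2 * n" "0 + (2 * n - 1) + 1 = 2 * n" "odd (2 * n - 1)" using n_ge_1 by auto
  have "\<langle>col g 0, col g (2 * n - 1)\<rangle> = c * (if 0 + (2 * n - 1) + 1 = 2 * n then (- 1) ^ (2 * n - 1) else 0)"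
    using c i unfolding similitude_iff_col by blast
  then have "- c = \<langle>col g 0, col g (2 * n - 1)\<rangle>" using i by simp
  also have "\<dots> = (\<Sum>l<2 * n. (- 1) ^ (l + 1) * g $$ (l, 0) * g $$ (2 * n - 1 - l, 2 * n - 1))"
    unfolding sform_sum[OF col_carrier_vec[OF i(1) C] col_carrier_vec[OF i(2) C]] using C i by (intro sum.cong) auto
  also have "\<dots> = (\<Sum>l<2 * n. if l = 0 then - 1 else 0)"
    using g i by (intro sum.cong) (auto simp: U_unip_def)
  finally have "c = 1" using i by simp
  then show ?thesis using c by simp
qed

lemma U_I: "similitude n g 1 \<Longrightarrow> (\<And>i. i < 2 * n \<Longrightarrow> g $$ (i, i) = 1) \<Longrightarrow>
    (\<And>i j. j < i \<Longrightarrow> i < 2 * n \<Longrightarrow> g $$ (i, j) = 0) \<Longrightarrow> g \<in> U"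
  unfolding U_unip_def GSp_iff by (auto intro!: exI[of _ 1])

lemma U_D: "g \<in> U \<Longrightarrow> i < 2 * n \<Longrightarrow> g $$ (i, i) = 1" "g \<in> U \<Longrightarrow> j < i \<Longrightarrow> i < 2 * n \<Longrightarrow> g $$ (i, j) = 0"
  "g \<in> U \<Longrightarrow> g \<in> carrier_mat (2 * n) (2 * n)"
  by (auto simp: U_unip_def GSp_def)

lemma U_mult:
  assumes g: "g \<in> U" and h: "h \<in> U"
  shows "g * h \<in> U"
proof (rule U_I)
  show "similitude n (g * h) 1" using similitude_mult[OF U_similitude[OF g] U_similitude[OF h]] by simp
  have gh: "(g * h) $$ (i, j) = (\<Sum>l<2 * n. if l = i \<and> i = j then 1 else 0)" if "j \<le> i" "i < 2 * n" for i j
  proof (subst mat_mult_index[OF U_D(3)[OF g] U_D(3)[OF h]])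
    show "(\<Sum>l<2 * n. g $$ (i, l) * h $$ (l, j)) = (\<Sum>l<2 * n. if l = i \<and> i = j then 1 else 0)"
    proof (intro sum.cong refl)
      fix l assume "l \<in> {..<2 * n}"
      moreover consider "l < i" | "j < l" "i \<le> l" | "l = i" "j = i" using \<open>j \<le> i\<close> by linarith
      ultimately show "g $$ (i, l) * h $$ (l, j) = (if l = i \<and> i = j then 1 else 0)"
        using that U_D(1)[OF g, of i] U_D(1)[OF h, of j] U_D(2)[OF g, of l i] U_D(2)[OF h, of j l]
        by cases auto
    qed
  qed (use that in auto)
  show "(g * h) $$ (i, i) = 1" if "i < 2 * n" for i using gh[of i i] that by simp
  show "(g * h) $$ (i, j) = 0" if "j < i" "i < 2 * n" for i j using gh[of j i] that by simp
qed

lemma U_group: "matrix_group (2 * n) U"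
  unfolding matrix_group_def
proof (intro conjI ballI subsetI)
  show "1\<^sub>m (2 * n) \<in> U" by (rule U_I) (auto simp: similitude_one)
  fix g assume g: "g \<in> U"
  note s = U_similitude[OF g]
  have "symp_inv n 1 g \<in> U"
  proof (rule U_I)
    show "similitude n (symp_inv n 1 g) 1" using similitude_symp_inv[OF s] by simp
    show "symp_inv n 1 g $$ (i, i) = 1" if "i < 2 * n" for i
      using that U_D(1)[OF g, of "2 * n - 1 - i"] by (simp add: symp_inv_def)
    show "symp_inv n 1 g $$ (i, j) = 0" if "j < i" "i < 2 * n" for i j
      using that U_D(2)[OF g, of "2 * n - 1 - i" "2 * n - 1 - j"] by (simp add: symp_inv_def)
  qed
  then show "\<exists>h\<in>U. g * h = 1\<^sub>m (2 * n)" using symp_inv(2)[OF s] by (intro bexI) auto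
qed (auto intro: U_mult U_D(3))

lemma U_map_sg:
  assumes g: "g \<in> U"
  shows "map_mat sg g \<in> U"
proof (rule U_I)
  note C = U_D(3)[OF g]
  show "similitude n (map_mat sg g) 1"
    unfolding similitude_iff_col
  proof (intro conjI allI impI)
    fix i j assume ij: "i < 2 * n" "j < 2 * n"
    have cols: "col g i \<in> CV" "col g j \<in> CV" "col (map_mat sg g) i \<in> CV" "col (map_mat sg g) j \<in> CV"
      using C ij by (auto intro!: col_carrier_vec[of _ "2 * n"])
    have "\<langle>col (map_mat sg g) i, col (map_mat sg g) j\<rangle> = sg \<langle>col g i, col g j\<rangle>"
      unfolding sform_sum[OF cols(1,2)] sform_sum[OF cols(3,4)] using C ij
      by (simp add: sg_sum sg_mult sg_minus sg_power)
    also have "\<langle>col g i, col g j\<rangle> = 1 * (if i + j + 1 = 2 * n then (- 1) ^ j else 0)"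
      using U_similitude[OF g] ij unfolding similitude_iff_col by blast
    finally show "\<langle>col (map_mat sg g) i, col (map_mat sg g) j\<rangle> = 1 * (if i + j + 1 = 2 * n then (- 1) ^ j else 0)"
      by (simp add: sg_power sg_minus)
  qed (use C in auto)
qed (use U_D[OF g] in auto)

lemma g_mat_X_U:
  assumes v: "v \<in> VS" and fix\<alpha>: "sg (\<alpha> v) = \<alpha> v"
  shows "lcoset (g0 v) U \<in> X_U D n k"
proof -
  obtain y where y: "similitude n y 1" "fmat (g0 v) = g0 v * w 0 * y"
    "\<And>i j. i < 2 * n \<Longrightarrow> j < 2 * n \<Longrightarrow> \<not> (i < n \<and> n \<le> j) \<Longrightarrow> y $$ (i, j) = (if i = j then 1 else 0)"
    using frobenius_factor[OF v fix\<alpha>] by metis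
  have "y \<in> U" by (rule U_I[OF y(1)]) (use y(3) in auto)
  then show ?thesis unfolding X_U_def by (rule adlvI[OF v _ U_group y(2)])
qed

text \<open>Right multiplication by a unipotent upper triangular matrix leaves the first column
  unchanged.\<close>

lemma g0_U_inj:
  assumes u: "u \<in> VS" and v: "v \<in> VS" and eq: "lcoset (g0 u) U = lcoset (g0 v) U"
  shows "u = v"
proof -
  have pos: "0 < 2 * n" using n_ge_1 by simp
  have b0: "basis_vec x 0 = x" for x using n_ge_1 by (simp add: basis_vec_def)
  obtain h where h: "h \<in> U" "g0 u = g0 v * h" using lcoset_eqD[OF U_group g_mat_carrier eq] by blast
  have "col h 0 = unit_vec (2 * n) 0"
    using U_D[OF h(1)] pos by (intro eq_vecI) (auto simp: unit_vec_def)
  then have "col (g0 v * h) 0 = g0 v *\<^sub>v unit_vec (2 * n) 0"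
    using col_mult2[OF g_mat_carrier U_D(3)[OF h(1)] pos] by simp
  also have "\<dots> = v" using mult_mat_unit_vec[OF g_mat_carrier pos] V_sympD(1)[OF v] pos by (simp add: b0)
  finally show ?thesis using h(2) V_sympD(1)[OF u] pos by (metis b0 g0_col)
qed

text \<open>A similitude with factor 1 is determined in its last columns by duality with its first ones.\<close>

lemma U_from_upper_half:
  assumes s: "similitude n Z 1"
    and one: "\<And>j. j < n \<Longrightarrow> Z $$ (j, j) = 1" and zero: "\<And>i j. j < n \<Longrightarrow> j < i \<Longrightarrow> i < 2 * n \<Longrightarrow> Z $$ (i, j) = 0"
  shows "Z \<in> U"
proof -
  note C = similitude_carrier[OF s]
  \<comment> \<open>The pairing with column a isolates row 2n - 1 - a: entries of column a below the
    diagonal vanish, and the rows further down are known by induction.\<close>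
  have right: "a < n \<Longrightarrow> j \<le> 2 * n - 1 - a \<Longrightarrow> n \<le> j \<Longrightarrow> Z $$ (2 * n - 1 - a, j) = (if j = 2 * n - 1 - a then 1 else 0)" for a j
  proof (induction a rule: less_induct)
    case (less a)
    have aj: "a < 2 * n" "j < 2 * n" using less.prems by auto
    have "\<langle>col Z a, col Z j\<rangle> = 1 * (if a + j + 1 = 2 * n then (- 1) ^ j else 0)"
      using s aj unfolding similitude_iff_col by blast
    moreover have "\<langle>col Z a, col Z j\<rangle> = (\<Sum>l<2 * n. (- 1) ^ (l + 1) * Z $$ (l, a) * Z $$ (2 * n - 1 - l, j))"
      unfolding sform_sum[OF col_carrier_vec[OF aj(1) C] col_carrier_vec[OF aj(2) C]] using C aj by (intro sum.cong) auto
    also have "\<dots> = (\<Sum>l<2 * n. if l = a then (- 1) ^ (a + 1) * Z $$ (2 * n - 1 - a, j) else 0)"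
    proof (intro sum.cong refl)
      fix l assume l: "l \<in> {..<2 * n}"
      consider "l = a" | "a < l" | "l < a" by linarith
      then show "(- 1) ^ (l + 1) * Z $$ (l, a) * Z $$ (2 * n - 1 - l, j) =
        (if l = a then (- 1) ^ (a + 1) * Z $$ (2 * n - 1 - a, j) else 0)"
      proof cases
        case 3
        then show ?thesis using less.IH[of l] less.prems by auto
      qed (use one zero less.prems l in auto)
    qed
    ultimately have "(- 1) ^ (a + 1) * Z $$ (2 * n - 1 - a, j) = (if a + j + 1 = 2 * n then (- 1) ^ j else 0)"
      using aj by simp
    moreover have "a + j + 1 = 2 * n \<longleftrightarrow> j = 2 * n - 1 - a" using less.prems by auto
    moreover have "a + j + 1 = 2 * n \<Longrightarrow> (- 1 :: 'l) ^ j = (- 1) ^ (a + 1)"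
      by (auto simp: minus_one_power_iff) presburger+
    ultimately show ?case by (auto split: if_splits)
  qed
  show ?thesis
  proof (rule U_I[OF s])
    show "Z $$ (i, i) = 1" if "i < 2 * n" for i
      using one[of i] right[of "2 * n - 1 - i" i] that by (cases "i < n") auto
    show "Z $$ (i, j) = 0" if "j < i" "i < 2 * n" for i j
      using zero[of j i] right[of "2 * n - 1 - i" j] that by (cases "j < n") auto
  qed
qed

lemma w_mult_vec_index:
  assumes p: "p \<in> CV" and i: "i < 2 * n"
  shows "(w r *\<^sub>v p) $ i = wcoef r (tau i) * p $ tau i"
proof -
  have "(w r *\<^sub>v p) $ i = (\<Sum>l<2 * n. w r $$ (i, l) * p $ l)" by (rule mult_mat_vec_index[OF w_carrier p i])
  also have "\<dots> = (\<Sum>l<2 * n. if l = tau i then wcoef r l * p $ l else 0)"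
  proof (intro sum.cong refl)
    fix l assume "l \<in> {..<2 * n}"
    then have l: "l < 2 * n" by simp
    have "w r $$ (i, l) = col (w r) l $ i" using l i carrier_matD[OF w_carrier[of r]] by simp
    then have "w r $$ (i, l) = (if i = tau_inv l then wcoef r l else 0)"
      unfolding w_col[OF l] using i tau_inv_less[OF l] by (simp add: unit_vec_def)
    moreover have "i = tau_inv l \<longleftrightarrow> l = tau i" using tau_inv_tau[OF i] tau_tau_inv[OF l] by auto
    ultimately show "w r $$ (i, l) * p $ l = (if l = tau i then wcoef r l * p $ l else 0)" by simp
  qed
  finally show ?thesis using tau_less[OF i] by simp
qed

text \<open>Absorbing x into g gives h with b \<sigma>(h) = h w z and z in U. In the coordinates of
  h, \<open>F\<close> is therefore \<sigma> followed by a unipotent matrix and by w, so the last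
  nonzero coordinate of F^j v, for v the first column of h, is a 1 at position j as long as j < n.
  This yields both the orthogonality relations and the first n columns of the change of basis from h
  to \<open>g0 v\<close>.\<close>

lemma X_U_surj:
  assumes C: "C \<in> X_U D n k"
  shows "\<exists>v\<in>VS. sg (\<alpha> v) = \<alpha> v \<and> C = lcoset (g0 v) U"
proof -
  obtain g x y where g: "g \<in> GSp n" "C = lcoset g U" and xy: "x \<in> U" "y \<in> U"
    and eq: "the (mat_inverse g) * b_mat D n k * map_mat sg g = x * w 0 * y"
    using C unfolding X_U_def adlv_def by blast
  obtain c where c: "c \<noteq> 0" "similitude n g c" using g(1) by (auto simp: GSp_iff)
  note gC = similitude_carrier[OF c(2)] and xC = U_D(3)[OF xy(1)] and yC = U_D(3)[OF xy(2)]
  have ginv: "the (mat_inverse g) = symp_inv n c g"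
    by (rule mat_inverse_eq[OF gC symp_inv_carrier symp_inv(2,1)[OF c(2,1)]])
  define h where "h = g * x"
  define z where "z = y * map_mat sg x"
  have zU: "z \<in> U" unfolding z_def by (rule U_mult[OF xy(2) U_map_sg[OF xy(1)]])
  note zC = U_D(3)[OF zU]
  have sh: "similitude n h c" using similitude_mult[OF c(2) U_similitude[OF xy(1)]] by (simp add: h_def)
  note hC = similitude_carrier[OF sh]
  have sx: "map_mat sg x \<in> carrier_mat (2 * n) (2 * n)" "map_mat sg g \<in> carrier_mat (2 * n) (2 * n)"
    using xC gC by auto
  have fg: "fmat g = g * (x * w 0 * y)"
  proof -
    have "g * (x * w 0 * y) = g * (symp_inv n c g * fmat g)"
      unfolding eq[symmetric] ginv by (simp only: assoc_mult_mat[OF symp_inv_carrier b_mat_carrier sx(2)])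
    also have "\<dots> = (g * symp_inv n c g) * fmat g"
      by (rule assoc_mult_mat[symmetric, OF gC symp_inv_carrier fmat_carrier[OF gC]])
    also have "\<dots> = fmat g"
      unfolding symp_inv(2)[OF c(2,1)] by (rule left_mult_one_mat[OF fmat_carrier[OF gC]])
    finally show ?thesis by simp
  qed
  have "map_mat sg h = map_mat sg g * map_mat sg x"
    unfolding h_def
  proof (rule eq_matI)
    fix i j assume "i < dim_row (map_mat sg g * map_mat sg x)" "j < dim_col (map_mat sg g * map_mat sg x)"
    then have ij: "i < 2 * n" "j < 2 * n" using gC xC by auto
    have "map_mat sg (g * x) $$ (i, j) = sg ((g * x) $$ (i, j))" using ij gC xC by simp
    also have "\<dots> = (\<Sum>l<2 * n. map_mat sg g $$ (i, l) * map_mat sg x $$ (l, j))"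
      unfolding mat_mult_index[OF gC xC ij] using ij gC xC by (simp add: sg_sum sg_mult)
    also have "\<dots> = (map_mat sg g * map_mat sg x) $$ (i, j)" by (rule mat_mult_index[symmetric, OF sx(2,1) ij])
    finally show "map_mat sg (g * x) $$ (i, j) = (map_mat sg g * map_mat sg x) $$ (i, j)" .
  qed (use gC xC in auto)
  then have "fmat h = fmat g * map_mat sg x"
    by (simp only: assoc_mult_mat[OF b_mat_carrier sx(2,1)])
  also have "\<dots> = g * (x * (w 0 * (y * map_mat sg x)))"
    unfolding fg using gC xC yC sx w_carrier[of 0]
    by (simp add: assoc_mult_mat[of _ "2 * n" "2 * n" _ "2 * n" _ "2 * n"] del: w_carrier)
  also have "\<dots> = h * (w 0 * z)"
    unfolding h_def z_def by (rule assoc_mult_mat[symmetric, OF gC xC]) (use yC sx in \<open>auto intro!: mult_carrier_mat\<close>)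
  finally have fh: "fmat h = h * (w 0 * z)" .
  have wzC: "w 0 * z \<in> carrier_mat (2 * n) (2 * n)" by (rule mult_carrier_mat[OF w_carrier zC])
  have "similitude n (fmat h) (c * (- (pi ^ k) * 1))"
    unfolding fh by (intro similitude_mult sh w_similitude U_similitude zU)
  \<comment> \<open>Comparing similitude factors shows that c is fixed by \<sigma>; since \<alpha> v
    turns out to be -c, this puts \<alpha> v in K.\<close>
  then have "- (pi ^ k) * sg c = c * (- (pi ^ k) * 1)"
    by (rule similitude_unique[OF fmat_similitude[OF sh] _ n_ge_1])
  then have sgc: "sg c = c" by simp
  have pos: "0 < 2 * n" using n_ge_1 by simp
  define v where "v = col h 0"
  have vC: "v \<in> CV" unfolding v_def by (rule col_carrier_vec[OF pos hC])
  have F_h: "F (h *\<^sub>v p) = h *\<^sub>v (w 0 *\<^sub>v (z *\<^sub>v map_vec sg p))" if p: "p \<in> CV" for p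
  proof -
    have mp: "map_vec sg p \<in> CV" using p by simp
    have "F (h *\<^sub>v p) = fmat h *\<^sub>v map_vec sg p"
    proof (rule eq_vecI)
      fix i assume "i < dim_vec (fmat h *\<^sub>v map_vec sg p)"
      then have i: "i < 2 * n" using carrier_matD[OF fmat_carrier[OF hC]] by simp
      have "F (h *\<^sub>v p) $ i = (\<Sum>l<2 * n. F (col h l) $ i * sg (p $ l))" by (rule F_mult_mat_vec[OF hC p i])
      also have "\<dots> = (\<Sum>l<2 * n. fmat h $$ (i, l) * map_vec sg p $ l)"
      proof (intro sum.cong refl)
        fix l assume "l \<in> {..<2 * n}"
        then have l: "l < 2 * n" by simp
        have "fmat h $$ (i, l) = col (fmat h) l $ i" using i l carrier_matD[OF fmat_carrier[OF hC]] by simp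
        then show "F (col h l) $ i * sg (p $ l) = fmat h $$ (i, l) * map_vec sg p $ l"
          unfolding fmat_col[OF hC l] using l p by simp
      qed
      also have "\<dots> = (fmat h *\<^sub>v map_vec sg p) $ i"
        by (rule mult_mat_vec_index[symmetric, OF fmat_carrier[OF hC] mp i])
      finally show "F (h *\<^sub>v p) $ i = (fmat h *\<^sub>v map_vec sg p) $ i" .
    qed (use carrier_matD[OF fmat_carrier[OF hC]] in simp)
    also have "\<dots> = h *\<^sub>v (w 0 * z *\<^sub>v map_vec sg p)"
      unfolding fh by (rule assoc_mult_mat_vec[OF hC wzC mp])
    also have "w 0 * z *\<^sub>v map_vec sg p = w 0 *\<^sub>v (z *\<^sub>v map_vec sg p)"
      by (rule assoc_mult_mat_vec[OF w_carrier zC mp])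
    finally show ?thesis .
  qed
  have z_lead: "(z *\<^sub>v map_vec sg p) $ i = (if i = j then sg (p $ j) else 0)"
    if p: "p \<in> CV" "\<And>l. j < l \<Longrightarrow> l < 2 * n \<Longrightarrow> p $ l = 0" and i: "j \<le> i" "i < 2 * n" for p i j
  proof -
    have mp: "map_vec sg p \<in> CV" using p by simp
    have "(z *\<^sub>v map_vec sg p) $ i = (\<Sum>l<2 * n. z $$ (i, l) * map_vec sg p $ l)"
      by (rule mult_mat_vec_index[OF zC mp i(2)])
    also have "\<dots> = (\<Sum>l<2 * n. if l = i then if i = j then sg (p $ j) else 0 else 0)"
    proof (intro sum.cong refl)
      fix l assume l: "l \<in> {..<2 * n}"
      consider "l < i" | "j < l" "i \<le> l" | "l = i" "j = i" using i by linarith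
      then show "z $$ (i, l) * map_vec sg p $ l = (if l = i then if i = j then sg (p $ j) else 0 else 0)"
        using l i p U_D(1)[OF zU i(2)] U_D(2)[OF zU, of l i] by cases auto
    qed
    finally show ?thesis using i by simp
  qed
  \<comment> \<open>z keeps a leading 1 in place, and w moves it from j to j + 1 within the first
    half and from n - 1 to the last position, because \<open>tau\<close> sends j + 1 to j and 2n - 1
    to n - 1.\<close>
  have step: "\<exists>q\<in>CV. F (h *\<^sub>v p) = h *\<^sub>v q \<and> (j + 1 < n \<longrightarrow> q $ (j + 1) = 1 \<and> (\<forall>i. j + 1 < i \<and> i < 2 * n \<longrightarrow> q $ i = 0)) \<and>
      (j + 1 = n \<longrightarrow> q $ (2 * n - 1) = 1)"
    if p: "p \<in> CV" "p $ j = 1" "\<And>l. j < l \<Longrightarrow> l < 2 * n \<Longrightarrow> p $ l = 0" and j: "j < n" for p j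
  proof (intro bexI[of _ "w 0 *\<^sub>v (z *\<^sub>v map_vec sg p)"] conjI impI allI)
    let ?p = "z *\<^sub>v map_vec sg p"
    have pC: "?p \<in> CV" using p by (intro mult_mat_vec_carrier[OF zC]) simp
    have lead: "?p $ i = (if i = j then 1 else 0)" if "j \<le> i" "i < 2 * n" for i
      using z_lead[OF p(1,3) that] p(2) by simp
    show "F (h *\<^sub>v p) = h *\<^sub>v (w 0 *\<^sub>v ?p)" by (rule F_h[OF p(1)])
    show "w 0 *\<^sub>v ?p \<in> CV" by (rule mult_mat_vec_carrier[OF w_carrier pC])
    have wp: "(w 0 *\<^sub>v ?p) $ i = wcoef 0 (tau i) * ?p $ tau i" if "i < 2 * n" for i
      by (rule w_mult_vec_index[OF pC that])
    have wc: "wcoef 0 j = 1" using j by (simp add: wcoef_def)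
    show "(w 0 *\<^sub>v ?p) $ (j + 1) = 1" if "j + 1 < n"
    proof -
      have "tau (j + 1) = j" "j + 1 < 2 * n" using that by (auto simp: tau_def)
      then show ?thesis using wp[of "j + 1"] lead[of j] wc j by simp
    qed
    show "(w 0 *\<^sub>v ?p) $ i = 0" if "j + 1 < n" "j + 1 < i \<and> i < 2 * n" for i
    proof -
      have "j < tau i" using that by (auto simp: tau_def)
      then show ?thesis using wp[of i] lead[of "tau i"] tau_less[of i] that by simp
    qed
    show "(w 0 *\<^sub>v ?p) $ (2 * n - 1) = 1" if "j + 1 = n"
    proof -
      have "tau (2 * n - 1) = j" "2 * n - 1 < 2 * n" using that by (auto simp: tau_def)
      then show ?thesis using wp[of "2 * n - 1"] lead[of j] wc j by simp
    qed
  qed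
  have lead: "j < n \<Longrightarrow> \<exists>q\<in>CV. (F ^^ j) v = h *\<^sub>v q \<and> q $ j = 1 \<and> (\<forall>i. j < i \<and> i < 2 * n \<longrightarrow> q $ i = 0)" for j
  proof (induction j)
    case 0
    show ?case using mult_mat_unit_vec[OF hC pos] pos by (intro bexI[of _ "unit_vec (2 * n) 0"]) (auto simp: v_def)
  next
    case (Suc j)
    then obtain p where p: "p \<in> CV" "(F ^^ j) v = h *\<^sub>v p" "p $ j = 1" "\<forall>i. j < i \<and> i < 2 * n \<longrightarrow> p $ i = 0" by auto
    show ?case using step[OF p(1,3)] p(2,4) Suc.prems by fastforce
  qed
  obtain qn where qn: "qn \<in> CV" "(F ^^ n) v = h *\<^sub>v qn" "qn $ (2 * n - 1) = 1"
  proof -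
    obtain p where p: "p \<in> CV" "(F ^^ (n - 1)) v = h *\<^sub>v p" "p $ (n - 1) = 1" "\<forall>i. n - 1 < i \<and> i < 2 * n \<longrightarrow> p $ i = 0"
      using lead[of "n - 1"] n_ge_1 by auto
    obtain q where "q \<in> CV" "F (h *\<^sub>v p) = h *\<^sub>v q" "q $ (2 * n - 1) = 1"
      using step[OF p(1,3)] p(4) n_ge_1 by fastforce
    moreover have "(F ^^ n) v = F ((F ^^ (n - 1)) v)" using n_ge_1 by (cases n) auto
    ultimately show ?thesis using that p(2) by metis
  qed
  \<comment> \<open>v is the image under h of the first basis vector, which pairs only with the last
    coordinate.\<close>
  have form: "\<langle>v, h *\<^sub>v q\<rangle> = - (c * q $ (2 * n - 1))" if q: "q \<in> CV" for q
  proof -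
    have "\<langle>v, h *\<^sub>v q\<rangle> = \<langle>h *\<^sub>v unit_vec (2 * n) 0, h *\<^sub>v q\<rangle>" unfolding v_def mult_mat_unit_vec[OF hC pos] ..
    also have "\<dots> = c * \<langle>unit_vec (2 * n) 0, q\<rangle>" by (rule similitude_form[OF sh unit_vec_carrier q])
    also have "\<langle>unit_vec (2 * n) 0, q\<rangle> = (\<Sum>i<2 * n. if i = 0 then - q $ (2 * n - 1) else 0)"
      unfolding sform_sum[OF unit_vec_carrier q] by (intro sum.cong) (auto simp: unit_vec_def)
    finally show ?thesis using pos by simp
  qed
  have \<alpha>v: "\<alpha> v = - c" using form[OF qn(1)] qn(2,3) by (simp add: alpha_def)
  have "\<langle>v, (F ^^ i) v\<rangle> = 0" if i: "1 \<le> i" "i \<le> n - 1" for i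
  proof -
    have "i < n" using i n_ge_1 by simp
    then obtain q where "q \<in> CV" "(F ^^ i) v = h *\<^sub>v q" "\<forall>l. i < l \<and> l < 2 * n \<longrightarrow> q $ l = 0" using lead by blast
    then show ?thesis using form[of q] \<open>i < n\<close> by simp
  qed
  then have v: "v \<in> VS" using vC \<alpha>v c(1) by (auto simp: V_symp_def)
  have fix\<alpha>: "sg (\<alpha> v) = \<alpha> v" unfolding \<alpha>v by (simp add: sg_minus sgc)
  \<comment> \<open>Its first n columns are the vectors with leading 1 found above, and
    \<open>U_from_upper_half\<close> settles the remaining ones.\<close>
  define Z where "Z = symp_inv n c h * g0 v"
  have ZC: "Z \<in> carrier_mat (2 * n) (2 * n)" unfolding Z_def by (rule mult_carrier_mat[OF symp_inv_carrier g_mat_carrier])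
  have sZ: "similitude n Z 1"
    using similitude_mult[OF similitude_symp_inv[OF sh c(1)] g0_similitude[OF v]] c(1) \<alpha>v by (simp add: Z_def)
  have hZ: "h * Z = g0 v"
  proof -
    have "h * Z = h * symp_inv n c h * g0 v"
      unfolding Z_def by (rule assoc_mult_mat[symmetric, OF hC symp_inv_carrier g_mat_carrier])
    also have "\<dots> = g0 v" unfolding symp_inv(2)[OF sh c(1)] by (rule left_mult_one_mat[OF g_mat_carrier])
    finally show ?thesis .
  qed
  have Zcol: "\<exists>q\<in>CV. col Z j = q \<and> q $ j = 1 \<and> (\<forall>i. j < i \<and> i < 2 * n \<longrightarrow> q $ i = 0)" if j: "j < n" for j
  proof -
    obtain q where q: "q \<in> CV" "(F ^^ j) v = h *\<^sub>v q" "q $ j = 1" "\<forall>i. j < i \<and> i < 2 * n \<longrightarrow> q $ i = 0" using lead[OF j] by auto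
    have j2: "j < 2 * n" using j by simp
    have "col Z j = symp_inv n c h *\<^sub>v col (g0 v) j" unfolding Z_def by (rule col_mult2[OF symp_inv_carrier g_mat_carrier j2])
    also have "col (g0 v) j = h *\<^sub>v q" using j vC by (simp add: basis_vec_def q(2))
    also have "symp_inv n c h *\<^sub>v (h *\<^sub>v q) = symp_inv n c h * h *\<^sub>v q"
      by (rule assoc_mult_mat_vec[symmetric, OF symp_inv_carrier hC q(1)])
    also have "\<dots> = q" using symp_inv(1)[OF sh c(1)] q(1) by simp
    finally show ?thesis using q by blast
  qed
  have ZU: "Z \<in> U"
  proof (rule U_from_upper_half[OF sZ])
    show "Z $$ (j, j) = 1" if "j < n" for j
    proof -
      have "Z $$ (j, j) = col Z j $ j" using that ZC by simp
      then show ?thesis using Zcol[OF that] by auto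
    qed
    show "Z $$ (i, j) = 0" if "j < n" "j < i" "i < 2 * n" for i j
    proof -
      have "Z $$ (i, j) = col Z j $ i" using that ZC by simp
      then show ?thesis using Zcol[OF that(1)] that by auto
    qed
  qed
  have "lcoset (g0 v) U = lcoset h U" using lcoset_mult_right[OF U_group hC ZU] hZ by simp
  also have "\<dots> = lcoset g U" unfolding h_def by (rule lcoset_mult_right[OF U_group gC xy(1)])
  finally show ?thesis using v fix\<alpha> g(2) by blast
qed

end

section \<open>The isomorphisms at infinite level\<close>

text \<open>Two parametrizations by the same set leave exactly one compatible map between their
  images; extensionality removes the freedom outside \<open>A\<close>.\<close>

lemma ex1_bij_from_parametrizations:
  assumes f: "bij_betw f S A" and g: "bij_betw g S B"
  shows "\<exists>!\<Phi>. \<Phi> \<in> extensional A \<and> bij_betw \<Phi> A B \<and> (\<forall>v\<in>S. f v \<in> A \<and> \<Phi> (f v) = g v)"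
proof (rule ex1I)
  let ?\<Phi> = "restrict (g \<circ> inv_into S f) A"
  have inv: "inv_into S f (f v) = v" if "v \<in> S" for v using f that by (simp add: bij_betw_def)
  have fA: "f v \<in> A" if "v \<in> S" for v using f that by (auto simp: bij_betw_def)
  have "bij_betw (g \<circ> inv_into S f) A B" by (rule bij_betw_trans[OF bij_betw_inv_into[OF f] g])
  then have "bij_betw ?\<Phi> A B" by (rule bij_betw_cong[THEN iffD1, rotated]) simp
  then show "?\<Phi> \<in> extensional A \<and> bij_betw ?\<Phi> A B \<and> (\<forall>v\<in>S. f v \<in> A \<and> ?\<Phi> (f v) = g v)"
    using inv fA by simp
  fix \<Phi> assume \<Phi>: "\<Phi> \<in> extensional A \<and> bij_betw \<Phi> A B \<and> (\<forall>v\<in>S. f v \<in> A \<and> \<Phi> (f v) = g v)"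
  show "\<Phi> = ?\<Phi>"
  proof (rule extensionalityI)
    fix a assume a: "a \<in> A"
    then obtain v where v: "v \<in> S" "a = f v" using f by (auto simp: bij_betw_def)
    then show "\<Phi> a = ?\<Phi> a" using \<Phi> inv fA by simp
  qed (use \<Phi> in auto)
qed

context coxeter
begin

section \<open>The rationality condition on \<alpha>\<close>

abbreviation fl :: nat where "fl \<equiv> k * n div 2"
abbreviation LR :: "'l vec set" where "LR \<equiv> L_symp_rat D n k"

text \<open>A fixed element comes from K, and dividing it by pi^m makes it a unit there. In this
  form the condition can be tested on limits.\<close>

lemma unit_multiple_iff:
  "x \<in> (\<lambda>u. pi ^ m * u) ` unitsK D \<longleftrightarrow> x \<noteq> 0 \<and> sg x = x \<and> ordL D x = int m"
proof
  assume "x \<in> (\<lambda>u. pi ^ m * u) ` unitsK D"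
  then obtain a where "x = pi ^ m * \<iota> a" "a \<noteq> 0" "ordK D a = 0" by (auto simp: unitsK_def)
  then show "x \<noteq> 0 \<and> sg x = x \<and> ordL D x = int m"
    by (simp add: sg_mult sg_power ord_mult ord_embK)
next
  assume x: "x \<noteq> 0 \<and> sg x = x \<and> ordL D x = int m"
  then obtain a where a: "x = \<iota> a" using frobenius_fixed by blast
  then have a0: "a \<noteq> 0" using x by auto
  then have oa: "ordK D a = int m" using x a ord_embK by simp
  let ?b = "a / unifK D ^ m"
  have "ordK D ?b = 0" using a0 oa by (simp add: K.ord_divide K.ord_power)
  moreover have "x = pi ^ m * \<iota> ?b" unfolding a by (simp add: embK_divide embK_power)
  ultimately show "x \<in> (\<lambda>u. pi ^ m * u) ` unitsK D"
    using a0 unfolding unitsK_def by (intro image_eqI[of _ _ "\<iota> ?b"]) auto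
qed

lemma LR_iff:
  "v \<in> LR \<longleftrightarrow> v \<in> VS \<and> v \<in> Lat D n k \<and> sg (\<alpha> v) = \<alpha> v \<and> ordL D (\<alpha> v) = int fl"
  using V_sympD(3)[of v] unfolding L_symp_rat_def by (auto simp: unit_multiple_iff)

text \<open>Marks the coordinates in which \<open>Lat_h h\<close> has exponent h - 1 instead of
  h.\<close>

definition eps :: "nat \<Rightarrow> int" where
  "eps i = (if k = 0 then 0 else if even n \<and> n \<le> i then 0 else if even i then 0 else 1)"

lemma eps01: "0 \<le> eps i" "eps i \<le> 1" by (auto simp: eps_def)

lemma Lat_h_iff: "x \<in> Lat_h D n k h \<longleftrightarrow> x \<in> CV \<and> (\<forall>i<2 * n. x $ i \<in> P (int h - eps i))"
proof -
  have "(if k = 0 then int h else if even n \<and> n < Suc i then int h else if odd (Suc i) then int h else int h - 1) =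
      int h - eps i" for i
    by (auto simp: eps_def)
  then show ?thesis unfolding Lat_h_def lattice_of_iff by simp
qed

section \<open>The limit of the X_h\<close>

lemma Lat_h_carrier: "x \<in> Lat_h D n k h \<Longrightarrow> x \<in> CV"
  by (simp add: Lat_h_iff)

lemma Lat_h_zero: "0\<^sub>v (2 * n) \<in> Lat_h D n k h"
  by (simp add: Lat_h_iff)

lemma Lat_h_add: "x \<in> Lat_h D n k h \<Longrightarrow> y \<in> Lat_h D n k h \<Longrightarrow> x + y \<in> Lat_h D n k h"
  unfolding Lat_h_iff by (auto intro!: ppow_add)

lemma Lat_h_diff: "x \<in> Lat_h D n k h \<Longrightarrow> y \<in> Lat_h D n k h \<Longrightarrow> x - y \<in> Lat_h D n k h"
  unfolding Lat_h_iff by (auto intro!: ppow_diff)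

lemma Lat_h_mono: "x \<in> Lat_h D n k h \<Longrightarrow> h' \<le> h \<Longrightarrow> x \<in> Lat_h D n k h'"
  unfolding Lat_h_iff by (auto intro: ppow_mono)

lemma vclass_self: "v \<in> CV \<Longrightarrow> v \<in> vclass D n k h v"
  unfolding vclass_def by (rule image_eqI[OF _ Lat_h_zero]) simp

lemma vclass_eq_iff:
  assumes u: "u \<in> CV" and v: "v \<in> CV"
  shows "vclass D n k h u = vclass D n k h v \<longleftrightarrow> u - v \<in> Lat_h D n k h"
proof
  assume "vclass D n k h u = vclass D n k h v"
  then obtain x where x: "x \<in> Lat_h D n k h" "u = v + x" using vclass_self[OF u, of h] by (auto simp: vclass_def)
  then have "u - v = x" using v Lat_h_carrier[OF x(1)] by (intro eq_vecI) auto
  then show "u - v \<in> Lat_h D n k h" using x by simp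
next
  assume d: "u - v \<in> Lat_h D n k h"
  show "vclass D n k h u = vclass D n k h v"
  proof
    show "vclass D n k h u \<subseteq> vclass D n k h v"
    proof
      fix y assume "y \<in> vclass D n k h u"
      then obtain x where x: "x \<in> Lat_h D n k h" "y = u + x" by (auto simp: vclass_def)
      then have "y = v + ((u - v) + x)" using u v Lat_h_carrier[OF x(1)] by (intro eq_vecI) auto
      then show "y \<in> vclass D n k h v" unfolding vclass_def using Lat_h_add[OF d x(1)] by blast
    qed
    show "vclass D n k h v \<subseteq> vclass D n k h u"
    proof
      fix y assume "y \<in> vclass D n k h v"
      then obtain x where x: "x \<in> Lat_h D n k h" "y = v + x" by (auto simp: vclass_def)
      then have "y = u + (x - (u - v))" using u v Lat_h_carrier[OF x(1)] by (intro eq_vecI) auto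
      then show "y \<in> vclass D n k h u" unfolding vclass_def using Lat_h_diff[OF x(1) d] by blast
    qed
  qed
qed

lemma X_proj_vclass:
  assumes v: "v \<in> CV"
  shows "X_proj D n k h (vclass D n k (h + 1) v) = vclass D n k h v"
proof
  show "X_proj D n k h (vclass D n k (h + 1) v) \<subseteq> vclass D n k h v"
  proof
    fix y assume "y \<in> X_proj D n k h (vclass D n k (h + 1) v)"
    then obtain a b where ab: "a \<in> Lat_h D n k (h + 1)" "b \<in> Lat_h D n k h" "y = v + a + b"
      by (auto simp: X_proj_def vclass_def)
    have "a + b \<in> Lat_h D n k h" using Lat_h_add[OF Lat_h_mono[OF ab(1)] ab(2)] by simp
    moreover have "y = v + (a + b)" using v Lat_h_carrier[OF ab(1)] Lat_h_carrier[OF ab(2)] ab(3) by simp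
    ultimately show "y \<in> vclass D n k h v" by (auto simp: vclass_def)
  qed
  show "vclass D n k h v \<subseteq> X_proj D n k h (vclass D n k (h + 1) v)"
    using vclass_self[OF v, of "h + 1"] by (auto simp: X_proj_def vclass_def[of D n k h])
qed

lemma coef_integral: "coef i \<in> P 0"
  by (simp add: ppow_iff ord_coef)

lemma F_funpow_ppow:
  "x \<in> CV \<Longrightarrow> (\<And>i. i < 2 * n \<Longrightarrow> x $ i \<in> P N) \<Longrightarrow> i < 2 * n \<Longrightarrow> (F ^^ j) x $ i \<in> P N"
proof (induction j arbitrary: i)
  case (Suc j)
  have "(F ^^ j) x $ tau i \<in> P N" by (rule Suc.IH[OF Suc.prems(1,2) tau_less[OF Suc.prems(3)]])
  then show ?case using F_index[OF F_funpow_carrier[OF Suc.prems(1), of j] Suc.prems(3)]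
    by (simp add: ppow_mult_left coef_integral)
qed simp

text \<open>Replace one argument at a time. Since b has integral entries, \<open>F\<close> preserves
  integral vectors and congruences between them.\<close>

lemma iterate_form_cong:
  assumes u: "u \<in> CV" "\<And>i. i < 2 * n \<Longrightarrow> u $ i \<in> P 0" and v: "v \<in> CV" "\<And>i. i < 2 * n \<Longrightarrow> v $ i \<in> P 0"
    and d: "\<And>i. i < 2 * n \<Longrightarrow> (v - u) $ i \<in> P N"
  shows "\<langle>v, (F ^^ j) v\<rangle> - \<langle>u, (F ^^ j) u\<rangle> \<in> P N"
proof -
  have c: "v - u \<in> CV" using u v by simp
  have "\<langle>v, (F ^^ j) v\<rangle> - \<langle>u, (F ^^ j) u\<rangle> = \<langle>v - u, (F ^^ j) v\<rangle> + \<langle>u, (F ^^ j) (v - u)\<rangle>"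
    using u(1) v(1) by (simp add: F_funpow_diff sform_bilinear)
  moreover have "\<langle>v - u, (F ^^ j) v\<rangle> \<in> P N"
    using sform_ppow[OF c F_funpow_carrier[OF v(1)] d F_funpow_ppow[OF v], of j] by simp
  moreover have "\<langle>u, (F ^^ j) (v - u)\<rangle> \<in> P N"
    using sform_ppow[OF u(1) F_funpow_carrier[OF c] u(2) F_funpow_ppow[OF c d], of j] by simp
  ultimately show ?thesis by (simp only: ppow_add)
qed

lemma Lat_integral: "x \<in> Lat D n k \<Longrightarrow> i < 2 * n \<Longrightarrow> x $ i \<in> P 0"
proof -
  assume "x \<in> Lat D n k" "i < 2 * n"
  then have "x $ i \<in> P (if even n \<and> n \<le> i \<and> even i then int k else 0)" by (simp only: Lat_iff)
  then show "x $ i \<in> P 0" by (rule ppow_mono) simp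
qed

lemma v_classes_X_limit:
  assumes v: "v \<in> LR"
  shows "v_classes D n k v \<in> X_limit D n k"
proof -
  have v': "v \<in> VS" "v \<in> Lat D n k" using v by (auto simp: LR_iff)
  obtain u where u: "u \<in> unitsK D" "\<alpha> v = pi ^ fl * u" using v by (auto simp: L_symp_rat_def)
  have "vclass D n k h v \<in> X_level D n k h" for h
    unfolding X_level_def using v' V_sympD(2)[OF v'(1)] u by (intro imageI) (auto intro!: bexI[of _ u])
  then show ?thesis using X_proj_vclass[OF V_sympD(1)[OF v'(1)]]
    by (auto simp: X_limit_def v_classes_def)
qed

lemma v_classes_inj: "inj_on (v_classes D n k) LR"
proof (rule inj_onI)
  fix u v assume uv: "u \<in> LR" "v \<in> LR" and eq: "v_classes D n k u = v_classes D n k v"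
  then have C: "u \<in> CV" "v \<in> CV" using V_sympD(1) by (auto simp: LR_iff)
  have "u $ i - v $ i = 0" if i: "i < 2 * n" for i
  proof (rule ppow_all_zero)
    fix m :: nat
    have "v_classes D n k u (Suc m) = v_classes D n k v (Suc m)" using eq by simp
    then have "u - v \<in> Lat_h D n k (Suc m)" using vclass_eq_iff[OF C] by (simp add: v_classes_def)
    then have "(u - v) $ i \<in> P (int (Suc m) - eps i)" using i by (simp add: Lat_h_iff)
    then have "(u - v) $ i \<in> P (int m)" by (rule ppow_mono) (use eps01[of i] in simp)
    then show "u $ i - v $ i \<in> P (int m)" using C i by simp
  qed
  then show "u = v" using C by (intro eq_vecI) auto
qed

text \<open>Representatives of the successive classes converge coordinatewise. Their defining
  congruences have moduli shrinking to 0, so they become equalities for the limit.\<close>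

lemma X_limit_surj:
  assumes x: "x \<in> X_limit D n k"
  shows "x \<in> v_classes D n k ` LR"
proof -
  have lev: "x (Suc m) \<in> X_level D n k (Suc m)" for m using x by (auto simp: X_limit_def)
  have proj: "X_proj D n k (Suc m) (x (Suc (Suc m))) = x (Suc m)" for m using x by (auto simp: X_limit_def)
  have "\<exists>u t. x (Suc m) = vclass D n k (Suc m) u \<and> u \<in> Lat D n k \<and>
      (\<forall>i. 1 \<le> i \<and> i \<le> n - 1 \<longrightarrow> \<langle>u, (F ^^ i) u\<rangle> \<in> P (int (Suc m) + int (k * i div 2))) \<and>
      t \<in> unitsK D \<and> \<alpha> u - pi ^ fl * t \<in> P (int (Suc m) + int fl)" for m
    using lev[of m] unfolding X_level_def by auto
  then obtain u t where u: "\<And>m. x (Suc m) = vclass D n k (Suc m) (u m)" "\<And>m. u m \<in> Lat D n k"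
      "\<And>m i. 1 \<le> i \<and> i \<le> n - 1 \<Longrightarrow> \<langle>u m, (F ^^ i) (u m)\<rangle> \<in> P (int (Suc m) + int (k * i div 2))"
      "\<And>m. t m \<in> unitsK D" "\<And>m. \<alpha> (u m) - pi ^ fl * t m \<in> P (int (Suc m) + int fl)" by metis
  have uC: "u m \<in> CV" for m using u(2) by (simp add: Lat_iff)
  have step: "u (Suc m) - u m \<in> Lat_h D n k (Suc m)" for m
  proof -
    have "vclass D n k (Suc m) (u (Suc m)) = vclass D n k (Suc m) (u m)"
      using proj[of m] X_proj_vclass[OF uC, of "Suc m" "Suc m"] by (simp add: u(1))
    then show ?thesis using vclass_eq_iff[OF uC uC] by blast
  qed
  \<comment> \<open>The estimate keeps the exact exponent of \<open>Lat_h\<close> in each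
    coordinate, so that the limit lies in the very class of u m; the weaker exponent m is enough for
    the form.\<close>
  have "\<exists>y. \<forall>m. y - u m $ i \<in> P (int m + (1 - eps i))" if i: "i < 2 * n" for i
  proof -
    have "u (Suc m) $ i - u m $ i \<in> P (int m + (1 - eps i))" for m
    proof -
      have "(u (Suc m) - u m) $ i \<in> P (int (Suc m) - eps i)" using step[of m] i by (simp only: Lat_h_iff)
      moreover have "int (Suc m) - eps i = int m + (1 - eps i)" by simp
      moreover have "(u (Suc m) - u m) $ i = u (Suc m) $ i - u m $ i" using uC[of m] i by simp
      ultimately show ?thesis by (simp only:)
    qed
    from complete_seq[of "\<lambda>m. u m $ i" "1 - eps i", OF this] show ?thesis by blast
  qed
  then obtain y where y: "\<And>i m. i < 2 * n \<Longrightarrow> y i - u m $ i \<in> P (int m + (1 - eps i))" by metis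
  define v where "v = vec (2 * n) y"
  have vC: "v \<in> CV" by (simp add: v_def)
  have d: "(v - u m) $ i \<in> P (int m + (1 - eps i))" if "i < 2 * n" for i m
    using y[OF that] that uC[of m] by (simp add: v_def)
  have dm: "(v - u m) $ i \<in> P (int m)" if "i < 2 * n" for i m
    by (rule ppow_mono[OF d[OF that]]) (use eps01[of i] in simp)
  have close: "v - u m \<in> Lat_h D n k (Suc m)" for m
  proof -
    have "int (Suc m) - eps i = int m + (1 - eps i)" for i by simp
    then show ?thesis
      unfolding Lat_h_iff using d[where m = m] minus_carrier_vec[OF vC uC[of m]] by (simp only: simp_thms) blast
  qed
  have xv: "x (Suc m) = vclass D n k (Suc m) v" for m
    unfolding u(1) using vclass_eq_iff[OF vC uC] close by blast
  have vL: "v \<in> Lat D n k"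
    unfolding Lat_iff
  proof (intro conjI allI impI)
    fix i assume i: "i < 2 * n"
    let ?e = "if even n \<and> n \<le> i \<and> even i then int k else 0"
    \<comment> \<open>A congruence modulo p decides membership in \<open>Lat\<close>, whose
      exponents are at most k and hence at most 1.\<close>
    have "(v - u 1) $ i \<in> P ?e" by (rule ppow_mono[OF dm[OF i]]) (use k01 in auto)
    moreover have "u 1 $ i \<in> P ?e" using u(2)[of 1] i by (simp only: Lat_iff)
    ultimately have "(v - u 1) $ i + u 1 $ i \<in> P ?e" by (rule ppow_add)
    then show "v $ i \<in> P ?e" using i vC uC[of 1] by simp
  qed (rule vC)
  have cong: "\<langle>v, (F ^^ j) v\<rangle> - \<langle>u m, (F ^^ j) (u m)\<rangle> \<in> P (int m)" for j m
    by (rule iterate_form_cong[OF uC Lat_integral[OF u(2)] vC Lat_integral[OF vL] dm])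
  have van: "\<langle>v, (F ^^ i) v\<rangle> = 0" if "1 \<le> i \<and> i \<le> n - 1" for i
  proof (rule ppow_all_zero)
    fix m :: nat
    have "\<langle>u m, (F ^^ i) (u m)\<rangle> \<in> P (int m)" by (rule ppow_mono[OF u(3)[OF that]]) simp
    from ppow_add[OF cong[of i m] this] show "\<langle>v, (F ^^ i) v\<rangle> \<in> P (int m)" by simp
  qed
  have t: "pi ^ fl * t m \<noteq> 0" "sg (pi ^ fl * t m) = pi ^ fl * t m" "ordL D (pi ^ fl * t m) = int fl" for m
    using unit_multiple_iff[of "pi ^ fl * t m" fl] u(4)[of m] by auto
  have \<alpha>t: "\<alpha> v - pi ^ fl * t m \<in> P (int m)" for m
  proof -
    have "\<alpha> (u m) - pi ^ fl * t m \<in> P (int m)" by (rule ppow_mono[OF u(5)]) simp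
    moreover have "\<alpha> v - \<alpha> (u m) \<in> P (int m)" using cong[of n m] by (simp add: alpha_def)
    ultimately show ?thesis using ppow_trans by blast
  qed
  have "sg (\<alpha> v) - \<alpha> v = 0"
  proof (rule ppow_all_zero)
    fix m :: nat
    have "sg (\<alpha> v - pi ^ fl * t m) \<in> P (int m)" using \<alpha>t by (simp only: sg_ppow_iff)
    then have "sg (\<alpha> v) - pi ^ fl * t m \<in> P (int m)" by (simp only: sg_diff t)
    from ppow_diff[OF this \<alpha>t[of m]] show "sg (\<alpha> v) - \<alpha> v \<in> P (int m)" by simp
  qed
  then have fixed: "sg (\<alpha> v) = \<alpha> v" by simp
  \<comment> \<open>One level beyond \<open>fl\<close> suffices to transfer the valuation to
    \<alpha> v and to exclude \<alpha> v = 0.\<close>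
  have "\<alpha> v - pi ^ fl * t (Suc fl) \<in> P (ordL D (pi ^ fl * t (Suc fl)) + 1)"
    unfolding t(3) by (rule ppow_mono[OF \<alpha>t]) simp
  from ord_cong[OF this t(1)] have \<alpha>v: "\<alpha> v \<noteq> 0" "ordL D (\<alpha> v) = int fl" using t(3) by auto
  have "v \<in> VS" unfolding V_symp_def using vC van \<alpha>v(1) by auto
  then have vLR: "v \<in> LR" using vL fixed \<alpha>v(2) by (simp add: LR_iff)
  moreover have "x = v_classes D n k v"
  proof (rule extensionalityI[of _ "{1..}"])
    show "x \<in> extensional {1..}" using x by (auto simp: X_limit_def PiE_def)
    fix h :: nat assume "h \<in> {1..}"
    then obtain m where "h = Suc m" by (cases h) auto
    then show "x h = v_classes D n k v h" using xv by (simp add: v_classes_def)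
  qed (simp add: v_classes_def)
  ultimately show ?thesis by blast
qed

lemma v_classes_bij: "bij_betw (v_classes D n k) LR (X_limit D n k)"
  unfolding bij_betw_def using v_classes_inj v_classes_X_limit X_limit_surj by blast

section \<open>The limits over r and m\<close>

lemma g_classes_dot_limit:
  assumes v: "v \<in> VS" and fixed: "sg (\<alpha> v) = \<alpha> v" and Y: "\<And>r m. m < r \<Longrightarrow> gI r m v \<in> Y r m"
  shows "g_classes D n k v \<in> dot_limit D n k Y"
proof -
  have "sg (\<alpha> v) / \<alpha> v - 1 = 0" using fixed V_sympD(3)[OF v] by simp
  then have "(gI (r + 1) m v, gI r m v) \<in> r_transition D n k r m" for r m
    unfolding r_transition_def using v by fastforce
  then show ?thesis using Y m_projection_gI by (auto simp: dot_limit_def g_classes_def)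
qed

lemma dot_limit_mono:
  assumes "\<And>r m. m < r \<Longrightarrow> Y r m \<subseteq> Y' r m"
  shows "dot_limit D n k Y \<subseteq> dot_limit D n k Y'"
proof
  fix x assume x: "x \<in> dot_limit D n k Y"
  have "x \<in> (\<Pi>\<^sub>E (r, m)\<in>{(r, m). m < r}. Y r m)" using x by (simp add: dot_limit_def)
  then have "x \<in> (\<Pi>\<^sub>E (r, m)\<in>{(r, m). m < r}. Y' r m)"
    using assms[THEN subsetD] by (auto simp: PiE_iff)
  then show "x \<in> dot_limit D n k Y'" using x by (simp add: dot_limit_def)
qed

lemma X_dot_L_subset: "m < r \<Longrightarrow> X_dot_L D n k r m \<subseteq> X_dot D n k r m"
  unfolding X_dot_L_def using g_mat_X_dot by (auto simp: LR_iff)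

text \<open>\<open>F\<close> and \<open>V\<close> do not lower the norm, and the coefficients of the
  recursion are integral, so the whole basis stays in the unit ball along with v.\<close>

lemma basis_vec_weight:
  assumes v: "v \<in> VS" and vL: "weight_ge 0 v"
  shows "weight_ge 0 (basis_vec v j)"
proof -
  have FL: "weight_ge 0 ((F ^^ j) v)" for j by (rule weight_ge_mono[OF weight_ge_funpow[OF vL]]) simp
  have "weight_ge 0 (GG v i)" for i
  proof (induction i)
    case 0
    show ?case unfolding GG.simps(1) by (rule weight_ge_smult[OF vL sign_in_ppow])
  next
    case (Suc i)
    have V: "weight_ge 0 (V (GG v i))" by (rule weight_ge_mono[OF weight_ge_V[OF Suc]]) simp
    have "- cc v i \<in> P 0" using cc_integral[OF v, of i] by (simp only: ppow_minus_iff)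
    then have "weight_ge 0 (V (GG v i) + (- cc v i) \<cdot>\<^sub>v v)" by (intro weight_ge_add V weight_ge_smult vL)
    moreover have "V (GG v i) + (- cc v i) \<cdot>\<^sub>v v = V (GG v i) - cc v i \<cdot>\<^sub>v v"
      using V_sympD(1)[OF v] by (intro eq_vecI) auto
    ultimately show ?case unfolding GG.simps(2) G_step_eq
      using weight_ge_smult[OF _ uu_integral[OF v]] by simp
  qed
  then show ?thesis using FL by (auto simp: basis_vec_def)
qed

lemma Lam_weight:
  assumes v: "v \<in> VS" and vL: "weight_ge 0 v" and x: "x \<in> Lam v 0"
  shows "weight_ge 0 x"
proof -
  obtain z where z: "z \<in> CV" "\<forall>i<2 * n. z $ i \<in> P 0" "x = g0 v *\<^sub>v z" using LamE[OF x] by blast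
  have half: "y = 0 \<or> 0 \<le> 2 * ordL D y + W i \<longleftrightarrow> y \<in> half_ppow (- W i)" for y i
    by (auto simp: half_ppow_def)
  have "x $ i \<in> half_ppow (- W i)" if i: "i < 2 * n" for i
    unfolding z(3) mult_mat_vec_index[OF g_mat_carrier z(1) i]
  proof (rule half_ppow_sum)
    fix c assume "c \<in> {..<2 * n}"
    then have c: "c < 2 * n" by simp
    have "g0 v $$ (i, c) = basis_vec v c $ i" using g_mat_index[OF V_sympD(1)[OF v] i c] by simp
    moreover have "basis_vec v c $ i \<in> half_ppow (- W i)"
      using basis_vec_weight[OF v vL, of c] i by (simp add: weight_ge_def half)
    moreover have "z $ c \<in> half_ppow 0" using z(2) c by (auto simp: half_ppow_def ppow_def)
    ultimately show "g0 v $$ (i, c) * z $ c \<in> half_ppow (- W i)"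
      using half_ppow_mult[of "basis_vec v c $ i" "- W i" "z $ c" 0] by simp
  qed
  then show ?thesis using Lam_carrier[OF x] by (simp add: weight_ge_def half)
qed

text \<open>A point of the limit comes from some v with \<alpha> v in K. That v lies in
  \<open>LR\<close> is decided at the component (1, 0): there v differs from some u in
  \<open>LR\<close> by an element of p times the lattice of u, which is contained in
  \<open>Lat\<close>, and \<alpha> keeps its valuation.\<close>

lemma g_classes_L_bij: "bij_betw (g_classes D n k) LR (dot_limit D n k (X_dot_L D n k))"
  unfolding bij_betw_def
proof (intro conjI equalityI subsetI)
  show "inj_on (g_classes D n k) LR" using g_classes_inj by (intro inj_onI) (auto simp: LR_iff)
  fix x
  show "x \<in> dot_limit D n k (X_dot_L D n k)" if "x \<in> g_classes D n k ` LR"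
    using that g_classes_dot_limit by (fastforce simp: LR_iff X_dot_L_def)
  assume x: "x \<in> dot_limit D n k (X_dot_L D n k)"
  obtain v where v: "v \<in> VS" "\<alpha> v \<in> KtimesL D" "x = g_classes D n k v" using dot_limit_subset[OF x] by blast
  have "x (1, 0) \<in> X_dot_L D n k 1 0" using x by (auto simp: dot_limit_def PiE_iff)
  then obtain u where u: "u \<in> LR" "x (1, 0) = gI 1 0 u" by (auto simp: X_dot_L_def)
  have uV: "u \<in> VS" "u \<in> Lat D n k" "ordL D (\<alpha> u) = int fl" using u(1) by (auto simp: LR_iff)
  have eq: "gI 1 0 v = gI 1 0 u" using u(2) v(3) by (simp add: g_classes_def)
  have close: "v - u \<in> Lam u 1"
    using first_column_close[OF uV(1) V_sympD(1)[OF v(1)] _ gI_eqD[OF uV(1) eq]] by simp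
  have "ordL D (\<alpha> v) = int fl" using close_alpha(2)[OF uV(1) _ close V_sympD(1)[OF v(1)]] uV(3) by simp
  moreover have "v \<in> Lat D n k"
  proof -
    have "v \<in> Lam u 0"
      by (rule Lam_cong_integral[OF self_Lam[OF uV(1)] close _ V_sympD(1)[OF v(1)]]) simp
    then show ?thesis using Lam_weight[OF uV(1)] uV(2) by (simp add: Lat_iff_weight)
  qed
  ultimately have "v \<in> LR" using v(1,2) by (simp add: LR_iff KtimesL_iff)
  then show "x \<in> g_classes D n k ` LR" using v(3) by blast
qed

lemma g_classes_bij:
  "bij_betw (g_classes D n k) {v \<in> VS. \<alpha> v \<in> KtimesL D} (dot_limit D n k (X_dot D n k))"
  unfolding bij_betw_def
proof (intro conjI equalityI subsetI)
  show "inj_on (g_classes D n k) {v \<in> VS. \<alpha> v \<in> KtimesL D}" using g_classes_inj by (intro inj_onI) auto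
  fix x
  show "x \<in> dot_limit D n k (X_dot D n k)" if x: "x \<in> g_classes D n k ` {v \<in> VS. \<alpha> v \<in> KtimesL D}"
  proof -
    obtain v where "v \<in> VS" "sg (\<alpha> v) = \<alpha> v" "x = g_classes D n k v" using x by (auto simp: KtimesL_iff)
    then show ?thesis using g_classes_dot_limit g_mat_X_dot by simp
  qed
  assume "x \<in> dot_limit D n k (X_dot D n k)"
  then show "x \<in> g_classes D n k ` {v \<in> VS. \<alpha> v \<in> KtimesL D}" using dot_limit_subset by blast
qed

lemma g0_U_bij:
  "bij_betw (\<lambda>v. lcoset (g0 v) U) {v \<in> VS. \<alpha> v \<in> KtimesL D} (X_U D n k)"
  unfolding bij_betw_def
proof (intro conjI equalityI subsetI)
  show "inj_on (\<lambda>v. lcoset (g0 v) U) {v \<in> VS. \<alpha> v \<in> KtimesL D}" using g0_U_inj by (intro inj_onI) auto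
  fix C
  show "C \<in> X_U D n k" if "C \<in> (\<lambda>v. lcoset (g0 v) U) ` {v \<in> VS. \<alpha> v \<in> KtimesL D}"
    using that g_mat_X_U by (auto simp: KtimesL_iff)
  assume "C \<in> X_U D n k"
  then obtain v where "v \<in> VS" "sg (\<alpha> v) = \<alpha> v" "C = lcoset (g0 v) U" using X_U_surj by blast
  then show "C \<in> (\<lambda>v. lcoset (g0 v) U) ` {v \<in> VS. \<alpha> v \<in> KtimesL D}"
    using V_sympD(3) by (auto simp: KtimesL_iff)
qed

end

theorem theorem1p0p3:
  fixes D :: "('k::field, 'l::field) local_datum" and n k :: nat
  assumes "is_local_datum D" and "1 \<le> n" and "k \<in> {0, 1}"
  shows "bij_betw (v_classes D n k) (L_symp_rat D n k) (X_limit D n k) \<and>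
    bij_betw (g_classes D n k) (L_symp_rat D n k) (dot_limit D n k (X_dot_L D n k)) \<and>
    dot_limit D n k (X_dot_L D n k) \<subseteq> dot_limit D n k (X_dot D n k) \<and>
    (\<exists>!\<Phi>. \<Phi> \<in> extensional (dot_limit D n k (X_dot D n k)) \<and>
       bij_betw \<Phi> (dot_limit D n k (X_dot D n k)) (X_U D n k) \<and>
       (\<forall>v\<in>V_symp D n k. alpha D n k v \<in> KtimesL D \<longrightarrow>
          g_classes D n k v \<in> dot_limit D n k (X_dot D n k) \<and>
          \<Phi> (g_classes D n k v) = lcoset (g_mat D n k 0 v) (U_unip n)))"
proof -
  interpret coxeter D n k using assms by unfold_locales
  have "(\<forall>v\<in>{v \<in> VS. \<alpha> v \<in> KtimesL D}. Q v) \<longleftrightarrow> (\<forall>v\<in>VS. \<alpha> v \<in> KtimesL D \<longrightarrow> Q v)" for Q by auto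
  then show ?thesis
    using v_classes_bij g_classes_L_bij dot_limit_mono[OF X_dot_L_subset]
      ex1_bij_from_parametrizations[OF g_classes_bij g0_U_bij] by simp
qed

end
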